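(* Let $R$ be an $\mathbb F$-algebra admitting two well agreeing near weights $\rho$ and $\sigma$. Then: (1) $R$ is an integral domain and its quotient field $\mathbf K$ is an algebraic function field of one variable over $\mathbb F$; (2) there exist two different places $P,Q\in\mathbb P(\mathbf K)$ such that $\rho$ and $\sigma$ are derived from the valuations $v_P$ and $v_Q$, that is, for all $f\in R$: $\rho(f)=-\infty$ if $f=0$, $\rho(f)=0$ if $f\ne 0$ and $v_P(f)\ge 0$, and $\rho(f)=-v_P(f)$ if $v_P(f)<0$; and likewise $\sigma(f)=-\infty$ if $f=0$, $\sigma(f)=0$ if $f\neq 0$ and $v_Q(f)\ge 0$, and $\sigma(f)=-v_Q(f)$ if $v_Q(f)<0$; and (3) for these places $P,Q$, the integral closure $\bar R$ of $R$ in $\mathbf K$ satisfies $\bar R=\bigcap_{S\in\mathbb P(\mathbf K)\setminus\{P,Q\}}\mathcal O_S$.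
   Context: $\mathbb N_0$ is the set of nonnegative integers, $\mathbb N$ the set of positive integers. $\mathbb F$ is a field and $R$ is a commutative $\mathbb F$-algebra with $\mathbb F\subsetneq R$; $R^*=R\setminus\{0\}$, $\mathbb F^*=\mathbb F\setminus\{0\}$. For $\rho:R\to\mathbb N_0\cup\{-\infty\}$ put $\mathcal U_\rho^*=\{r\in R\setminus\{0\}:\rho(r)\le\rho(1)\}$, $\mathcal U_\rho=\mathcal U_\rho^*\cup\{0\}$, $\mathcal M_\rho=\{r\in R:\rho(r)>\rho(1)\}$. The function $\rho$ is a near weight if for all $f,g,h\in R$: (N0) $\rho(f)=-\infty$ iff $f=0$; (N1) $\rho(\lambda f)=\rho(f)$ for $\lambda\in\mathbb F^*$; (N2) $\rho(f+g)\le\max\{\rho(f),\rho(g)\}$; (N3) if $\rho(f)<\rho(g)$ then $\rho(fh)\le\rho(gh)$, and if moreover $h\in\mathcal M_\rho$ then $\rho(fh)<\rho(gh)$; (N4) if $\rho(f)=\rho(g)$ with $f,g\in\mathcal M_\rho$, then there is $\lambda\in\mathbb F^*$ with $\rho(f-\lambda g)<\rho(f)$; (N5) $\rho(fg)\le\rho(f)+\rho(g)$, with equality if $f,g\in\mathcal M_\rho$. Near weights are assumed normalized: $\rho(f)=0$ for $f\in\mathcal U_\rho^*$ and $\gcd\{\rho(f):f\in\mathcal M_\rho\}=1$. Two near weights $\rho,\sigma$ on $R$ agree well if $\mathbb N^2\setminus H$ is finite, where $H=\{(\rho(f),\sigma(f)):f\in R^*\}$, and $\mathcal U_\rho\cap\mathcal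 U_\sigma=\mathbb F$. $\mathbb P(\mathbf K)$ denotes the set of places of $\mathbf K$ over $\mathbb F$ (i.e. trivial on $\mathbb F$); for $S\in\mathbb P(\mathbf K)$, $v_S$ is the corresponding normalized discrete valuation and $\mathcal O_S$ its valuation ring. *)

theory Defs
  imports "HOL-Algebra.Algebra" "HOL-Library.Extended"
begin

section \<open>Near weights\<close>

text \<open>
  An \<open>F\<close>-algebra \<open>R\<close> with \<open>F\<close> properly contained in \<open>R\<close> is a commutative ring \<open>R\<close> together
  with a subfield \<open>F\<close> of \<open>R\<close> (a subset of the carrier), so that scalar multiplication is
  multiplication in \<open>R\<close>. The set of nonnegative integers together with minus infinity is
  encoded inside \<^typ>\<open>int extended\<close>, so that values of near weights can be compared with
  negated values of discrete valuations, which lie in the integers together with plus infinity.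
\<close>

definition nw_U_star :: "('a, 'b) ring_scheme \<Rightarrow> ('a \<Rightarrow> int extended) \<Rightarrow> 'a set" where
  "nw_U_star R \<rho> = {r \<in> carrier R - {\<zero>\<^bsub>R\<^esub>}. \<rho> r \<le> \<rho> \<one>\<^bsub>R\<^esub>}"

definition nw_U :: "('a, 'b) ring_scheme \<Rightarrow> ('a \<Rightarrow> int extended) \<Rightarrow> 'a set" where
  "nw_U R \<rho> = nw_U_star R \<rho> \<union> {\<zero>\<^bsub>R\<^esub>}"

definition nw_M :: "('a, 'b) ring_scheme \<Rightarrow> ('a \<Rightarrow> int extended) \<Rightarrow> 'a set" where
  "nw_M R \<rho> = {r \<in> carrier R. \<rho> r > \<rho> \<one>\<^bsub>R\<^esub>}"

locale near_weight = cring R for R :: "('a, 'b) ring_scheme" (structure) +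
  fixes F :: "'a set" and \<rho> :: "'a \<Rightarrow> int extended"
  assumes F_subfield: "subfield F R"
    and F_proper: "F \<subset> carrier R"
    and rho_range: "f \<in> carrier R \<Longrightarrow> \<rho> f \<in> insert Minf (Fin ` {0..})"
    and N0: "f \<in> carrier R \<Longrightarrow> \<rho> f = Minf \<longleftrightarrow> f = \<zero>"
    and N1: "\<lbrakk>f \<in> carrier R; l \<in> F - {\<zero>}\<rbrakk> \<Longrightarrow> \<rho> (l \<otimes> f) = \<rho> f"
    and N2: "\<lbrakk>f \<in> carrier R; g \<in> carrier R\<rbrakk> \<Longrightarrow> \<rho> (f \<oplus> g) \<le> max (\<rho> f) (\<rho> g)"
    and N3: "\<lbrakk>f \<in> carrier R; g \<in> carrier R; h \<in> carrier R; \<rho> f < \<rho> g\<rbrakk>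
      \<Longrightarrow> \<rho> (f \<otimes> h) \<le> \<rho> (g \<otimes> h)"
    and N3_strict: "\<lbrakk>f \<in> carrier R; g \<in> carrier R; h \<in> nw_M R \<rho>; \<rho> f < \<rho> g\<rbrakk>
      \<Longrightarrow> \<rho> (f \<otimes> h) < \<rho> (g \<otimes> h)"
    and N4: "\<lbrakk>f \<in> nw_M R \<rho>; g \<in> nw_M R \<rho>; \<rho> f = \<rho> g\<rbrakk>
      \<Longrightarrow> \<exists>l \<in> F - {\<zero>}. \<rho> (f \<ominus> l \<otimes> g) < \<rho> f"
    and N5: "\<lbrakk>f \<in> carrier R; g \<in> carrier R\<rbrakk> \<Longrightarrow> \<rho> (f \<otimes> g) \<le> \<rho> f + \<rho> g"
    and N5_eq: "\<lbrakk>f \<in> nw_M R \<rho>; g \<in> nw_M R \<rho>\<rbrakk> \<Longrightarrow> \<rho> (f \<otimes> g) = \<rho> f + \<rho> g"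

locale normalized_near_weight = near_weight +
  assumes normalized_U: "f \<in> nw_U_star R \<rho> \<Longrightarrow> \<rho> f = 0"
    and normalized_Gcd: "Gcd {n. \<exists>f \<in> nw_M R \<rho>. \<rho> f = Fin n} = 1"

definition agree_well ::
  "('a, 'b) ring_scheme \<Rightarrow> 'a set \<Rightarrow> ('a \<Rightarrow> int extended) \<Rightarrow> ('a \<Rightarrow> int extended) \<Rightarrow> bool" where
  "agree_well R F \<rho> \<sigma> \<longleftrightarrow>
     finite ((Fin ` {0<..}) \<times> (Fin ` {0<..}) - (\<lambda>f. (\<rho> f, \<sigma> f)) ` (carrier R - {\<zero>\<^bsub>R\<^esub>})) \<and>
     nw_U R \<rho> \<inter> nw_U R \<sigma> = F"


section \<open>The quotient field of an integral domain\<close>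

definition frac_rel :: "('a, 'b) ring_scheme \<Rightarrow> (('a \<times> 'a) \<times> ('a \<times> 'a)) set" where
  "frac_rel R = {((a, b), (c, d)).
     a \<in> carrier R \<and> b \<in> carrier R - {\<zero>\<^bsub>R\<^esub>} \<and>
     c \<in> carrier R \<and> d \<in> carrier R - {\<zero>\<^bsub>R\<^esub>} \<and> a \<otimes>\<^bsub>R\<^esub> d = c \<otimes>\<^bsub>R\<^esub> b}"

definition fract_class :: "('a, 'b) ring_scheme \<Rightarrow> 'a \<Rightarrow> 'a \<Rightarrow> ('a \<times> 'a) set" where
  "fract_class R a b = frac_rel R `` {(a, b)}"

definition quotient_field :: "('a, 'b) ring_scheme \<Rightarrow> ('a \<times> 'a) set ring" where
  "quotient_field R =
     \<lparr>carrier = (carrier R \<times> (carrier R - {\<zero>\<^bsub>R\<^esub>})) // frac_rel R,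
      monoid.mult = (\<lambda>p q. \<Union>{fract_class R (a \<otimes>\<^bsub>R\<^esub> c) (b \<otimes>\<^bsub>R\<^esub> d) | a b c d.
                       (a, b) \<in> p \<and> (c, d) \<in> q}),
      one = fract_class R \<one>\<^bsub>R\<^esub> \<one>\<^bsub>R\<^esub>,
      ring.zero = fract_class R \<zero>\<^bsub>R\<^esub> \<one>\<^bsub>R\<^esub>,
      ring.add = (\<lambda>p q. \<Union>{fract_class R (a \<otimes>\<^bsub>R\<^esub> d \<oplus>\<^bsub>R\<^esub> c \<otimes>\<^bsub>R\<^esub> b) (b \<otimes>\<^bsub>R\<^esub> d) | a b c d.
                      (a, b) \<in> p \<and> (c, d) \<in> q})\<rparr>"

definition to_frac :: "('a, 'b) ring_scheme \<Rightarrow> 'a \<Rightarrow> ('a \<times> 'a) set" where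
  "to_frac R a = fract_class R a \<one>\<^bsub>R\<^esub>"


section \<open>Algebraic function fields, places and valuations\<close>

text \<open>\<open>K\<close> is a finite extension of \<open>F(x)\<close> for some \<open>x\<close> transcendental over \<open>F\<close>.\<close>

definition function_field :: "('a, 'b) ring_scheme \<Rightarrow> 'a set \<Rightarrow> bool" where
  "function_field K F \<longleftrightarrow> field K \<and> subfield F K \<and>
     (\<exists>x \<in> carrier K. ring.transcendental K F x \<and>
        ring.finite_dimension K (generate_field K (insert x F)) (carrier K))"

definition valuation_ring :: "('a, 'b) ring_scheme \<Rightarrow> 'a set \<Rightarrow> 'a set \<Rightarrow> bool" where
  "valuation_ring K F A \<longleftrightarrow> subring A K \<and> F \<subset> A \<and> A \<subset> carrier K \<and>
     (\<forall>z \<in> carrier K - {\<zero>\<^bsub>K\<^esub>}. z \<in> A \<or> inv\<^bsub>K\<^esub> z \<in> A)"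

definition place_of :: "('a, 'b) ring_scheme \<Rightarrow> 'a set \<Rightarrow> 'a set \<Rightarrow> 'a set \<Rightarrow> bool" where
  "place_of K F A P \<longleftrightarrow> valuation_ring K F A \<and> maximalideal P (K\<lparr>carrier := A\<rparr>)"

text \<open>A place is the maximal ideal of a valuation ring; it determines this ring.\<close>

definition places :: "('a, 'b) ring_scheme \<Rightarrow> 'a set \<Rightarrow> 'a set set" where
  "places K F = {P. \<exists>A. place_of K F A P}"

definition place_ring :: "('a, 'b) ring_scheme \<Rightarrow> 'a set \<Rightarrow> 'a set \<Rightarrow> 'a set" where
  "place_ring K F P = (THE A. place_of K F A P)"

text \<open>
  The normalized discrete valuation at \<open>P\<close>: a nonzero \<open>z\<close> has value \<open>n\<close> iff \<open>z = t\<^sup>n u\<close> with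
  \<open>t\<close> a prime element at \<open>P\<close> (a generator of the ideal \<open>P\<close>) and \<open>u\<close> a unit of the valuation
  ring. The integer \<open>n\<close> does not depend on the choice of \<open>t\<close>.
\<close>

definition place_val :: "('a, 'b) ring_scheme \<Rightarrow> 'a set \<Rightarrow> 'a set \<Rightarrow> 'a \<Rightarrow> int extended" where
  "place_val K F P z =
     (let A = K\<lparr>carrier := place_ring K F P\<rparr> in
      if z = \<zero>\<^bsub>K\<^esub> then Pinf
      else Fin (THE n::int. \<exists>t \<in> carrier A. \<exists>u \<in> Units A.
                  P = PIdl\<^bsub>A\<^esub> t \<and> z = t [^]\<^bsub>K\<^esub> n \<otimes>\<^bsub>K\<^esub> u))"

definition derived_from ::
  "('a, 'b) ring_scheme \<Rightarrow> ('a \<Rightarrow> int extended) \<Rightarrow> ('a \<Rightarrow> int extended) \<Rightarrow> bool" where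
  "derived_from R \<rho> v \<longleftrightarrow> (\<forall>f \<in> carrier R.
     \<rho> f = (if f = \<zero>\<^bsub>R\<^esub> then Minf else if v f \<ge> 0 then 0 else - v f))"

text \<open>Polynomials are lists of coefficients, leading coefficient first, without leading zeros.\<close>

definition integral_closure :: "('a, 'b) ring_scheme \<Rightarrow> 'a set \<Rightarrow> 'a set" where
  "integral_closure K A = {z \<in> carrier K.
     \<exists>p \<in> carrier (A[X]\<^bsub>K\<^esub>). p \<noteq> [] \<and> lead_coeff p = \<one>\<^bsub>K\<^esub> \<and> ring.eval K p z = \<zero>\<^bsub>K\<^esub>}"

end

theory Submission
  imports Defs
begin

text \<open>
  Why the theorem is true. A near weight behaves like the order of a pole. Elements of positive
  weight for \<open>\<rho>\<close> or \<open>\<sigma>\<close> are not zero divisors, and the remaining elements lie in the field \<open>F\<close> by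
  agreement, so \<open>R\<close> is a domain. A minimality argument (\<open>ex_multiplier\<close>) shows that every nonzero \<open>f\<close> can be
  multiplied into the set of elements of positive weight by an element of that set. Therefore every nonzero
  fraction is \<open>a / b\<close> with \<open>a\<close> and \<open>b\<close> of positive weight, and \<open>v (a / b) = \<rho> b - \<rho> a\<close> defines a
  discrete valuation of the quotient field \<open>K\<close>, whose residue field is \<open>F\<close> by axiom \<open>N4\<close>
  (\<open>frac_val_rational\<close>). Doing this for both weights yields the places \<open>P\<close> and \<open>Q\<close>.

  From here on only the following data matter (locale \<open>two_point_ring\<close>): a subring \<open>R\<close> of \<open>K\<close> with
  quotient field \<open>K\<close>, two valuations \<open>v\<close> and \<open>w\<close> of \<open>K\<close> with residue field \<open>F\<close>, the fact that elements of
  \<open>R\<close> without poles at \<open>P\<close> and \<open>Q\<close> are constants, and the existence of elements of \<open>R\<close> with any two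
  large prescribed pole orders. The space \<open>L k l\<close> of elements of \<open>R\<close> with poles of order at most
  \<open>k\<close> and \<open>l\<close> has dimension at most \<open>k + l + 1\<close>, since each unit of pole order costs at most one
  dimension. Comparing this growth with that of \<open>F[f]\<close>-multiples gives
  \<open>[K : F(f)] \<le> - v f - w f\<close> for every \<open>f \<in> R\<close> (\<open>pol_independent_card\<close>). Any \<open>f\<close> with a pole is
  transcendental, so \<open>K\<close> is a function field.

  The same inequality shows that \<open>P\<close> and \<open>Q\<close> are the only places at which elements of \<open>R\<close> have
  poles: at a third pole, weak approximation would produce
  \<open>- v f - w f + 1\<close> elements of \<open>K\<close> that are linearly independent over \<open>F(f)\<close>
  (\<open>third_valuation_contains_ring\<close>). So the valuation rings containing \<open>R\<close> are those of the places
  other than \<open>P\<close> and \<open>Q\<close>, and the integral closure of a subring of a field is the intersection of the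
  valuation rings above it (\<open>integral_closure_in_valuation_ring\<close> and
  \<open>valuation_ring_avoiding_non_integral\<close>).
\<close>

section \<open>Auxiliary facts on rings and fields\<close>

lemma (in ring) add_minus_cancel:
  assumes "x \<in> carrier R" "y \<in> carrier R"
  shows "(x \<oplus> y) \<oplus> \<ominus> y = x" "(x \<oplus> y) \<oplus> \<ominus> x = y"
proof -
  show *: "(x \<oplus> y) \<oplus> \<ominus> y = x" using assms by (simp add: a_assoc r_neg)
  show "(x \<oplus> y) \<oplus> \<ominus> x = y" unfolding a_comm[OF assms] using assms by (simp add: a_assoc r_neg)
qed

lemma (in ring) nat_pow_in_subring:
  assumes "subring A R" "x \<in> A" shows "x [^] (n::nat) \<in> A"
  by (induction n) (use subringE(3,6)[OF assms(1)] assms(2) in auto)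

lemma (in ring) finsum_in_subring:
  assumes A: "subring A R" and I: "finite I" "\<And>i. i \<in> I \<Longrightarrow> g i \<in> A"
  shows "(\<Oplus>i\<in>I. g i) \<in> A"
  using I
proof (induction I)
  case empty
  then show ?case using subringE(2)[OF A] by simp
next
  case (insert i I)
  have "(\<Oplus>j\<in>insert i I. g j) = g i \<oplus> (\<Oplus>j\<in>I. g j)"
    by (rule finsum_insert) (use insert.hyps insert.prems subringE(1)[OF A] in blast)+
  then show ?case using insert subringE(7)[OF A] by simp
qed

lemma (in field) inv_nonzero:
  assumes "z \<in> carrier R" "z \<noteq> \<zero>"
  shows "inv z \<in> carrier R" "inv z \<noteq> \<zero>" "z \<otimes> inv z = \<one>" "inv z \<otimes> z = \<one>" "inv (inv z) = z"
proof -
  have u: "z \<in> Units R" using assms field_Units by blast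
  then show "inv z \<in> carrier R" "z \<otimes> inv z = \<one>" "inv z \<otimes> z = \<one>" "inv (inv z) = z" by auto
  then show "inv z \<noteq> \<zero>" using assms by fastforce
qed

lemma (in field) inv_of_mult:
  assumes "x \<in> carrier R" "x \<noteq> \<zero>" "y \<in> carrier R" "y \<noteq> \<zero>"
  shows "inv (x \<otimes> y) = inv x \<otimes> inv y"
proof (rule comm_inv_char)
  have "x \<otimes> y \<otimes> (inv x \<otimes> inv y) = (x \<otimes> inv x) \<otimes> (y \<otimes> inv y)"
    using assms inv_nonzero by (simp add: m_ac)
  then show "x \<otimes> y \<otimes> (inv x \<otimes> inv y) = \<one>" using assms inv_nonzero by simp
qed (use assms inv_nonzero in auto)

lemma (in field) pow_inverse_cancel:
  assumes "z \<in> carrier R" "u \<in> carrier R" "z \<otimes> u = \<one>"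
  shows "z [^] (n::nat) \<otimes> u [^] n = \<one>"
  using assms by (simp add: nat_pow_distrib[symmetric])

lemma (in ring) finsum_remove:
  assumes "finite J" "i \<in> J" "g \<in> J \<rightarrow> carrier R"
  shows "(\<Oplus>j\<in>J. g j) = g i \<oplus> (\<Oplus>j\<in>J - {i}. g j)"
proof -
  have "(\<Oplus>j\<in>insert i (J - {i}). g j) = g i \<oplus> (\<Oplus>j\<in>J - {i}. g j)"
    by (rule finsum_insert) (use assms in auto)
  then show ?thesis using assms(2) by (simp add: insert_absorb)
qed

lemma (in ring) finsum_product:
  assumes "finite I" "finite J" "\<And>i j. i \<in> I \<Longrightarrow> j \<in> J \<Longrightarrow> g i j \<in> carrier R"
  shows "(\<Oplus>p\<in>I \<times> J. g (fst p) (snd p)) = (\<Oplus>i\<in>I. \<Oplus>j\<in>J. g i j)"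
  using assms(1,3)
proof (induction I)
  case empty
  then show ?case by simp
next
  case (insert i I)
  have cl: "(\<lambda>j. g i' j) \<in> J \<rightarrow> carrier R" if "i' \<in> insert i I" for i'
    using insert.prems that by auto
  have "(\<Oplus>p\<in>insert i I \<times> J. g (fst p) (snd p)) =
      (\<Oplus>p\<in>Pair i ` J \<union> I \<times> J. g (fst p) (snd p))"
    by (rule arg_cong[where f = "finsum R _"]) auto
  also have "\<dots> = (\<Oplus>p\<in>Pair i ` J. g (fst p) (snd p)) \<oplus> (\<Oplus>p\<in>I \<times> J. g (fst p) (snd p))"
    by (rule finsum_Un_disjoint) (use insert assms(2) in auto)
  also have "(\<Oplus>p\<in>Pair i ` J. g (fst p) (snd p)) = (\<Oplus>j\<in>J. g (fst (i, j)) (snd (i, j)))"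
    by (rule add.finprod_reindex) (use insert.prems in \<open>auto simp: inj_on_def\<close>)
  also have "(\<Oplus>p\<in>I \<times> J. g (fst p) (snd p)) = (\<Oplus>i\<in>I. \<Oplus>j\<in>J. g i j)"
    using insert.IH insert.prems by simp
  also have "(\<Oplus>j\<in>J. g (fst (i, j)) (snd (i, j))) \<oplus> (\<Oplus>i\<in>I. \<Oplus>j\<in>J. g i j) =
      (\<Oplus>i\<in>insert i I. \<Oplus>j\<in>J. g i j)"
    using cl by (subst finsum_insert) (use insert.hyps in \<open>auto intro!: finsum_closed\<close>)
  finally show ?case .
qed

lemma (in ring) finsum_in_Span:
  assumes K: "subfield K R" and Us: "set Us \<subseteq> carrier R"
    and I: "finite I" "\<And>i. i \<in> I \<Longrightarrow> k i \<in> K" "\<And>i. i \<in> I \<Longrightarrow> u i \<in> set Us"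
  shows "(\<Oplus>i\<in>I. k i \<otimes> u i) \<in> Span K Us"
  using I
proof (induction I)
  case empty
  then show ?case using Span_subgroup_props(2)[OF K Us] by simp
next
  case (insert i I)
  have c: "k j \<otimes> u j \<in> carrier R" if "j \<in> insert i I" for j
    using insert.prems(1)[OF that] insert.prems(2)[OF that] Us subfieldE(3)[OF K] by blast
  have "k i \<otimes> u i \<in> Span K Us"
    using Span_smult_closed[OF K Us] Span_base_incl[OF K Us] insert.prems by blast
  moreover have "(\<Oplus>j\<in>insert i I. k j \<otimes> u j) = k i \<otimes> u i \<oplus> (\<Oplus>j\<in>I. k j \<otimes> u j)"
    by (rule finsum_insert) (use insert.hyps c in auto)
  ultimately show ?case using insert Span_subgroup_props(3)[OF K Us] by auto
qed

section \<open>Valuation rings and their places\<close>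

text \<open>
  In a valuation ring this is the maximal ideal. Zero is listed separately because its inverse is an
  unspecified element.
\<close>

definition nonunits :: "('a, 'b) ring_scheme \<Rightarrow> 'a set \<Rightarrow> 'a set" where
  "nonunits K A = {z \<in> A. z = \<zero>\<^bsub>K\<^esub> \<or> inv\<^bsub>K\<^esub> z \<notin> A}"

lemma valuation_ringD:
  assumes "valuation_ring K F A"
  shows "subring A K" "F \<subset> A" "A \<subset> carrier K"
    "\<And>z. z \<in> carrier K \<Longrightarrow> z \<noteq> \<zero>\<^bsub>K\<^esub> \<Longrightarrow> z \<notin> A \<Longrightarrow> inv\<^bsub>K\<^esub> z \<in> A"
  using assms unfolding valuation_ring_def by auto

lemma (in field) unit_of_subring:
  assumes "subring A R" "x \<in> A" "y \<in> A" "x \<otimes> y \<notin> nonunits R A"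
  shows "x \<notin> nonunits R A"
proof -
  note s = subringE[OF assms(1)]
  have c: "x \<in> carrier R" "y \<in> carrier R" using s(1) assms by auto
  have xy: "x \<otimes> y \<noteq> \<zero>" "inv (x \<otimes> y) \<in> A"
    using assms s(6) unfolding nonunits_def by auto
  then have nz: "x \<noteq> \<zero>" "y \<noteq> \<zero>" using c by auto
  have "inv x = y \<otimes> inv (x \<otimes> y)"
    using c nz inv_nonzero[OF c(1)] inv_nonzero[OF c(2)]
    by (simp add: inv_of_mult m_lcomm[of y "inv x"])
  then show ?thesis using s(6) assms(3) xy nz unfolding nonunits_def by auto
qed

lemma (in field) nonunits_mult:
  assumes "subring A R" "x \<in> nonunits R A" "y \<in> A"
  shows "x \<otimes> y \<in> nonunits R A"
  using unit_of_subring[OF assms(1) _ assms(3)] assms(2) unfolding nonunits_def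
  by blast

text \<open>
  Of the quotients \<open>y / x\<close> and \<open>x / y\<close> one lies in \<open>A\<close>; say \<open>y / x\<close>. Then \<open>x + y\<close> is the product of the
  nonunit \<open>x\<close> and the element \<open>1 + y / x\<close> of \<open>A\<close>.
\<close>

lemma (in field) nonunits_add:
  assumes vr: "valuation_ring R F A" and x: "x \<in> nonunits R A" and y: "y \<in> nonunits R A"
  shows "x \<oplus> y \<in> nonunits R A"
proof -
  note s = subringE[OF valuation_ringD(1)[OF vr]]
  have *: "x \<oplus> y \<in> nonunits R A"
    if x: "x \<in> nonunits R A" "x \<noteq> \<zero>" and y: "y \<in> nonunits R A" and q: "inv x \<otimes> y \<in> A" for x y
  proof -
    have c: "x \<in> carrier R" "y \<in> carrier R" using s(1) x y unfolding nonunits_def by auto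
    have "x \<oplus> y = x \<otimes> (\<one> \<oplus> inv x \<otimes> y)"
      using c x inv_nonzero[OF c(1)] by (simp add: r_distr m_assoc[symmetric])
    then show ?thesis using nonunits_mult[OF valuation_ringD(1)[OF vr] x(1)] s(3,7) q by metis
  qed
  have c: "x \<in> carrier R" "y \<in> carrier R" using s(1) x y unfolding nonunits_def by auto
  show ?thesis
  proof (cases "x = \<zero> \<or> y = \<zero>")
    case True then show ?thesis using c x y by auto
  next
    case False
    note i = inv_nonzero[OF c(1)] inv_nonzero[OF c(2)]
    have "inv (inv x \<otimes> y) = inv y \<otimes> x" using False c i by (simp add: inv_of_mult m_comm)
    then have "inv x \<otimes> y \<in> A \<or> inv y \<otimes> x \<in> A"
      using valuation_ringD(4)[OF vr, of "inv x \<otimes> y"] False c i by (metis integral_iff m_closed)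
    then show ?thesis using *[of x y] *[of y x] x y False a_comm c by metis
  qed
qed

lemma (in field) unit_not_nonunit:
  assumes "subring A R" shows "\<one> \<notin> nonunits R A"
  using subringE(3)[OF assms] unfolding nonunits_def by simp

lemma (in field) nonunits_ideal:
  assumes vr: "valuation_ring R F A"
  shows "ideal (nonunits R A) (R\<lparr>carrier := A\<rparr>)"
proof -
  note sr = valuation_ringD(1)[OF vr]
  note s = subringE[OF sr]
  interpret A: ring "R\<lparr>carrier := A\<rparr>" by (rule subring_is_ring[OF sr])
  show ?thesis
  proof (rule idealI[OF A.ring_axioms])
    show "subgroup (nonunits R A) (add_monoid (R\<lparr>carrier := A\<rparr>))"
    proof (rule A.add.subgroupI)
      show "nonunits R A \<subseteq> carrier (R\<lparr>carrier := A\<rparr>)" by (auto simp: nonunits_def)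
      show "nonunits R A \<noteq> {}" using s(2) by (auto simp: nonunits_def)
      fix a assume a: "a \<in> nonunits R A"
      then have aA: "a \<in> A" "a \<in> carrier R" using s(1) by (auto simp: nonunits_def)
      have "a \<otimes> (\<ominus> \<one>) \<in> nonunits R A" using nonunits_mult[OF sr a] s(3,5) by auto
      moreover have "a \<otimes> (\<ominus> \<one>) = \<ominus> a" using aA by (simp add: r_minus)
      moreover have "\<ominus>\<^bsub>R\<lparr>carrier := A\<rparr>\<^esub> a = \<ominus> a"
        by (rule A.minus_equality) (use aA s(5) in \<open>auto simp: l_neg\<close>)
      ultimately show "\<ominus>\<^bsub>R\<lparr>carrier := A\<rparr>\<^esub> a \<in> nonunits R A" by simp
    qed (use nonunits_add[OF vr] in auto)
  next
    fix a x assume h: "a \<in> nonunits R A" "x \<in> carrier (R\<lparr>carrier := A\<rparr>)"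
    then have c: "a \<in> carrier R" "x \<in> carrier R" using s(1) by (auto simp: nonunits_def)
    show "a \<otimes>\<^bsub>R\<lparr>carrier := A\<rparr>\<^esub> x \<in> nonunits R A" using nonunits_mult[OF sr] h by simp
    then show "x \<otimes>\<^bsub>R\<lparr>carrier := A\<rparr>\<^esub> a \<in> nonunits R A" using c by (simp add: m_comm)
  qed
qed

lemma (in field) proper_ideal_nonunits:
  assumes vr: "valuation_ring R F A" and J: "ideal J (R\<lparr>carrier := A\<rparr>)" "J \<noteq> A"
  shows "J \<subseteq> nonunits R A"
proof
  note sr = valuation_ringD(1)[OF vr]
  note s = subringE[OF sr]
  interpret J: ideal J "R\<lparr>carrier := A\<rparr>" by (rule J(1))
  have JA: "J \<subseteq> A" using J.a_subset by auto
  fix x assume x: "x \<in> J"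
  show "x \<in> nonunits R A"
  proof (rule ccontr)
    assume "x \<notin> nonunits R A"
    then have u: "x \<noteq> \<zero>" "inv x \<in> A" using x JA by (auto simp: nonunits_def)
    have xc: "x \<in> carrier R" using x JA s(1) by auto
    have "\<one> \<in> J" using J.I_l_closed[OF x, of "inv x"] u inv_nonzero[OF xc u(1)] by simp
    then have "A \<subseteq> J" using J.one_imp_carrier by simp
    then show False using J(2) JA by auto
  qed
qed

lemma (in field) valuation_ring_place:
  assumes vr: "valuation_ring R F A"
  shows "place_of R F A (nonunits R A)"
proof -
  note sr = valuation_ringD(1)[OF vr]
  have ne: "nonunits R A \<noteq> A" using unit_not_nonunit[OF sr] subringE(3)[OF sr] by auto
  have "maximalideal (nonunits R A) (R\<lparr>carrier := A\<rparr>)"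
    by (rule maximalidealI[OF nonunits_ideal[OF vr]])
      (use ne proper_ideal_nonunits[OF vr] in auto)
  then show ?thesis using vr unfolding place_of_def by simp
qed

lemma (in field) place_eq_nonunits:
  assumes "place_of R F A P"
  shows "P = nonunits R A"
proof -
  have vr: "valuation_ring R F A" and m: "maximalideal P (R\<lparr>carrier := A\<rparr>)"
    using assms unfolding place_of_def by auto
  interpret P: maximalideal P "R\<lparr>carrier := A\<rparr>" by (rule m)
  have "P \<subseteq> nonunits R A"
    by (rule proper_ideal_nonunits[OF vr P.ideal_axioms]) (use P.I_notcarr in auto)
  then have "nonunits R A = P \<or> nonunits R A = A"
    using P.I_maximal[OF nonunits_ideal[OF vr]] by (auto simp: nonunits_def)
  then show ?thesis
    using unit_not_nonunit subringE(3) valuation_ringD(1)[OF vr] by blast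
qed

text \<open>
  An element is missing from a valuation ring exactly if its inverse is a nonunit, so the maximal
  ideal remembers the ring. This makes the definite description in \<open>place_ring\<close> meaningful.
\<close>

lemma (in field) place_determines_ring:
  assumes "place_of R F A P"
  shows "A = {z \<in> carrier R. z = \<zero> \<or> inv z \<notin> P}"
proof -
  have vr: "valuation_ring R F A" using assms unfolding place_of_def by auto
  note s = subringE[OF valuation_ringD(1)[OF vr]]
  have P: "P = nonunits R A" by (rule place_eq_nonunits[OF assms])
  show ?thesis
  proof (intro equalityI subsetI)
    fix z assume z: "z \<in> A"
    then show "z \<in> {z \<in> carrier R. z = \<zero> \<or> inv z \<notin> P}"
      using s(1) inv_nonzero[of z] unfolding P nonunits_def by auto
  next
    fix z assume z: "z \<in> {z \<in> carrier R. z = \<zero> \<or> inv z \<notin> P}"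
    then show "z \<in> A"
      using s(2) inv_nonzero[of z] valuation_ringD(4)[OF vr, of z] unfolding P nonunits_def
      by (cases "z = \<zero>") auto
  qed
qed

lemma (in field) place_ring_eq:
  assumes "place_of R F A P"
  shows "place_ring R F P = A"
  unfolding place_ring_def
  using assms place_determines_ring by (intro the_equality) blast+

section \<open>Integral closure as an intersection of valuation rings\<close>

lemma (in field) eval_times_inverse_power:
  assumes "subring A R" "z \<in> carrier R" "u \<in> A" "z \<otimes> u = \<one>" "set q \<subseteq> A"
  shows "\<exists>a\<in>A. eval q z \<otimes> u [^] length q = u \<otimes> a"
  using assms(5)
proof (induction q)
  case Nil
  then show ?case using subringE(1,2)[OF assms(1)] assms(3) by (auto intro!: bexI[of _ \<zero>])
next
  case (Cons c q)
  note s = subringE[OF assms(1)]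
  from Cons obtain a where a: "a \<in> A" "eval q z \<otimes> u [^] length q = u \<otimes> a" by auto
  have qc: "set q \<subseteq> carrier R" using Cons.prems s(1) by auto
  have c: "c \<in> carrier R" "u \<in> carrier R" "a \<in> carrier R" "eval q z \<in> carrier R"
    using s(1) Cons.prems a(1) assms eval_in_carrier[OF qc assms(2)] by auto
  let ?n = "length q"
  have p: "z [^] ?n \<otimes> u [^] ?n = \<one>"
    by (rule pow_inverse_cancel) (use assms c in auto)
  have "eval (c # q) z \<otimes> u [^] length (c # q)
      = (c \<otimes> z [^] ?n \<oplus> eval q z) \<otimes> (u [^] ?n \<otimes> u)" by simp
  also have "\<dots> = c \<otimes> (z [^] ?n \<otimes> u [^] ?n) \<otimes> u \<oplus> (eval q z \<otimes> u [^] ?n) \<otimes> u"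
    using c assms(2) by (simp add: l_distr m_assoc)
  also have "\<dots> = u \<otimes> (c \<oplus> u \<otimes> a)"
    unfolding p a(2) using c by (simp add: r_distr m_ac)
  finally show ?case using s(6,7) Cons.prems a(1) assms(3) by (intro bexI[of _ "c \<oplus> u \<otimes> a"]) auto
qed

text \<open>
  If \<open>z\<close> were outside \<open>A\<close>, then \<open>u = 1 / z\<close> would lie in \<open>A\<close>. Dividing a monic equation of
  degree \<open>n\<close> for \<open>z\<close> by \<open>z\<close> to the \<open>n\<close> gives \<open>1 + u a = 0\<close> with \<open>a \<in> A\<close>, so that \<open>z = - a\<close> is in \<open>A\<close> after all.
\<close>

lemma (in field) integral_closure_in_valuation_ring:
  assumes vr: "valuation_ring R F A" and B: "subring B R" "B \<subseteq> A"
    and z: "z \<in> integral_closure R B"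
  shows "z \<in> A"
proof (rule ccontr)
  assume zA: "z \<notin> A"
  note sr = valuation_ringD(1)[OF vr]
  note s = subringE[OF sr]
  from z obtain p where zc: "z \<in> carrier R" and p: "p \<in> carrier (B[X]\<^bsub>R\<^esub>)" "p \<noteq> []"
    "lead_coeff p = \<one>" "eval p z = \<zero>"
    unfolding integral_closure_def by auto
  then obtain q where q: "p = \<one> # q" by (cases p) auto
  have qA: "set q \<subseteq> A" using p(1) q B(2) by (auto simp: univ_poly_carrier[symmetric] polynomial_def)
  then have qc: "set q \<subseteq> carrier R" using s(1) by auto
  have z0: "z \<noteq> \<zero>" using zA s(2) by auto
  define u where "u = inv z"
  have u: "u \<in> A" "u \<in> carrier R" "z \<otimes> u = \<one>"
    using valuation_ringD(4)[OF vr zc z0 zA] inv_nonzero[OF zc z0] unfolding u_def by auto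
  obtain a where a: "a \<in> A" "eval q z \<otimes> u [^] length q = u \<otimes> a"
    using eval_times_inverse_power[OF sr zc u(1,3) qA] by auto
  have ac: "a \<in> carrier R" using a s(1) by auto
  have "\<zero> = (z [^] length q \<oplus> eval q z) \<otimes> u [^] length q"
    using p(4) q zc u(2) by simp
  also have "\<dots> = \<one> \<oplus> u \<otimes> a"
    using zc u(2) eval_in_carrier[OF qc zc] pow_inverse_cancel[OF zc u(2,3)] a(2) by (simp add: l_distr)
  finally have "z \<otimes> (\<one> \<oplus> u \<otimes> a) = \<zero>" using zc by (metis r_null)
  then have "z \<oplus> a = \<zero>" using zc u ac by (simp add: r_distr m_assoc[symmetric])
  then have "z = \<ominus> a" using zc ac by (metis add.m_comm minus_equality)
  then show False using zA s(5) a(1) by simp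
qed

text \<open>
  The values at \<open>x\<close> of polynomials over \<open>B\<close> with at most \<open>n\<close> coefficients. Their union is the simple
  extension \<open>B[x]\<close>; the explicit bound on the degree serves the descent in
  \<open>maximal_subring_is_valuation\<close>.
\<close>

fun (in ring) bounded_pols :: "'a set \<Rightarrow> 'a \<Rightarrow> nat \<Rightarrow> 'a set" where
  "bounded_pols B x 0 = {\<zero>}"
| "bounded_pols B x (Suc n) = {y \<otimes> x \<oplus> b | y b. y \<in> bounded_pols B x n \<and> b \<in> B}"

context field
begin

lemma bounded_pols_carrier:
  assumes "B \<subseteq> carrier R" "x \<in> carrier R"
  shows "y \<in> bounded_pols B x n \<Longrightarrow> y \<in> carrier R"
proof (induction n arbitrary: y)
  case (Suc n)
  then obtain y' b where "y = y' \<otimes> x \<oplus> b" "y' \<in> bounded_pols B x n" "b \<in> B" by auto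
  then show ?case using Suc.IH[of y'] assms by auto
qed auto

lemma simple_extension_bounded_pols:
  "z \<in> simple_extension B x \<longleftrightarrow> (\<exists>n. z \<in> bounded_pols B x n)"
proof
  assume "z \<in> simple_extension B x"
  then show "\<exists>n. z \<in> bounded_pols B x n"
  proof induction
    case zero show ?case by (intro exI[of _ 0]) simp
  next
    case (lin k1 k2)
    then obtain n where "k1 \<in> bounded_pols B x n" by auto
    then show ?case using lin by (intro exI[of _ "Suc n"]) auto
  qed
next
  have "z \<in> simple_extension B x" if "z \<in> bounded_pols B x n" for n
    using that
  proof (induction n arbitrary: z)
    case (Suc n)
    then show ?case using simple_extension.lin by auto
  qed auto
  then show "\<exists>n. z \<in> bounded_pols B x n \<Longrightarrow> z \<in> simple_extension B x" by auto
qed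

lemma bounded_pols_add:
  assumes B: "subring B R" and x: "x \<in> carrier R"
  shows "\<lbrakk>y \<in> bounded_pols B x n; z \<in> bounded_pols B x n\<rbrakk> \<Longrightarrow> y \<oplus> z \<in> bounded_pols B x n"
proof (induction n arbitrary: y z)
  case (Suc n)
  note s = subringE[OF B]
  from Suc.prems obtain y' b z' c where e: "y = y' \<otimes> x \<oplus> b" "z = z' \<otimes> x \<oplus> c"
    "y' \<in> bounded_pols B x n" "b \<in> B" "z' \<in> bounded_pols B x n" "c \<in> B" by auto
  have c: "y' \<in> carrier R" "z' \<in> carrier R" "b \<in> carrier R" "c \<in> carrier R"
    using e s(1) bounded_pols_carrier[OF s(1) x] by auto
  have "y \<oplus> z = (y' \<oplus> z') \<otimes> x \<oplus> (b \<oplus> c)" unfolding e using c x by (simp add: l_distr a_ac)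
  then show ?case using Suc.IH[OF e(3,5)] s(7) e(4,6) by auto
qed auto

lemma bounded_pols_smult:
  assumes B: "subring B R" and x: "x \<in> carrier R" and a: "a \<in> B"
  shows "y \<in> bounded_pols B x n \<Longrightarrow> a \<otimes> y \<in> bounded_pols B x n"
proof (induction n arbitrary: y)
  case 0
  then show ?case using subringE(1)[OF B] a by auto
next
  case (Suc n)
  note s = subringE[OF B]
  from Suc.prems obtain y' b where e: "y = y' \<otimes> x \<oplus> b" "y' \<in> bounded_pols B x n" "b \<in> B" by auto
  have c: "y' \<in> carrier R" "b \<in> carrier R" "a \<in> carrier R"
    using e s(1) a bounded_pols_carrier[OF s(1) x] by auto
  have "a \<otimes> y = (a \<otimes> y') \<otimes> x \<oplus> a \<otimes> b" unfolding e using c x by (simp add: r_distr m_assoc)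
  then show ?case using Suc.IH[OF e(2)] s(6)[OF a e(3)] by auto
qed

lemma bounded_pols_mult_x:
  assumes B: "subring B R" and x: "x \<in> carrier R" and y: "y \<in> bounded_pols B x n"
  shows "y \<otimes> x \<in> bounded_pols B x (Suc n)"
proof -
  have "y \<otimes> x = y \<otimes> x \<oplus> \<zero>" using bounded_pols_carrier[OF subringE(1)[OF B] x y] x by simp
  then show ?thesis using y subringE(2)[OF B] unfolding bounded_pols.simps by blast
qed

lemma bounded_pols_mult_pow:
  assumes B: "subring B R" and x: "x \<in> carrier R" and y: "y \<in> bounded_pols B x n"
  shows "y \<otimes> x [^] k \<in> bounded_pols B x (n + k)"
proof (induction k)
  case 0
  then show ?case using bounded_pols_carrier[OF subringE(1)[OF B] x y] y by simp
next
  case (Suc k)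
  have "y \<otimes> x [^] Suc k = (y \<otimes> x [^] k) \<otimes> x"
    using bounded_pols_carrier[OF subringE(1)[OF B] x y] x by (simp add: m_assoc)
  then show ?case using bounded_pols_mult_x[OF B x Suc] by simp
qed

lemma bounded_pols_leading:
  assumes B: "subring B R" and x: "x \<in> carrier R" and y: "y \<in> bounded_pols B x (Suc n)"
  shows "\<exists>a\<in>B. \<exists>y'\<in>bounded_pols B x n. y = a \<otimes> x [^] n \<oplus> y'"
  using y
proof (induction n arbitrary: y)
  case 0
  then obtain b where "b \<in> B" "y = \<zero> \<otimes> x \<oplus> b" by auto
  then show ?case using x subringE(1)[OF B] by (intro bexI[of _ b] bexI[of _ \<zero>]) auto
next
  case (Suc n)
  note s = subringE[OF B]
  from Suc.prems obtain w b where e: "y = w \<otimes> x \<oplus> b" "w \<in> bounded_pols B x (Suc n)" "b \<in> B"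
    unfolding bounded_pols.simps(2)[of B x "Suc n"] by blast
  from Suc.IH[OF e(2)] obtain a w' where w: "a \<in> B" "w' \<in> bounded_pols B x n" "w = a \<otimes> x [^] n \<oplus> w'"
    by auto
  have c: "a \<in> carrier R" "w' \<in> carrier R" "b \<in> carrier R"
    using w e s(1) bounded_pols_carrier[OF s(1) x] by auto
  have "y = a \<otimes> x [^] Suc n \<oplus> (w' \<otimes> x \<oplus> b)"
    unfolding e(1) w(3) using c x by (simp add: l_distr m_assoc a_assoc)
  moreover have "w' \<otimes> x \<oplus> b \<in> bounded_pols B x (Suc n)" using w(2) e(3) by auto
  ultimately show ?case using w(1) by blast
qed

text \<open>Reversing the coefficients turns a polynomial in the inverse of \<open>x\<close> into one in \<open>x\<close>.\<close>

lemma bounded_pols_reverse: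
  assumes B: "subring B R" and x: "x \<in> carrier R" and u: "u \<in> carrier R" "u \<otimes> x = \<one>"
    and y: "y \<in> bounded_pols B u n"
  shows "\<exists>w \<in> bounded_pols B x n. y \<otimes> x [^] n = w \<otimes> x"
  using y
proof (induction n arbitrary: y)
  case 0
  then show ?case using x by auto
next
  case (Suc n)
  note s = subringE[OF B]
  from bounded_pols_leading[OF B u(1) Suc.prems] obtain a y' where
    e: "a \<in> B" "y' \<in> bounded_pols B u n" "y = a \<otimes> u [^] n \<oplus> y'" by auto
  from Suc.IH[OF e(2)] obtain w where w: "w \<in> bounded_pols B x n" "y' \<otimes> x [^] n = w \<otimes> x" by auto
  have c: "a \<in> carrier R" "w \<in> carrier R" "y' \<in> carrier R"
    using w e s(1) bounded_pols_carrier[OF s(1) x] bounded_pols_carrier[OF s(1) u(1)] by auto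
  have "y \<otimes> x [^] Suc n = (a \<otimes> (u [^] n \<otimes> x [^] n) \<oplus> y' \<otimes> x [^] n) \<otimes> x"
    unfolding e(3) using c x u(1) by (simp add: l_distr m_assoc)
  also have "\<dots> = (w \<otimes> x \<oplus> a) \<otimes> x"
    unfolding w(2) pow_inverse_cancel[OF u(1) x u(2)] using c x by (simp add: a_comm)
  finally show ?case using w(1) e(1) by auto
qed

lemma simple_extension_inverse_clear:
  assumes B: "subring B R" and c: "c \<in> B" and d: "d \<in> carrier R" "d \<otimes> c = \<one>"
    and z: "z \<in> simple_extension B d"
  shows "\<exists>n::nat. z \<otimes> c [^] n \<in> B"
  using z
proof induction
  case zero
  then show ?case using subringE(1,2)[OF B] c by (intro exI[of _ 0]) auto
next
  case (lin k1 k2)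
  note s = subringE[OF B]
  have cc: "c \<in> carrier R" "k2 \<in> carrier R" "k1 \<in> carrier R"
    using c lin s(1) simple_extension_in_carrier[OF s(1) d(1)] by auto
  from lin obtain n where n: "k1 \<otimes> c [^] (n::nat) \<in> B" by auto
  have pw: "c [^] (m::nat) \<in> B" for m
    by (induction m) (use s(3,6) c in auto)
  have "(k1 \<otimes> d \<oplus> k2) \<otimes> c [^] Suc n = k1 \<otimes> c [^] n \<otimes> (d \<otimes> c) \<oplus> k2 \<otimes> c [^] Suc n"
    using cc d(1) by (simp add: l_distr r_distr m_ac)
  also have "\<dots> = k1 \<otimes> c [^] n \<oplus> k2 \<otimes> c [^] Suc n" using cc d by simp
  also have "\<dots> \<in> B" using s(6,7) n pw lin(2) by blast
  finally show ?case by blast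
qed

lemma one_minus_power:
  assumes B: "subring B R" and u: "u \<in> B" and b: "b \<in> B"
  shows "\<exists>b'\<in>B. (\<one> \<ominus> u \<otimes> b) [^] (n::nat) = \<one> \<ominus> u \<otimes> b'"
proof (induction n)
  case 0
  then show ?case using subringE(1,2)[OF B] u by (intro bexI[of _ \<zero>]) (auto simp: a_minus_def)
next
  case (Suc n)
  note s = subringE[OF B]
  from Suc obtain b' where b': "b' \<in> B" "(\<one> \<ominus> u \<otimes> b) [^] (n::nat) = \<one> \<ominus> u \<otimes> b'" by auto
  have c: "u \<in> carrier R" "b \<in> carrier R" "b' \<in> carrier R" using s(1) u b b' by auto
  have "(\<one> \<ominus> u \<otimes> b) [^] Suc n = (\<one> \<ominus> u \<otimes> b') \<otimes> (\<one> \<ominus> u \<otimes> b)" using b'(2) by simp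
  also have "\<dots> = \<one> \<ominus> u \<otimes> (b \<oplus> b' \<oplus> \<ominus> (u \<otimes> b' \<otimes> b))"
    using c by algebra
  finally show ?case using s(5,6,7) u b b'(1) by (intro bexI[of _ "b \<oplus> b' \<oplus> \<ominus> (u \<otimes> b' \<otimes> b)"]) auto
qed

lemma maximal_subring_avoiding:
  assumes B0: "subring B0 R" and z0: "z \<notin> B0"
  obtains B where "subring B R" "B0 \<subseteq> B" "z \<notin> B"
    "\<And>C. \<lbrakk>subring C R; B \<subseteq> C; z \<notin> C\<rbrakk> \<Longrightarrow> C = B"
proof -
  let ?S = "{B. subring B R \<and> B0 \<subseteq> B \<and> z \<notin> B}"
  have "\<exists>M\<in>?S. \<forall>D\<in>?S. M \<subseteq> D \<longrightarrow> D = M"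
  proof (rule subset_Zorn_nonempty)
    show "?S \<noteq> {}" using assms by auto
    fix C assume C: "C \<noteq> {}" "subset.chain ?S C"
    then have CS: "C \<subseteq> ?S" by (auto simp: subset.chain_def)
    have tot: "D \<subseteq> Y \<or> Y \<subseteq> D" if "D \<in> C" "Y \<in> C" for D Y
      using C(2) that by (auto simp: subset.chain_def)
    have both: "\<exists>Z\<in>C. x \<in> Z \<and> y \<in> Z" if "x \<in> \<Union>C" "y \<in> \<Union>C" for x y
      using that tot by blast
    have sub: "subring D R" if "D \<in> C" for D using CS that by auto
    have "subring (\<Union>C) R"
    proof (rule subringI)
      show "\<Union>C \<subseteq> carrier R" using subringE(1)[OF sub] by auto
      show "\<one> \<in> \<Union>C" using subringE(3)[OF sub] C(1) by auto
      show "\<ominus> h \<in> \<Union>C" if "h \<in> \<Union>C" for h using subringE(5)[OF sub] that by auto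
      show "h1 \<otimes> h2 \<in> \<Union>C" if "h1 \<in> \<Union>C" "h2 \<in> \<Union>C" for h1 h2
        using both[OF that] subringE(6)[OF sub] by blast
      show "h1 \<oplus> h2 \<in> \<Union>C" if "h1 \<in> \<Union>C" "h2 \<in> \<Union>C" for h1 h2
        using both[OF that] subringE(7)[OF sub] by blast
    qed
    then show "\<Union>C \<in> ?S" using CS C(1) by auto
  qed
  then obtain M where "subring M R" "B0 \<subseteq> M" "z \<notin> M"
    "\<And>D. subring D R \<Longrightarrow> B0 \<subseteq> D \<Longrightarrow> z \<notin> D \<Longrightarrow> M \<subseteq> D \<Longrightarrow> D = M" by auto
  then show ?thesis using that by (metis order_trans)
qed

text \<open>
  Here \<open>B\<close> is maximal among the subrings that contain \<open>u = 1 / z\<close> but not \<open>z\<close>. Two consequences of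
  maximality carry the proof. Localizing \<open>B\<close> at \<open>1 - u b\<close> cannot add \<open>z\<close>, so every \<open>1 - u b\<close> is already
  a unit of \<open>B\<close>. And if neither \<open>x\<close> nor \<open>1 / x\<close> is in \<open>B\<close>, then \<open>z\<close> is a polynomial in \<open>x\<close> and also one
  in \<open>1 / x\<close>. Taking both of least degree, the polynomial in \<open>1 / x\<close>, whose constant term is
  absorbed by a unit, expresses the leading power of \<open>x\<close> by lower ones and so contradicts the
  choice of the degree.
\<close>

lemma maximal_subring_is_valuation:
  assumes B: "subring B R" and z: "z \<in> carrier R" "z \<noteq> \<zero>" "z \<notin> B" and u: "inv z \<in> B"
    and mx: "\<And>C. \<lbrakk>subring C R; B \<subseteq> C; z \<notin> C\<rbrakk> \<Longrightarrow> C = B"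
    and x: "x \<in> carrier R" "x \<noteq> \<zero>"
  shows "x \<in> B \<or> inv x \<in> B"
proof (rule ccontr)
  assume nx: "\<not> (x \<in> B \<or> inv x \<in> B)"
  note s = subringE[OF B]
  define u where "u = inv z"
  have u: "u \<in> B" "u \<in> carrier R" "u \<noteq> \<zero>" "u \<otimes> z = \<one>" "z \<otimes> u = \<one>"
    using u inv_nonzero[OF z(1,2)] unfolding u_def by auto
  have unit: "\<exists>d\<in>B. d \<otimes> (\<one> \<ominus> u \<otimes> b) = \<one>" if b: "b \<in> B" for b
  proof -
    define c where "c = \<one> \<ominus> u \<otimes> b"
    have bc: "b \<in> carrier R" using b s(1) by auto
    have no: "\<one> \<ominus> u \<otimes> b' \<noteq> u \<otimes> b''" if "b' \<in> B" "b'' \<in> B" for b' b''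
    proof
      assume "\<one> \<ominus> u \<otimes> b' = u \<otimes> b''"
      moreover have bc: "b' \<in> carrier R" "b'' \<in> carrier R" using that s(1) by auto
      moreover have "\<one> = (\<one> \<ominus> u \<otimes> b') \<oplus> u \<otimes> b'"
        using u(2) bc by (simp add: a_minus_def a_assoc l_neg)
      ultimately have "\<one> = u \<otimes> (b' \<oplus> b'')" using u(2) bc by (simp add: r_distr a_comm)
      then have "z = b' \<oplus> b''"
        using u bc z(1) by (metis a_closed l_one m_assoc r_one)
      then show False using z(3) s(7) that by auto
    qed
    have cB: "c \<in> B" unfolding c_def a_minus_def using s(3,5,6,7) u b by auto
    then have cc: "c \<in> carrier R" using s(1) by auto
    have c0: "c \<noteq> \<zero>" using no[OF b s(2)] u(2) unfolding c_def by simp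
    note d = inv_nonzero[OF cc c0]
    let ?C = "simple_extension B (inv c)"
    \<comment> \<open>if the localization contained \<open>z\<close>, clearing denominators would give \<open>1 - u b' = u b''\<close> in \<open>B\<close>\<close>
    have "z \<notin> ?C"
    proof
      assume "z \<in> ?C"
      then obtain n where n: "z \<otimes> c [^] (n::nat) \<in> B"
        using simple_extension_inverse_clear[OF B cB d(1,4)] by auto
      obtain b' where b': "b' \<in> B" "c [^] n = \<one> \<ominus> u \<otimes> b'"
        using one_minus_power[OF B u(1) b] unfolding c_def by metis
      have "c [^] n = u \<otimes> (z \<otimes> c [^] n)" using u z(1) cc by (simp add: m_assoc[symmetric])
      then show False using no[OF b'(1) n] b'(2) by simp
    qed
    then have "?C = B"
      using mx[OF simple_extension_is_subring[OF B d(1)] simple_extension_incl[OF s(1) d(1)]] by simp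
    then have "inv c \<in> B" using simple_extension_mem[OF B d(1)] by simp
    then show ?thesis using d(4) unfolding c_def by auto
  qed
  \<comment> \<open>the descent step, stated for \<open>y\<close> so that it applies to \<open>x\<close> and to its inverse\<close>
  have red: False
    if y: "y \<in> carrier R" "y \<noteq> \<zero>" "z \<in> bounded_pols B y n" "z \<in> bounded_pols B (inv y) m" "m \<le> n"
      and least: "\<And>k. k < n \<Longrightarrow> z \<notin> bounded_pols B y k" for y n m
  proof -
    note iy = inv_nonzero[OF y(1,2)]
    have "m \<noteq> 0" using y(4) z(2) by (intro notI) auto
    then obtain m' where m': "m = Suc m'" by (cases m) auto
    then obtain n' where n': "n = Suc n'" using y(5) by (cases n) auto
    from y(4) m' obtain c w where w: "w \<in> bounded_pols B (inv y) m'" "c \<in> B" "z = w \<otimes> inv y \<oplus> c"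
      by auto
    have wc: "w \<in> carrier R" "c \<in> carrier R"
      using w bounded_pols_carrier[OF s(1) iy(1)] s(1) by auto
    obtain d where d: "d \<in> B" "d \<otimes> (\<one> \<ominus> u \<otimes> c) = \<one>" using unit[OF w(2)] by auto
    have dc: "d \<in> carrier R" using d s(1) by auto
    \<comment> \<open>multiplying \<open>z = w / y + c\<close> by \<open>u\<close> isolates the constant term\<close>
    have "\<one> \<ominus> u \<otimes> c = u \<otimes> (w \<otimes> inv y)"
    proof -
      have "\<one> = u \<otimes> (w \<otimes> inv y \<oplus> c)" using u(4) w(3) by simp
      then have "\<one> = u \<otimes> (w \<otimes> inv y) \<oplus> u \<otimes> c" using u(2) wc iy(1) by (simp add: r_distr)
      then show ?thesis using u(2) wc iy(1) by (simp add: minus_eq a_assoc r_neg)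
    qed
    then have one: "\<one> = d \<otimes> u \<otimes> w \<otimes> inv y" using d(2) dc u(2) wc iy(1) by (simp add: m_assoc)
    obtain w' where w': "w' \<in> bounded_pols B y m'" "w \<otimes> y [^] m' = w' \<otimes> y"
      using bounded_pols_reverse[OF B y(1) iy(1,4) w(1)] by auto
    have w'c: "w' \<in> carrier R" using w' bounded_pols_carrier[OF s(1) y(1)] by auto
    have "y [^] m' = d \<otimes> u \<otimes> w \<otimes> inv y \<otimes> y [^] m'" unfolding one[symmetric] using y by simp
    also have "\<dots> = d \<otimes> u \<otimes> (w \<otimes> y [^] m') \<otimes> inv y"
      using dc u(2) wc iy(1) y(1) by (simp add: m_ac)
    also have "\<dots> = (d \<otimes> u) \<otimes> w'" unfolding w'(2) using dc u(2) w'c iy y(1) by (simp add: m_assoc)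
    finally have "y [^] m' \<in> bounded_pols B y m'"
      using bounded_pols_smult[OF B y(1) s(6)[OF d(1) u(1)] w'(1)] by simp
    then have "y [^] m' \<otimes> y [^] (n' - m') \<in> bounded_pols B y (m' + (n' - m'))"
      by (rule bounded_pols_mult_pow[OF B y(1)])
    then have pw: "y [^] n' \<in> bounded_pols B y n'" using y(1,5) m' n' by (simp add: nat_pow_mult)
    obtain a z' where a: "a \<in> B" "z' \<in> bounded_pols B y n'" "z = a \<otimes> y [^] n' \<oplus> z'"
      using bounded_pols_leading[OF B y(1)] y(3) n' by blast
    have "z \<in> bounded_pols B y n'"
      unfolding a(3) by (intro bounded_pols_add[OF B y(1)] bounded_pols_smult[OF B y(1) a(1)] pw a(2))
    then show False using least[of n'] n' by auto
  qed
  have ex: "\<exists>n. z \<in> bounded_pols B y n" if y: "y \<in> carrier R" "y \<notin> B" for y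
  proof (rule ccontr)
    assume "\<not> ?thesis"
    then have "z \<notin> simple_extension B y" using simple_extension_bounded_pols by auto
    then have "simple_extension B y = B"
      using mx[OF simple_extension_is_subring[OF B y(1)] simple_extension_incl[OF s(1) y(1)]] by simp
    then show False using simple_extension_mem[OF B y(1)] y(2) by simp
  qed
  note ix = inv_nonzero[OF x]
  define n where "n = (LEAST n. z \<in> bounded_pols B x n)"
  define m where "m = (LEAST n. z \<in> bounded_pols B (inv x) n)"
  have n: "z \<in> bounded_pols B x n" "\<And>k. k < n \<Longrightarrow> z \<notin> bounded_pols B x k"
    unfolding n_def using LeastI_ex[OF ex[of x]] not_less_Least nx x by auto
  have m: "z \<in> bounded_pols B (inv x) m" "\<And>k. k < m \<Longrightarrow> z \<notin> bounded_pols B (inv x) k"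
    unfolding m_def using LeastI_ex[OF ex[of "inv x"]] not_less_Least nx ix(1) by auto
  show False
    using red[OF x n(1) m(1) _ n(2)] red[OF ix(1,2) m(1) _ _ m(2)] n(1) ix(5) by (metis nat_le_linear)
qed

lemma bounded_pols_eval:
  assumes B: "subring B R" and z: "z \<in> carrier R" and w: "w \<in> bounded_pols B z n"
  shows "\<exists>q. set q \<subseteq> B \<and> length q = n \<and> eval q z = w"
  using w
proof (induction n arbitrary: w)
  case (Suc n)
  then obtain w' b where e: "w = w' \<otimes> z \<oplus> b" "w' \<in> bounded_pols B z n" "b \<in> B" by auto
  from Suc.IH[OF e(2)] obtain q where q: "set q \<subseteq> B" "length q = n" "eval q z = w'" by auto
  have "eval (q @ [b]) z = w"
    using eval_append_aux[of q b z] q e subringE(1)[OF B] z by auto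
  then show ?case using q e(3) by (intro exI[of _ "q @ [b]"]) auto
qed auto

text \<open>
  An expression of \<open>z\<close> as a polynomial in \<open>1 / z\<close> becomes a monic equation for \<open>z\<close> when it is
  multiplied by a power of \<open>z\<close>.
\<close>

lemma not_integral_not_in_extension_by_inverse:
  assumes B: "subring B R" and z: "z \<in> carrier R" "z \<noteq> \<zero>" and ni: "z \<notin> integral_closure R B"
  shows "z \<notin> simple_extension B (inv z)"
proof
  note s = subringE[OF B]
  note iz = inv_nonzero[OF z]
  assume "z \<in> simple_extension B (inv z)"
  then obtain n where "z \<in> bounded_pols B (inv z) n" using simple_extension_bounded_pols by auto
  then obtain w where w: "w \<in> bounded_pols B z n" "z \<otimes> z [^] n = w \<otimes> z"
    using bounded_pols_reverse[OF B z(1) iz(1,4)] by auto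
  have wc: "w \<in> carrier R" using w bounded_pols_carrier[OF s(1) z(1)] by auto
  have wz: "w = z [^] n"
    using w(2) wc z m_comm[of z "z [^] n"] m_rcancel[of z w "z [^] n"] by auto
  obtain q where q: "set q \<subseteq> B" "length q = n" "eval q z = (\<ominus> \<one>) \<otimes> w"
    using bounded_pols_eval[OF B z(1) bounded_pols_smult[OF B z(1) s(5)[OF s(3)] w(1)]] by auto
  have "eval (\<one> # q) z = \<zero>" using q z(1) wz by (simp add: l_minus r_neg)
  moreover have "\<one> # q \<in> carrier (B[X]\<^bsub>R\<^esub>)"
    using q(1) s(3) by (auto simp: univ_poly_carrier[symmetric] polynomial_def)
  ultimately have "z \<in> integral_closure R B"
    unfolding integral_closure_def using z(1) by (auto intro!: bexI[of _ "\<one> # q"])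
  then show False using ni by simp
qed

text \<open>
  By Zorn's lemma \<open>B[1 / z]\<close> extends to a subring that is maximal among those without \<open>z\<close>, and such a
  subring is a valuation ring.
\<close>

lemma valuation_ring_avoiding_non_integral:
  assumes B: "subring B R" and F: "F \<subset> B" and z: "z \<in> carrier R" "z \<notin> integral_closure R B"
  obtains A where "valuation_ring R F A" "B \<subseteq> A" "z \<notin> A"
proof -
  note s = subringE[OF B]
  have "\<zero> \<in> integral_closure R B"
    unfolding integral_closure_def
    by (auto intro!: bexI[of _ "[\<one>, \<zero>]"] simp: univ_poly_carrier[symmetric] polynomial_def s(2,3))
  then have z0: "z \<noteq> \<zero>" using z(2) by auto
  note iz = inv_nonzero[OF z(1) z0]
  obtain A where A: "subring A R" "simple_extension B (inv z) \<subseteq> A" "z \<notin> A"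
    "\<And>C. \<lbrakk>subring C R; A \<subseteq> C; z \<notin> C\<rbrakk> \<Longrightarrow> C = A"
    using maximal_subring_avoiding[OF simple_extension_is_subring[OF B iz(1)]
      not_integral_not_in_extension_by_inverse[OF B z(1) z0 z(2)]] by metis
  have BA: "B \<subseteq> A" using simple_extension_incl[OF s(1) iz(1)] A(2) by auto
  have iA: "inv z \<in> A" using simple_extension_mem[OF B iz(1)] A(2) by auto
  have "valuation_ring R F A"
    unfolding valuation_ring_def
    using A(1,3) BA F z(1) subringE(1)[OF A(1)]
      maximal_subring_is_valuation[OF A(1) z(1) z0 A(3) iA A(4)] by blast
  then show ?thesis using that BA A(3) by auto
qed

end

section \<open>Discrete valuations with residue field \<open>F\<close>\<close>

text \<open>
  The normalized valuation of a place of degree one, constrained on nonzero elements only. The last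
  assumption says that the residue field consists of constants.
\<close>

locale rational_valuation = field K for K :: "('a, 'b) ring_scheme" (structure) +
  fixes F :: "'a set" and v :: "'a \<Rightarrow> int"
  assumes F_subfield: "subfield F K"
    and v_mult: "\<lbrakk>x \<in> carrier K; y \<in> carrier K; x \<noteq> \<zero>; y \<noteq> \<zero>\<rbrakk> \<Longrightarrow> v (x \<otimes> y) = v x + v y"
    and v_add: "\<lbrakk>x \<in> carrier K; y \<in> carrier K; x \<noteq> \<zero>; y \<noteq> \<zero>; x \<oplus> y \<noteq> \<zero>\<rbrakk>
      \<Longrightarrow> min (v x) (v y) \<le> v (x \<oplus> y)"
    and v_prime: "\<exists>t \<in> carrier K. t \<noteq> \<zero> \<and> v t = 1"
    and v_const: "\<lbrakk>c \<in> F; c \<noteq> \<zero>\<rbrakk> \<Longrightarrow> v c = 0"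
    and v_residue: "\<lbrakk>x \<in> carrier K; x \<noteq> \<zero>; v x = 0\<rbrakk>
      \<Longrightarrow> \<exists>c \<in> F. x \<ominus> c = \<zero> \<or> 0 < v (x \<ominus> c)"
begin

text \<open>
  Zero belongs to every \<open>vge n\<close>, as if its value were infinite. With this convention the sets
  \<open>vge n\<close> are subgroups, and estimates need no case distinction for vanishing sums.
\<close>

definition vge :: "int \<Rightarrow> 'a set" where
  "vge n = {x \<in> carrier K. x = \<zero> \<or> n \<le> v x}"

lemmas F_props = subringE[OF subfieldE(1)[OF F_subfield]]

lemma F_carrier: "c \<in> F \<Longrightarrow> c \<in> carrier K" using F_props(1) by auto

lemma v_one: "v \<one> = 0" using v_const[OF F_props(3)] by simp

lemma v_inv:
  assumes "x \<in> carrier K" "x \<noteq> \<zero>" shows "v (inv x) = - v x"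
  using v_mult[OF assms(1) inv_nonzero(1)[OF assms] assms(2) inv_nonzero(2)[OF assms]]
    inv_nonzero(3)[OF assms] v_one by simp

lemma v_nat_pow: "\<lbrakk>x \<in> carrier K; x \<noteq> \<zero>\<rbrakk> \<Longrightarrow> x [^] (n::nat) \<noteq> \<zero> \<and> v (x [^] n) = int n * v x"
proof (induction n)
  case (Suc n)
  then show ?case by (simp add: v_mult integral_iff algebra_simps)
qed (simp add: v_one)

lemma v_int_pow:
  assumes "x \<in> carrier K" "x \<noteq> \<zero>"
  shows "x [^] (n::int) \<in> carrier K" "x [^] n \<noteq> \<zero>" "v (x [^] n) = n * v x"
proof -
  have p: "x [^] m \<in> carrier K" "x [^] m \<noteq> \<zero>" "v (x [^] m) = int m * v x" for m :: nat
    using assms v_nat_pow[OF assms] by auto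
  show "x [^] (n::int) \<in> carrier K" "x [^] n \<noteq> \<zero>" "v (x [^] n) = n * v x"
  proof (atomize (full), cases "n < 0")
    case True
    define y where "y = x [^] nat (- n)"
    have y: "y \<in> carrier K" "y \<noteq> \<zero>" "v y = - n * v x" using p[of "nat (- n)"] True y_def by auto
    have "x [^] n = inv y" using int_pow_def2[of K x n] True y_def by argo
    then show "x [^] n \<in> carrier K \<and> x [^] n \<noteq> \<zero> \<and> v (x [^] n) = n * v x"
      using y(3) v_inv[OF y(1,2)] inv_nonzero(1,2)[OF y(1,2)] by simp
  next
    case False
    then have "x [^] n = x [^] nat n" using int_pow_def2[of K x n] by argo
    then show "x [^] n \<in> carrier K \<and> x [^] n \<noteq> \<zero> \<and> v (x [^] n) = n * v x"
      using p[of "nat n"] False by simp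
  qed
qed

lemma vgeI: "\<lbrakk>x \<in> carrier K; n \<le> v x\<rbrakk> \<Longrightarrow> x \<in> vge n" by (simp add: vge_def)

lemma vge_carrier: "x \<in> vge n \<Longrightarrow> x \<in> carrier K" by (simp add: vge_def)

lemma vgeD: "\<lbrakk>x \<in> vge n; x \<noteq> \<zero>\<rbrakk> \<Longrightarrow> n \<le> v x" by (simp add: vge_def)

lemma zero_vge: "\<zero> \<in> vge n" by (simp add: vge_def)

lemma vge_mono: "\<lbrakk>x \<in> vge n; m \<le> n\<rbrakk> \<Longrightarrow> x \<in> vge m" by (auto simp: vge_def)

lemma F_vge: "c \<in> F \<Longrightarrow> c \<in> vge 0" using v_const F_carrier by (auto simp: vge_def)

lemma vge_add:
  assumes "x \<in> vge n" "y \<in> vge n" shows "x \<oplus> y \<in> vge n"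
proof (cases "x = \<zero> \<or> y = \<zero> \<or> x \<oplus> y = \<zero>")
  case True then show ?thesis using assms by (auto simp: vge_def)
next
  case False then show ?thesis using assms v_add[of x y] by (auto simp: vge_def)
qed

lemma vge_mult:
  assumes "x \<in> vge n" "y \<in> vge m" shows "x \<otimes> y \<in> vge (n + m)"
proof (cases "x = \<zero> \<or> y = \<zero>")
  case True then show ?thesis using assms by (auto simp: vge_def)
next
  case False then show ?thesis using assms v_mult[of x y] by (simp add: vge_def)
qed

lemma vge_smult: "\<lbrakk>c \<in> F; x \<in> vge n\<rbrakk> \<Longrightarrow> c \<otimes> x \<in> vge n"
  using vge_mult[OF F_vge, of c x n] by simp

lemma vge_uminus:
  assumes "x \<in> vge n" shows "\<ominus> x \<in> vge n"
  using vge_smult[OF F_props(5)[OF F_props(3)] assms] vge_carrier[OF assms] by (simp add: l_minus)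

lemma vge_minus: "\<lbrakk>x \<in> vge n; y \<in> vge n\<rbrakk> \<Longrightarrow> x \<ominus> y \<in> vge n"
  unfolding a_minus_def by (intro vge_add vge_uminus)

lemma vge_finsum:
  assumes "finite I" "\<And>i. i \<in> I \<Longrightarrow> g i \<in> vge n"
  shows "(\<Oplus>i\<in>I. g i) \<in> vge n"
  using assms
proof (induction I)
  case empty then show ?case by (simp add: zero_vge)
next
  case (insert i I)
  have "g i \<in> carrier K" "g \<in> I \<rightarrow> carrier K" using insert.prems vge_carrier by auto
  then have "(\<Oplus>j\<in>insert i I. g j) = g i \<oplus> (\<Oplus>j\<in>I. g j)"
    using finsum_insert[OF insert.hyps(1,2)] by simp
  then show ?case using insert vge_add by simp
qed

lemma v_add_dominated:
  assumes "x \<in> carrier K" "x \<noteq> \<zero>" "y \<in> vge (v x + 1)"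
  shows "x \<oplus> y \<noteq> \<zero>" "v (x \<oplus> y) = v x"
proof -
  have yc: "y \<in> carrier K" by (rule vge_carrier[OF assms(3)])
  have x: "x = (x \<oplus> y) \<ominus> y" using assms(1) yc by (simp add: a_minus_def a_assoc r_neg)
  have no: "x \<oplus> y \<notin> vge (v x + 1)"
  proof
    assume "x \<oplus> y \<in> vge (v x + 1)"
    then have "x \<in> vge (v x + 1)" using vge_minus[OF _ assms(3)] x by metis
    then show False using vgeD assms(2) by fastforce
  qed
  then show nz: "x \<oplus> y \<noteq> \<zero>" using zero_vge by metis
  have "x \<oplus> y \<in> vge (v x)" using vge_add[OF vgeI[OF assms(1) order_refl] vge_mono[OF assms(3)]] by simp
  then show "v (x \<oplus> y) = v x" using nz no vgeD[of "x \<oplus> y" "v x"] assms(1) yc by (auto simp: vge_def)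
qed

text \<open>
  The residue of \<open>x / y\<close> is a constant \<open>c\<close>, and subtracting \<open>c y\<close> removes the leading term of \<open>x\<close>.
\<close>

lemma cancel_leading:
  assumes x: "x \<in> vge n" and y: "y \<in> carrier K" "y \<noteq> \<zero>" "v y = n"
  shows "\<exists>c\<in>F. x \<ominus> c \<otimes> y \<in> vge (n + 1)"
proof (cases "x \<in> vge (n + 1)")
  case True
  moreover have "x \<ominus> \<zero> \<otimes> y = x" using y vge_carrier[OF x] by (simp add: a_minus_def)
  ultimately show ?thesis using F_props(2) by (intro bexI[of _ \<zero>]) auto
next
  case False
  note iy = inv_nonzero[OF y(1,2)]
  have xx: "x \<in> carrier K" "x \<noteq> \<zero>" "v x = n" using x False by (auto simp: vge_def)
  have "v (x \<otimes> inv y) = 0" using xx y iy v_mult v_inv by simp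
  moreover have "x \<otimes> inv y \<noteq> \<zero>" using xx iy by (simp add: integral_iff)
  ultimately obtain c where c: "c \<in> F" "x \<otimes> inv y \<ominus> c = \<zero> \<or> 0 < v (x \<otimes> inv y \<ominus> c)"
    using v_residue[of "x \<otimes> inv y"] xx iy by auto
  have cc: "c \<in> carrier K" using F_carrier c by auto
  have "x \<otimes> inv y \<ominus> c \<in> vge 1" using c xx iy cc by (auto simp: vge_def)
  then have "(x \<otimes> inv y \<ominus> c) \<otimes> y \<in> vge (1 + n)" using vge_mult vgeI y by auto
  moreover have "(x \<otimes> inv y \<ominus> c) \<otimes> y = x \<ominus> c \<otimes> y"
    using xx y iy cc by (simp add: a_minus_def l_distr l_minus m_assoc)
  ultimately show ?thesis using c(1) by (auto simp: add.commute)
qed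

lemma vge_subring: "subring (vge 0) K"
proof (rule subringI)
  show "h1 \<otimes> h2 \<in> vge 0" if "h1 \<in> vge 0" "h2 \<in> vge 0" for h1 h2
    using vge_mult[OF that] by simp
qed (simp_all add: vge_carrier vge_uminus vge_add F_vge F_props(3) subsetI)

lemma inv_vge: "\<lbrakk>x \<in> carrier K; x \<noteq> \<zero>\<rbrakk> \<Longrightarrow> inv x \<in> vge n \<longleftrightarrow> v x \<le> - n"
  using inv_nonzero(1,2)[of x] v_inv[of x] by (auto simp: vge_def)

lemma vge_valuation_ring: "valuation_ring K F (vge 0)"
proof -
  obtain t where t: "t \<in> carrier K" "t \<noteq> \<zero>" "v t = 1" using v_prime by auto
  have "t \<in> vge 0" "t \<notin> F" using t v_const by (auto simp: vge_def)
  moreover have "inv t \<notin> vge 0" "inv t \<in> carrier K" using inv_vge t inv_nonzero by auto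
  moreover have "z \<in> vge 0 \<or> inv z \<in> vge 0" if "z \<in> carrier K - {\<zero>}" for z
    using that inv_vge[of z 0] by (auto simp: vge_def)
  ultimately show ?thesis
    unfolding valuation_ring_def using vge_subring F_vge vge_carrier by blast
qed

lemma nonunits_vge: "nonunits K (vge 0) = vge 1"
proof -
  have "z \<in> nonunits K (vge 0) \<longleftrightarrow> z \<in> vge 1" for z
  proof (cases "z \<in> carrier K \<and> z \<noteq> \<zero>")
    case True
    then have "inv z \<in> vge 0 \<longleftrightarrow> v z \<le> 0" using inv_vge[of z 0] by simp
    then show ?thesis using True by (auto simp: nonunits_def vge_def[of 1] vge_def[of 0])
  next
    case False then show ?thesis by (auto simp: vge_def nonunits_def)
  qed
  then show ?thesis by blast
qed

lemma vge_place: "place_of K F (vge 0) (vge 1)"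
  using valuation_ring_place[OF vge_valuation_ring] nonunits_vge by simp

lemma vge_place_ring: "place_ring K F (vge 1) = vge 0"
  by (rule place_ring_eq[OF vge_place])

lemma vge_in_places: "vge 1 \<in> places K F"
  using vge_place unfolding places_def by auto

lemma Units_vge: "Units (K\<lparr>carrier := vge 0\<rparr>) = {x \<in> carrier K. x \<noteq> \<zero> \<and> v x = 0}"
proof (intro equalityI subsetI)
  fix x assume "x \<in> Units (K\<lparr>carrier := vge 0\<rparr>)"
  then obtain y where y: "x \<in> vge 0" "y \<in> vge 0" "x \<otimes> y = \<one>" by (auto simp: Units_def)
  then have "x \<noteq> \<zero>" "y \<noteq> \<zero>" using vge_carrier by auto
  then show "x \<in> {x \<in> carrier K. x \<noteq> \<zero> \<and> v x = 0}"
    using y v_mult[of x y] v_one by (auto simp: vge_def)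
next
  fix x assume "x \<in> {x \<in> carrier K. x \<noteq> \<zero> \<and> v x = 0}"
  then show "x \<in> Units (K\<lparr>carrier := vge 0\<rparr>)"
    using inv_vge[of x 0] inv_nonzero[of x] by (auto simp: Units_def vge_def)
qed

lemma principal_vge:
  assumes t: "t \<in> vge 0"
  shows "PIdl\<^bsub>K\<lparr>carrier := vge 0\<rparr>\<^esub> t = vge 1 \<longleftrightarrow> t \<noteq> \<zero> \<and> v t = 1"
proof -
  have P: "PIdl\<^bsub>K\<lparr>carrier := vge 0\<rparr>\<^esub> t = {x \<otimes> t | x. x \<in> vge 0}"
    unfolding cgenideal_def by simp
  have tc: "t \<in> carrier K" by (rule vge_carrier[OF t])
  show ?thesis unfolding P
  proof
    assume e: "{x \<otimes> t | x. x \<in> vge 0} = vge 1"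
    obtain s where s: "s \<in> carrier K" "s \<noteq> \<zero>" "v s = 1" using v_prime by auto
    then have "s \<in> {x \<otimes> t | x. x \<in> vge 0}" unfolding e by (simp add: vgeI)
    then obtain x where x: "x \<in> vge 0" "s = x \<otimes> t" by auto
    then have nz: "x \<noteq> \<zero>" "t \<noteq> \<zero>" using s vge_carrier tc by auto
    have "\<one> \<otimes> t \<in> vge 1" unfolding e[symmetric] using F_vge[OF F_props(3)] by auto
    then have "1 \<le> v t" using nz tc vgeD by auto
    then show "t \<noteq> \<zero> \<and> v t = 1"
      using x s nz v_mult[of x t] tc vge_carrier[OF x(1)] vgeD[OF x(1)] by auto
  next
    assume h: "t \<noteq> \<zero> \<and> v t = 1"
    note it = inv_nonzero[OF tc conjunct1[OF h]]
    show "{x \<otimes> t | x. x \<in> vge 0} = vge 1"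
    proof (intro equalityI subsetI)
      fix y assume "y \<in> {x \<otimes> t | x. x \<in> vge 0}"
      then show "y \<in> vge 1" using vge_mult[of _ 0 t 1] h tc vgeI by auto
    next
      fix y assume y: "y \<in> vge 1"
      have "inv t \<in> vge (- 1)" using inv_vge[OF tc] h by simp
      then have "y \<otimes> inv t \<in> vge 0" using vge_mult[OF y] by fastforce
      moreover have "y = y \<otimes> inv t \<otimes> t" using it tc vge_carrier[OF y] by (simp add: m_assoc)
      ultimately show "y \<in> {x \<otimes> t | x. x \<in> vge 0}" by blast
    qed
  qed
qed

lemma place_val_vge:
  assumes z: "z \<in> carrier K"
  shows "place_val K F (vge 1) z = (if z = \<zero> then Pinf else Fin (v z))"
proof (cases "z = \<zero>")
  case True then show ?thesis by (simp add: place_val_def)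
next
  case False
  have "(THE n::int. \<exists>t \<in> vge 0. \<exists>u \<in> Units (K\<lparr>carrier := vge 0\<rparr>).
      vge 1 = PIdl\<^bsub>K\<lparr>carrier := vge 0\<rparr>\<^esub> t \<and> z = t [^] n \<otimes> u) = v z" (is "(THE n. ?P n) = _")
  proof (rule the_equality)
    obtain t where t: "t \<in> carrier K" "t \<noteq> \<zero>" "v t = 1" using v_prime by auto
    have t0: "t \<in> vge 0" using t by (simp add: vge_def)
    note p = v_int_pow[OF t(1,2), of "v z"]
    note ip = inv_nonzero[OF p(1,2)]
    have "inv (t [^] v z) \<otimes> z \<in> Units (K\<lparr>carrier := vge 0\<rparr>)"
      unfolding Units_vge using z False p ip t by (simp add: v_mult v_inv integral_iff)
    moreover have "z = t [^] v z \<otimes> (inv (t [^] v z) \<otimes> z)" using p ip z by (simp add: m_assoc[symmetric])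
    moreover have "PIdl\<^bsub>K\<lparr>carrier := vge 0\<rparr>\<^esub> t = vge 1" using principal_vge[OF t0] t by simp
    ultimately show "?P (v z)" using t0 by metis
  next
    fix n assume "?P n"
    then obtain t u where h: "t \<in> vge 0" "u \<in> carrier K" "u \<noteq> \<zero>" "v u = 0"
      "PIdl\<^bsub>K\<lparr>carrier := vge 0\<rparr>\<^esub> t = vge 1" "z = t [^] n \<otimes> u"
      unfolding Units_vge by auto
    then have t: "t \<in> carrier K" "t \<noteq> \<zero>" "v t = 1" using principal_vge[OF h(1)] vge_carrier by auto
    show "n = v z" using v_mult[OF v_int_pow(1)[OF t(1,2)] h(2) v_int_pow(2)[OF t(1,2)] h(3), of n]
      v_int_pow(3)[OF t(1,2), of n] h(4,6) t(3) by simp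
  qed
  then show ?thesis using False by (simp add: place_val_def vge_place_ring Let_def)
qed

text \<open>
  An element of positive value has its inverse outside \<open>vge 0\<close>, hence outside \<open>A\<close>, so it lies in \<open>A\<close>
  itself. Every element of \<open>vge 0\<close> differs from such an element by a constant.
\<close>

lemma valuation_ring_maximal:
  assumes A: "valuation_ring K F A" and sub: "A \<subseteq> vge 0"
  shows "A = vge 0"
proof (rule equalityI[OF sub], rule subsetI)
  note sA = subringE[OF valuation_ringD(1)[OF A]]
  have pos: "z \<in> A" if z: "z \<in> vge 1" for z
  proof (rule ccontr)
    assume n: "z \<notin> A"
    then have z0: "z \<noteq> \<zero>" using sA(2) by auto
    have "inv z \<in> A" using valuation_ringD(4)[OF A vge_carrier[OF z] z0 n] .
    then show False using sub inv_vge[OF vge_carrier[OF z] z0, of 0] vgeD[OF z z0] by auto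
  qed
  fix z assume z: "z \<in> vge 0"
  obtain c where c: "c \<in> F" "z \<ominus> c \<otimes> \<one> \<in> vge (0 + 1)"
    using cancel_leading[OF z, of \<one>] v_one by auto
  have cc: "c \<in> carrier K" using F_carrier c by auto
  have "z \<ominus> c \<in> A" using pos c cc by simp
  moreover have "c \<in> A" using c(1) valuation_ringD(2)[OF A] by auto
  ultimately have "(z \<ominus> c) \<oplus> c \<in> A" using sA(7) by simp
  then show "z \<in> A" using vge_carrier[OF z] cc by (simp add: a_minus_def a_assoc l_neg)
qed

end

section \<open>Linear dependence of finite families\<close>

context field
begin

text \<open>
  Families instead of lists or sets: the counting argument below needs families indexed by pairs, in
  which elements may repeat.
\<close>

definition lin_dependent :: "'a set \<Rightarrow> 'i set \<Rightarrow> ('i \<Rightarrow> 'a) \<Rightarrow> bool" where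
  "lin_dependent F J g \<longleftrightarrow>
     (\<exists>c \<in> J \<rightarrow> F. (\<exists>j\<in>J. c j \<noteq> \<zero>) \<and> (\<Oplus>j\<in>J. c j \<otimes> g j) = \<zero>)"

lemma lin_dependent_eliminate:
  assumes F: "subring F R" and J: "finite J" "i \<in> J" and g: "g \<in> J \<rightarrow> carrier R"
    and l: "l \<in> J - {i} \<rightarrow> F"
    and d: "lin_dependent F (J - {i}) (\<lambda>j. g j \<ominus> l j \<otimes> g i)"
  shows "lin_dependent F J g"
proof -
  note s = subringE[OF F]
  let ?I = "J - {i}"
  from d obtain c where c: "c \<in> ?I \<rightarrow> F" "\<exists>j\<in>?I. c j \<noteq> \<zero>"
    "(\<Oplus>j\<in>?I. c j \<otimes> (g j \<ominus> l j \<otimes> g i)) = \<zero>"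
    unfolding lin_dependent_def by auto
  have fin: "finite ?I" using J by simp
  have cC: "c j \<in> carrier R" "l j \<in> carrier R" "g j \<in> carrier R" "c j \<otimes> l j \<in> F"
    if j: "j \<in> ?I" for j
  proof -
    have *: "c j \<in> F" "l j \<in> F" using c(1) l j by auto
    show "c j \<in> carrier R" "l j \<in> carrier R" "g j \<in> carrier R" "c j \<otimes> l j \<in> F"
      using * s(1) s(6)[OF *] g j by auto
  qed
  have gi: "g i \<in> carrier R" using g J by auto
  define e where "e = (\<Oplus>j\<in>?I. c j \<otimes> l j)"
  have "e \<in> F" unfolding e_def by (rule finsum_in_subring[OF F fin cC(4)])
  then have e: "e \<in> F" "e \<in> carrier R" using s(1) by auto
  have "\<zero> = (\<Oplus>j\<in>?I. c j \<otimes> g j \<oplus> \<ominus> \<one> \<otimes> g i \<otimes> (c j \<otimes> l j))"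
    unfolding c(3)[symmetric]
    by (rule finsum_cong') (use cC gi in \<open>auto simp: a_minus_def r_distr l_minus r_minus m_ac\<close>)
  also have "\<dots> = (\<Oplus>j\<in>?I. c j \<otimes> g j) \<oplus> (\<Oplus>j\<in>?I. \<ominus> \<one> \<otimes> g i \<otimes> (c j \<otimes> l j))"
    by (rule finsum_addf) (use cC gi in auto)
  also have "(\<Oplus>j\<in>?I. \<ominus> \<one> \<otimes> g i \<otimes> (c j \<otimes> l j)) = \<ominus> \<one> \<otimes> g i \<otimes> e"
    unfolding e_def by (rule finsum_rdistr[symmetric]) (use cC gi fin in auto)
  finally have z: "(\<Oplus>j\<in>?I. c j \<otimes> g j) \<oplus> \<ominus> \<one> \<otimes> g i \<otimes> e = \<zero>" by simp
  define c' where "c' = c(i := \<ominus> e)"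
  have "(\<Oplus>j\<in>J. c' j \<otimes> g j) = c' i \<otimes> g i \<oplus> (\<Oplus>j\<in>?I. c' j \<otimes> g j)"
    by (rule finsum_remove) (use J e gi cC in \<open>auto simp: c'_def\<close>)
  also have "(\<Oplus>j\<in>?I. c' j \<otimes> g j) = (\<Oplus>j\<in>?I. c j \<otimes> g j)"
    by (rule finsum_cong') (use cC in \<open>auto simp: c'_def\<close>)
  also have "c' i \<otimes> g i \<oplus> \<dots> = (\<Oplus>j\<in>?I. c j \<otimes> g j) \<oplus> \<ominus> \<one> \<otimes> g i \<otimes> e"
    using cC gi e by (subst a_comm) (auto simp: c'_def l_minus r_minus m_comm intro!: finsum_closed)
  also have "\<dots> = \<zero>" by (rule z)
  finally have "(\<Oplus>j\<in>J. c' j \<otimes> g j) = \<zero>" .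
  moreover have "c' \<in> J \<rightarrow> F" using c(1) e s(5) by (auto simp: c'_def)
  moreover have "\<exists>j\<in>J. c' j \<noteq> \<zero>" using c(2) by (auto simp: c'_def)
  ultimately show ?thesis unfolding lin_dependent_def by blast
qed

text \<open>
  One step of Gaussian elimination. The premise on \<open>S\<close> and \<open>S'\<close> says that \<open>S'\<close> has codimension at
  most one in \<open>S\<close>: any member outside \<open>S'\<close> can be used to move the others into \<open>S'\<close>.
\<close>

lemma lin_dependent_step:
  fixes J :: "'i set"
  assumes F: "subring F R" and S: "S \<subseteq> carrier R"
    and red: "\<And>x y. \<lbrakk>x \<in> S; y \<in> S; y \<notin> S'\<rbrakk> \<Longrightarrow> \<exists>c\<in>F. x \<ominus> c \<otimes> y \<in> S'"
    and IH: "\<And>(J::'i set) g. \<lbrakk>finite J; n \<le> card J; g \<in> J \<rightarrow> S'\<rbrakk> \<Longrightarrow> lin_dependent F J g"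
    and J: "finite J" "Suc n \<le> card J" "g \<in> J \<rightarrow> S"
  shows "lin_dependent F J g"
proof -
  note s = subringE[OF F]
  have gc: "g \<in> J \<rightarrow> carrier R" using J(3) S by auto
  have "\<exists>i\<in>J. \<exists>l \<in> J - {i} \<rightarrow> F. \<forall>j\<in>J - {i}. g j \<ominus> l j \<otimes> g i \<in> S'"
  proof (cases "\<exists>i\<in>J. g i \<notin> S'")
    case True
    then obtain i where i: "i \<in> J" "g i \<notin> S'" by auto
    then have "\<forall>j\<in>J - {i}. \<exists>c\<in>F. g j \<ominus> c \<otimes> g i \<in> S'" using red J(3) by blast
    then obtain l where "\<forall>j\<in>J - {i}. l j \<in> F \<and> g j \<ominus> l j \<otimes> g i \<in> S'" by metis
    then show ?thesis using i by (intro bexI[of _ i] bexI[of _ l]) auto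
  next
    case False
    obtain i where i: "i \<in> J" using J(2) by fastforce
    have "g j \<ominus> \<zero> \<otimes> g i = g j" if "j \<in> J" for j using gc i that by (auto simp: a_minus_def Pi_iff)
    then show ?thesis using i False s(2) by (intro bexI[of _ i] bexI[of _ "\<lambda>_. \<zero>"]) auto
  qed
  then obtain i l where i: "i \<in> J" "l \<in> J - {i} \<rightarrow> F" "\<forall>j\<in>J - {i}. g j \<ominus> l j \<otimes> g i \<in> S'" by auto
  have "lin_dependent F (J - {i}) (\<lambda>j. g j \<ominus> l j \<otimes> g i)"
    by (rule IH) (use i J in \<open>auto simp: card_Diff_singleton\<close>)
  then show ?thesis by (rule lin_dependent_eliminate[OF F J(1) i(1) gc i(2)])
qed

lemma lin_dependent_zero:
  assumes F: "subring F R" and J: "finite J" "1 \<le> card J" "g \<in> J \<rightarrow> {\<zero>}"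
  shows "lin_dependent F J g"
proof -
  have "(\<Oplus>j\<in>J. \<one> \<otimes> g j) = \<zero>" 
  proof (rule add.finprod_one_eqI)
    fix j assume "j \<in> J"
    then have "g j = \<zero>" using J(3) by auto
    then show "\<one> \<otimes> g j = \<zero>" by simp
  qed
  moreover have "J \<noteq> {}" using J(2) by auto
  ultimately show ?thesis unfolding lin_dependent_def
    using subringE(3)[OF F] by (intro bexI[of _ "\<lambda>_. \<one>"]) auto
qed

text \<open>
  Linear independence over \<open>F[f]\<close>, hence over \<open>F(f)\<close> if \<open>f\<close> is transcendental. The polynomials are written
  out by their coefficients \<open>c i j\<close>, because the proofs compare coefficients.
\<close>

definition pol_independent :: "'a set \<Rightarrow> 'a \<Rightarrow> 'i set \<Rightarrow> ('i \<Rightarrow> 'a) \<Rightarrow> bool" where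
  "pol_independent F f I x \<longleftrightarrow>
     (\<forall>m c. (\<forall>i\<in>I. \<forall>j\<le>m. c i j \<in> F) \<longrightarrow> (\<Oplus>i\<in>I. (\<Oplus>j\<in>{..m::nat}. c i j \<otimes> f [^] j) \<otimes> x i) = \<zero> \<longrightarrow>
       (\<forall>i\<in>I. \<forall>j\<le>m. c i j = \<zero>))"

end

section \<open>Rings whose elements have poles at two places only\<close>

text \<open>
  What remains of a pair of well agreeing near weights once they are valuations of \<open>K\<close>. That \<open>v\<close> and
  \<open>w\<close> are the only valuations with poles on \<open>R\<close> is a consequence of these assumptions.
\<close>

locale two_point_ring = v: rational_valuation K F v + w: rational_valuation K F w
  for K :: "('a, 'b) ring_scheme" (structure) and F v w +
  fixes R :: "'a set"
  assumes R_subring: "subring R K"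
    and F_R: "F \<subseteq> R"
    and R_fractions: "z \<in> carrier K \<Longrightarrow> \<exists>b\<in>R. b \<noteq> \<zero> \<and> z \<otimes> b \<in> R"
    and R_constants: "R \<inter> v.vge 0 \<inter> w.vge 0 \<subseteq> F"
    and R_poles: "\<exists>N::int. \<forall>a\<ge>N. \<forall>b\<ge>N. \<exists>f\<in>R. f \<noteq> \<zero> \<and> v f = - a \<and> w f = - b"
begin

lemmas R_props = subringE[OF R_subring]

text \<open>
  The Riemann-Roch space of \<open>k P + l Q\<close>, restricted to \<open>R\<close>.
\<close>

definition L :: "nat \<Rightarrow> nat \<Rightarrow> 'a set" where
  "L k l = R \<inter> v.vge (- int k) \<inter> w.vge (- int l)"

text \<open>
  \<open>L 0 0\<close> is contained in \<open>F\<close>, and raising \<open>k\<close> or \<open>l\<close> by one raises the dimension by at most one, so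
  the dimension of \<open>L k l\<close> is at most \<open>k + l + 1\<close>.
\<close>

lemma L_dependent:
  "\<lbrakk>finite J; k + l + 2 \<le> card J; g \<in> J \<rightarrow> L k l\<rbrakk> \<Longrightarrow> v.lin_dependent F J g"
proof (induction "k + l" arbitrary: k l J g)
  case 0
  then have kl: "k = 0" "l = 0" by auto
  have LF: "L 0 0 \<subseteq> F" using R_constants by (auto simp: L_def)
  show ?case
  proof (rule v.lin_dependent_step[where S = F and S' = "{\<zero>}" and n = 1])
    show "subring F K" by (rule subfieldE(1)[OF v.F_subfield])
    show "F \<subseteq> carrier K" by (rule v.F_props(1))
    show "g \<in> J \<rightarrow> F" using 0(4) LF kl by auto
    show "Suc 1 \<le> card J" using 0(3) by simp
    show "finite J" by fact
    fix x y assume xy: "x \<in> F" "y \<in> F" "y \<notin> {\<zero>}"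
    have c: "x \<in> carrier K" "y \<in> carrier K" "y \<noteq> \<zero>" using xy v.F_carrier by auto
    have "inv y \<in> F" using v.subfield_m_inv(1)[OF v.F_subfield] xy by auto
    moreover have "x \<ominus> x \<otimes> inv y \<otimes> y = \<zero>"
      using c v.inv_nonzero[OF c(2,3)] by (simp add: v.m_assoc a_minus_def v.r_neg)
    ultimately show "\<exists>c\<in>F. x \<ominus> c \<otimes> y \<in> {\<zero>}"
      using v.F_props(6) xy(1) by (intro bexI[of _ "x \<otimes> inv y"]) auto
  next
    show "v.lin_dependent F J g" if "finite J" "1 \<le> card J" "g \<in> J \<rightarrow> {\<zero>}" for J :: "'c set" and g
      using v.lin_dependent_zero[OF subfieldE(1)[OF v.F_subfield] that] .
  qed
next
  case (Suc n)
  have LR: "L k' l' \<subseteq> carrier K" for k' l' using R_props(1) by (auto simp: L_def)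
  have sub: "x \<ominus> c \<otimes> y \<in> R" if "x \<in> R" "y \<in> R" "c \<in> F" for x y c
    unfolding a_minus_def using that F_R R_props(5,6,7) by blast
  show ?case
  proof (cases k)
    case (Suc k')
    show ?thesis
    proof (rule v.lin_dependent_step[where S = "L k l" and S' = "L k' l" and n = "k' + l + 2"])
      show "subring F K" by (rule subfieldE(1)[OF v.F_subfield])
      show "L k l \<subseteq> carrier K" by (rule LR)
      show "g \<in> J \<rightarrow> L k l" "finite J" by fact+
      show "Suc (k' + l + 2) \<le> card J" using Suc.prems(2) Suc by simp
      show "v.lin_dependent F J g" if "finite J" "k' + l + 2 \<le> card J" "g \<in> J \<rightarrow> L k' l" for J :: "'c set" and g
        by (rule Suc.hyps(1)[OF _ that]) (use Suc Suc.hyps(2) in simp)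
      fix x y assume xy: "x \<in> L k l" "y \<in> L k l" "y \<notin> L k' l"
      have e: "- int k = - int k' - 1" "- int k + 1 = - int k'" using Suc by auto
      have y: "y \<in> carrier K" "y \<noteq> \<zero>" "v y = - int k"
        using xy(2,3) e LR unfolding L_def v.vge_def by auto
      have "x \<in> v.vge (- int k)" using xy by (simp add: L_def)
      from v.cancel_leading[OF this y] obtain c where c: "c \<in> F" "x \<ominus> c \<otimes> y \<in> v.vge (- int k')"
        unfolding e by auto
      moreover have "x \<ominus> c \<otimes> y \<in> w.vge (- int l)"
        using xy c by (intro w.vge_minus w.vge_smult) (auto simp: L_def)
      moreover have "x \<ominus> c \<otimes> y \<in> R" using sub xy c by (auto simp: L_def)
      ultimately show "\<exists>c\<in>F. x \<ominus> c \<otimes> y \<in> L k' l" by (auto simp: L_def)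
    qed
  next
    case 0
    then obtain l' where l': "l = Suc l'" using Suc.hyps(2) by (cases l) auto
    show ?thesis
    proof (rule v.lin_dependent_step[where S = "L k l" and S' = "L k l'" and n = "k + l' + 2"])
      show "subring F K" by (rule subfieldE(1)[OF v.F_subfield])
      show "L k l \<subseteq> carrier K" by (rule LR)
      show "g \<in> J \<rightarrow> L k l" "finite J" by fact+
      show "Suc (k + l' + 2) \<le> card J" using Suc.prems(2) l' by simp
      show "v.lin_dependent F J g" if "finite J" "k + l' + 2 \<le> card J" "g \<in> J \<rightarrow> L k l'" for J :: "'c set" and g
        by (rule Suc.hyps(1)[OF _ that]) (use l' Suc.hyps(2) in simp)
      fix x y assume xy: "x \<in> L k l" "y \<in> L k l" "y \<notin> L k l'"
      have e: "- int l = - int l' - 1" "- int l + 1 = - int l'" using l' by auto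
      have y: "y \<in> carrier K" "y \<noteq> \<zero>" "w y = - int l"
        using xy(2,3) e LR unfolding L_def w.vge_def by auto
      have "x \<in> w.vge (- int l)" using xy by (simp add: L_def)
      from w.cancel_leading[OF this y] obtain c where c: "c \<in> F" "x \<ominus> c \<otimes> y \<in> w.vge (- int l')"
        unfolding e by auto
      moreover have "x \<ominus> c \<otimes> y \<in> v.vge (- int k)"
        using xy c by (intro v.vge_minus v.vge_smult) (auto simp: L_def)
      moreover have "x \<ominus> c \<otimes> y \<in> R" using sub xy c by (auto simp: L_def)
      ultimately show "\<exists>c\<in>F. x \<ominus> c \<otimes> y \<in> L k l'" by (auto simp: L_def)
    qed
  qed
qed

lemma common_denominator:
  assumes "finite I" "x \<in> I \<rightarrow> carrier K"
  shows "\<exists>h\<in>R. h \<noteq> \<zero> \<and> (\<forall>i\<in>I. h \<otimes> x i \<in> R)"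
  using assms
proof (induction I)
  case empty
  then show ?case using R_props(3) by (intro bexI[of _ \<one>]) auto
next
  case (insert i I)
  then obtain h where h: "h \<in> R" "h \<noteq> \<zero>" "\<forall>i\<in>I. h \<otimes> x i \<in> R" by auto
  obtain b where b: "b \<in> R" "b \<noteq> \<zero>" "x i \<otimes> b \<in> R" using R_fractions[of "x i"] insert.prems by auto
  have c: "h \<in> carrier K" "b \<in> carrier K" using h b R_props(1) by auto
  have "h \<otimes> b \<otimes> x j \<in> R" if j: "j \<in> insert i I" for j
  proof -
    have xj: "x j \<in> carrier K" using insert.prems j by auto
    show ?thesis
    proof (cases "j = i")
      case True
      have "h \<otimes> b \<otimes> x j = h \<otimes> (x i \<otimes> b)" using c xj True by (simp add: v.m_ac)
      then show ?thesis using R_props(6)[OF h(1) b(3)] by simp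
    next
      case False
      have "h \<otimes> b \<otimes> x j = b \<otimes> (h \<otimes> x j)" using c xj by (simp add: v.m_ac)
      moreover have "h \<otimes> x j \<in> R" using h(3) j False by auto
      ultimately show ?thesis using R_props(6)[OF b(1)] by simp
    qed
  qed
  moreover have "h \<otimes> b \<noteq> \<zero>" "h \<otimes> b \<in> R" using c h b R_props(6) by (auto simp: v.integral_iff)
  ultimately show ?case by blast
qed

lemma bounded_poles:
  assumes "finite I" "y \<in> I \<rightarrow> R"
  shows "\<exists>C::nat. \<forall>i\<in>I. y i \<in> L C C"
  using assms
proof (induction I)
  case (insert i I)
  then obtain C where C: "\<forall>i\<in>I. y i \<in> L C C" by auto
  define D where "D = C + nat (- v (y i)) + nat (- w (y i))"
  have "y i \<in> R" "y i \<in> carrier K" using insert.prems R_props(1) by auto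
  moreover have "- int D \<le> v (y i)" "- int D \<le> w (y i)" "- int D \<le> - int C" unfolding D_def by auto
  ultimately have "y j \<in> L D D" if "j \<in> insert i I" for j
    using that C v.vge_mono[of "y j" "- int C" "- int D"] w.vge_mono[of "y j" "- int C" "- int D"]
    by (auto simp: L_def v.vgeI w.vgeI)
  then show ?case by blast
qed auto

text \<open>
  The degree of \<open>K\<close> over \<open>F(f)\<close> is at most the number \<open>p + q\<close> of poles of \<open>f\<close> at the two places. Clear the
  denominators of the \<open>x i\<close> by \<open>h\<close>. The elements \<open>h x\<^sub>i f\<^sup>j\<close> with \<open>j \<le> m\<close> number
  \<open>(m + 1) * card I\<close>, they are independent over \<open>F\<close>, and they lie in a space of dimension
  at most \<open>2 C + m (p + q) + 1\<close>, where \<open>C\<close> depends only on the \<open>x i\<close> and \<open>h\<close>. Compare the growth in \<open>m\<close>.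
\<close>

lemma pol_independent_card:
  fixes I :: "'i set"
  assumes f: "f \<in> R" "f \<noteq> \<zero>" "v f \<le> 0" "w f \<le> 0"
    and I: "finite I" "x \<in> I \<rightarrow> carrier K" and ind: "v.pol_independent F f I x"
  shows "int (card I) \<le> - v f - w f"
proof (rule ccontr)
  assume less: "\<not> ?thesis"
  define p where "p = nat (- v f)"
  define q where "q = nat (- w f)"
  have pq: "v f = - int p" "w f = - int q" using f by (auto simp: p_def q_def)
  then have big: "p + q + 1 \<le> card I" using less by auto
  obtain h where h: "h \<in> R" "h \<noteq> \<zero>" "\<forall>i\<in>I. h \<otimes> x i \<in> R" using common_denominator[OF I] by auto
  obtain C where C: "\<forall>i\<in>I. h \<otimes> x i \<in> L C C" using bounded_poles[OF I(1), of "\<lambda>i. h \<otimes> x i"] h by auto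
  have fc: "f \<in> carrier K" "h \<in> carrier K" using f h R_props(1) by auto
  have xc: "x i \<in> carrier K" if "i \<in> I" for i using I that by auto
  \<comment> \<open>any \<open>m \<ge> 2 C + 1\<close> makes \<open>(p + q + 1) (m + 1)\<close> exceed the dimension bound\<close>
  define m where "m = 2 * C + 1"
  define g where "g = (\<lambda>ij. h \<otimes> x (fst ij) \<otimes> f [^] (snd ij :: nat))"
  have fR: "f [^] j \<in> R" for j :: nat by (rule v.nat_pow_in_subring[OF R_subring f(1)])
  have gL: "g \<in> I \<times> {..m} \<rightarrow> L (C + m * p) (C + m * q)"
  proof
    fix ij assume "ij \<in> I \<times> {..m}"
    then obtain i j where ij: "ij = (i, j)" "i \<in> I" "j \<le> m" by auto
    have hx: "h \<otimes> x i \<in> R" "h \<otimes> x i \<in> v.vge (- int C)" "h \<otimes> x i \<in> w.vge (- int C)"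
      using C ij(2) by (auto simp: L_def)
    have "f [^] j \<in> v.vge (- int (j * p))" "f [^] j \<in> w.vge (- int (j * q))"
      using v.v_nat_pow[OF fc(1) f(2), of j] w.v_nat_pow[OF fc(1) f(2), of j] fc pq
      by (auto intro!: v.vgeI w.vgeI)
    then have "g ij \<in> v.vge (- int C + - int (j * p))" "g ij \<in> w.vge (- int C + - int (j * q))"
      unfolding g_def ij fst_conv snd_conv by (intro v.vge_mult w.vge_mult hx; simp)+
    moreover have "- int (C + m * p) \<le> - int C + - int (j * p)" "- int (C + m * q) \<le> - int C + - int (j * q)"
      using ij(3) by (simp_all add: mult_right_mono flip: of_nat_mult)
    ultimately show "g ij \<in> L (C + m * p) (C + m * q)"
      unfolding L_def using v.vge_mono w.vge_mono R_props(6)[OF hx(1) fR[of j]] by (auto simp: g_def ij)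
  qed
  have "(p + q + 1) * (m + 1) \<le> card I * (m + 1)" using big by (intro mult_right_mono) auto
  moreover have "C + m * p + (C + m * q) + 2 \<le> (p + q + 1) * (m + 1)" by (simp add: m_def algebra_simps)
  moreover have "card (I \<times> {..m}) = card I * (m + 1)" by (simp add: card_cartesian_product)
  ultimately have "C + m * p + (C + m * q) + 2 \<le> card (I \<times> {..m})" by linarith
  then have "v.lin_dependent F (I \<times> {..m}) g" using L_dependent[OF _ _ gL] I(1) by simp
  then obtain c where c: "c \<in> I \<times> {..m} \<rightarrow> F" "\<exists>ij\<in>I \<times> {..m}. c ij \<noteq> \<zero>"
    "(\<Oplus>ij\<in>I \<times> {..m}. c ij \<otimes> g ij) = \<zero>" unfolding v.lin_dependent_def by auto
  have cc: "c (i, j) \<in> carrier K" "c (i, j) \<in> F" if "i \<in> I" "j \<le> m" for i j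
    using c(1) that v.F_carrier by auto
  let ?P = "\<lambda>i. \<Oplus>j\<in>{..m}. c (i, j) \<otimes> f [^] j"
  have Pc: "?P i \<in> carrier K" if "i \<in> I" for i using cc that fc by (intro v.finsum_closed) auto
  have "\<zero> = (\<Oplus>ij\<in>I \<times> {..m}. c (fst ij, snd ij) \<otimes> (h \<otimes> x (fst ij) \<otimes> f [^] snd ij))"
    using c(3) unfolding g_def by simp
  also have "\<dots> = (\<Oplus>i\<in>I. \<Oplus>j\<in>{..m}. c (i, j) \<otimes> (h \<otimes> x i \<otimes> f [^] j))"
    by (rule v.finsum_product) (use I(1) cc fc xc in auto)
  also have "\<dots> = (\<Oplus>i\<in>I. h \<otimes> (?P i \<otimes> x i))"
  proof (rule v.finsum_cong')
    fix i assume i: "i \<in> I"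
    have "(\<Oplus>j\<in>{..m}. c (i, j) \<otimes> (h \<otimes> x i \<otimes> f [^] j)) = (\<Oplus>j\<in>{..m}. c (i, j) \<otimes> f [^] j \<otimes> (h \<otimes> x i))"
      by (rule v.finsum_cong') (use cc i xc fc in \<open>auto simp: v.m_ac\<close>)
    also have "\<dots> = ?P i \<otimes> (h \<otimes> x i)"
      by (rule v.finsum_ldistr[symmetric]) (use cc i xc fc in auto)
    finally show "(\<Oplus>j\<in>{..m}. c (i, j) \<otimes> (h \<otimes> x i \<otimes> f [^] j)) = h \<otimes> (?P i \<otimes> x i)"
      using Pc[OF i] fc xc[OF i] by (simp add: v.m_ac)
  qed (use Pc fc xc in auto)
  also have "\<dots> = h \<otimes> (\<Oplus>i\<in>I. ?P i \<otimes> x i)"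
    by (rule v.finsum_rdistr[symmetric]) (use I(1) Pc fc xc in auto)
  finally have "\<zero> = h \<otimes> (\<Oplus>i\<in>I. ?P i \<otimes> x i)" .
  then have "h \<otimes> (\<Oplus>i\<in>I. ?P i \<otimes> x i) = \<zero>" by (rule sym)
  moreover have "(\<Oplus>i\<in>I. ?P i \<otimes> x i) \<in> carrier K" using Pc xc by (intro v.finsum_closed) auto
  ultimately have "(\<Oplus>i\<in>I. ?P i \<otimes> x i) = \<zero>" using h(2) fc by (simp add: v.integral_iff)
  then have "\<forall>i\<in>I. \<forall>j\<le>m. c (i, j) = \<zero>"
    using ind[unfolded v.pol_independent_def, THEN spec, THEN spec, of m "\<lambda>i j. c (i, j)"] cc(2) by blast
  then show False using c(2) by auto
qed

end

section \<open>Function fields\<close>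

context rational_valuation
begin

text \<open>
  If one term of a linear combination strictly dominates the others, it cannot be cancelled.
\<close>

lemma leading_coefficient_zero:
  assumes I: "finite I" "i \<in> I" and c: "\<And>j. j \<in> I \<Longrightarrow> c j \<in> F"
    and x: "\<And>j. j \<in> I \<Longrightarrow> x j \<in> carrier K" and xi: "x i \<noteq> \<zero>"
    and dom: "\<And>j. j \<in> I \<Longrightarrow> j \<noteq> i \<Longrightarrow> c j = \<zero> \<or> x j \<in> vge (v (x i) + 1)"
    and sum: "(\<Oplus>j\<in>I. c j \<otimes> x j) \<in> vge (v (x i) + 1)"
  shows "c i = \<zero>"
proof (rule ccontr)
  assume ci: "c i \<noteq> \<zero>"
  have cc: "c j \<in> carrier K" if "j \<in> I" for j using c F_carrier that by auto
  have vi: "c i \<otimes> x i \<in> carrier K" "c i \<otimes> x i \<noteq> \<zero>" "v (c i \<otimes> x i) = v (x i)"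
    using ci xi cc[OF I(2)] x[OF I(2)] v_const[OF c[OF I(2)] ci] v_mult[of "c i" "x i"]
    by (auto simp: integral_iff)
  have rest: "(\<Oplus>j\<in>I - {i}. c j \<otimes> x j) \<in> vge (v (x i) + 1)"
  proof (rule vge_finsum)
    fix j assume j: "j \<in> I - {i}"
    then show "c j \<otimes> x j \<in> vge (v (x i) + 1)"
      using dom[of j] vge_smult[OF c[of j]] x[of j] zero_vge by fastforce
  qed (use I in auto)
  have "(\<Oplus>j\<in>I. c j \<otimes> x j) = c i \<otimes> x i \<oplus> (\<Oplus>j\<in>I - {i}. c j \<otimes> x j)"
    by (rule finsum_remove) (use I cc x in auto)
  then have "(\<Oplus>j\<in>I. c j \<otimes> x j) \<noteq> \<zero>" "v (\<Oplus>j\<in>I. c j \<otimes> x j) = v (x i)"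
    using v_add_dominated[OF vi(1,2)] rest vi(3) by auto
  then show False using vgeD[OF sum] by simp
qed

text \<open>
  The powers of \<open>f\<close> have distinct values, so the highest one dominates.
\<close>

lemma pole_powers_independent:
  assumes f: "f \<in> carrier K" "f \<noteq> \<zero>" "v f < 0"
  shows "\<lbrakk>\<forall>j\<le>m. c j \<in> F; (\<Oplus>j\<in>{..m::nat}. c j \<otimes> f [^] j) = \<zero>\<rbrakk> \<Longrightarrow> \<forall>j\<le>m. c j = \<zero>"
proof (induction m)
  case 0
  then have "c 0 \<in> carrier K" using F_carrier by auto
  then have "(\<Oplus>j\<in>{..0::nat}. c j \<otimes> f [^] j) = c 0" by simp
  then show ?case using 0(2) by simp
next
  case (Suc m)
  have p: "f [^] j \<in> carrier K" "f [^] j \<noteq> \<zero>" "v (f [^] j) = int j * v f" for j :: nat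
    using v_nat_pow[OF f(1,2), of j] f(1) by auto
  have top: "c (Suc m) = \<zero>"
  proof (rule leading_coefficient_zero[where I = "{..Suc m}" and i = "Suc m" and c = c and x = "\<lambda>j. f [^] j"])
    fix j assume "j \<in> {..Suc m}" "j \<noteq> Suc m"
    then have "j < Suc m" by simp
    then have "int (Suc m) * v f < int j * v f" using f(3) by (intro mult_strict_right_mono_neg) auto
    then show "c j = \<zero> \<or> f [^] j \<in> vge (v (f [^] Suc m) + 1)"
      unfolding p(3) by (intro disjI2 vgeI p(1)) (simp add: p(3))
  next
    show "f [^] j \<in> carrier K" for j :: nat using p by simp
    show "f [^] Suc m \<noteq> \<zero>" by (rule p(2))
    show "(\<Oplus>j\<in>{..Suc m}. c j \<otimes> f [^] j) \<in> vge (v (f [^] Suc m) + 1)"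
      unfolding Suc.prems(2) by (rule zero_vge)
  qed (use Suc.prems(1) in auto)
  have split: "(\<Oplus>j\<in>{..Suc m}. c j \<otimes> f [^] j) = c (Suc m) \<otimes> f [^] Suc m \<oplus> (\<Oplus>j\<in>{..m}. c j \<otimes> f [^] j)"
    by (rule finsum_Suc) (use Suc.prems(1) F_carrier f(1) in auto)
  have "(\<Oplus>j\<in>{..m}. c j \<otimes> f [^] j) \<in> carrier K"
    by (rule finsum_closed) (use Suc.prems(1) F_carrier f(1) in auto)
  then have "(\<Oplus>j\<in>{..m}. c j \<otimes> f [^] j) = c (Suc m) \<otimes> f [^] Suc m \<oplus> (\<Oplus>j\<in>{..m}. c j \<otimes> f [^] j)"
    by (simp only: top l_null[OF p(1)] l_zero)
  also have "\<dots> = \<zero>" unfolding split[symmetric] by (rule Suc.prems(2))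
  finally have "(\<Oplus>j\<in>{..m}. c j \<otimes> f [^] j) = \<zero>" .
  moreover have "\<forall>j\<le>m. c j \<in> F" using Suc.prems(1) by (meson le_SucI)
  ultimately have "\<forall>j\<le>m. c j = \<zero>" by (intro Suc.IH)
  then show ?case using top by (auto simp: le_Suc_eq)
qed

lemma pole_transcendental:
  assumes f: "f \<in> carrier K" "f \<noteq> \<zero>" "v f < 0"
  shows "transcendental F f"
proof -
  have p: "f [^] j \<in> carrier K" "f [^] j \<noteq> \<zero>" "v (f [^] j) = int j * v f" for j :: nat
    using v_nat_pow[OF f(1,2), of j] f(1) by auto
  have tm: "a \<otimes> f [^] j \<in> vge (int j * v f)" if "a \<in> F" for a and j :: nat
    by (rule vge_smult[OF that]) (simp add: vge_def p)
  have bound: "eval q f \<in> vge ((int (length q) - 1) * v f)" if "set q \<subseteq> F" for q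
    using that
  proof (induction q)
    case Nil then show ?case by (simp add: zero_vge)
  next
    case (Cons a q)
    have "eval q f \<in> vge ((int (length q) - 1) * v f)" using Cons by auto
    then have "eval q f \<in> vge (int (length q) * v f)"
      by (rule vge_mono) (use f(3) in \<open>simp add: algebra_simps\<close>)
    moreover have "a \<otimes> f [^] length q \<in> vge (int (length q) * v f)" using Cons.prems tm by auto
    ultimately show ?case using vge_add by simp
  qed
  have "p = []" if h: "p \<in> carrier (F[X])" "eval p f = \<zero>" for p
  proof (cases p)
    case (Cons a q)
    then have a: "a \<in> F" "a \<noteq> \<zero>" "set q \<subseteq> F"
      using h(1) by (auto simp: univ_poly_carrier[symmetric] polynomial_def)
    let ?t = "a \<otimes> f [^] length q"
    have ac: "a \<in> carrier K" using a F_carrier by auto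
    have t: "?t \<in> carrier K" "?t \<noteq> \<zero>" "v ?t = int (length q) * v f"
      using v_mult[OF ac p(1) a(2) p(2), of "length q"] v_const[OF a(1,2)] p[of "length q"] ac a(2)
      by (auto simp: integral_iff)
    have "eval q f \<in> vge (v ?t + 1)"
      by (rule vge_mono[OF bound[OF a(3)]]) (use f(3) t(3) in \<open>simp add: algebra_simps\<close>)
    then have "?t \<oplus> eval q f \<noteq> \<zero>" by (rule v_add_dominated(1)[OF t(1,2)])
    then show ?thesis using h(2) Cons by simp
  qed simp
  then have "a_kernel (F[X]) K (\<lambda>p. eval p f) = {[]}"
    unfolding a_kernel_def' by (auto simp: univ_poly_carrier[symmetric])
  then show ?thesis
    using trivial_ker_imp_transcendental[OF subfieldE(1)[OF F_subfield] f(1)] unfolding over_def by simp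
qed

end

context two_point_ring
begin

text \<open>
  Since the size of families independent over \<open>F[f]\<close> is bounded, there is a largest one. Adjoining
  any \<open>y\<close> to it gives a dependence in which the coefficient of \<open>y\<close> does not vanish, so the family
  spans \<open>K\<close> over \<open>F(f)\<close>.
\<close>

lemma finite_dimension_over_pole:
  assumes f: "f \<in> R" "f \<noteq> \<zero>" "v f < 0" "w f \<le> 0"
  shows "v.finite_dimension (generate_field K (insert f F)) (carrier K)"
proof -
  let ?E = "generate_field K (insert f F)"
  define ok where "ok = (\<lambda>n. \<exists>x. x \<in> {..<n::nat} \<rightarrow> carrier K \<and> v.pol_independent F f {..<n} x)"
  have fc: "f \<in> carrier K" using f R_props(1) by auto
  have sub: "insert f F \<subseteq> carrier K" using fc v.F_carrier by auto
  note E = v.generate_field_is_subfield[OF sub]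
  note Es = subringE[OF subfieldE(1)[OF E]]
  have fE: "f \<in> ?E" "F \<subseteq> ?E" by (auto intro: generate_field.incl)
  have polE: "(\<Oplus>j\<in>{..m::nat}. c j \<otimes> f [^] j) \<in> ?E" if c: "\<forall>j\<le>m. c j \<in> F" for c m
  proof -
    have t: "c j \<otimes> f [^] j \<in> ?E" if "j \<le> m" for j
    proof -
      have "f [^] j \<in> ?E" by (rule v.nat_pow_in_subring[OF subfieldE(1)[OF E] fE(1)])
      then show ?thesis using Es(6) c fE(2) that by blast
    qed
    show ?thesis by (rule v.finsum_in_subring[OF subfieldE(1)[OF E] _ t]) auto
  qed
  have ok0: "ok 0" unfolding ok_def v.pol_independent_def by auto
  have bound: "n \<le> nat (- v f - w f)" if "ok n" for n
  proof -
    from that obtain x where x: "x \<in> {..<n} \<rightarrow> carrier K" "v.pol_independent F f {..<n} x"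
      unfolding ok_def by auto
    have "int (card {..<n}) \<le> - v f - w f" by (rule pol_independent_card[OF f(1,2) _ f(4) _ x]) (use f in auto)
    then show ?thesis by simp
  qed
  define n where "n = (GREATEST n. ok n)"
  have n: "ok n" unfolding n_def using GreatestI_nat[of ok, OF ok0] bound by blast
  have "\<not> ok (Suc n)"
  proof
    assume "ok (Suc n)"
    then have "Suc n \<le> n" using Greatest_le_nat[of ok "Suc n"] bound unfolding n_def by blast
    then show False by simp
  qed
  then have max: "\<not> v.pol_independent F f {..<Suc n} x" if "x \<in> {..<Suc n} \<rightarrow> carrier K" for x
    using that unfolding ok_def by blast
  from n obtain x where x: "x \<in> {..<n} \<rightarrow> carrier K" "v.pol_independent F f {..<n} x"
    unfolding ok_def by auto
  define Us where "Us = map x [0..<n]"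
  have Us: "set Us \<subseteq> carrier K" "\<And>i. i < n \<Longrightarrow> x i \<in> set Us" using x(1) by (auto simp: Us_def)
  have "y \<in> v.Span ?E Us" if y: "y \<in> carrier K" for y
  proof -
    define x' where "x' = x(n := y)"
    have x': "x' \<in> {..<Suc n} \<rightarrow> carrier K" using x(1) y by (auto simp: x'_def less_Suc_eq)
    obtain m c where c: "\<forall>i\<in>{..<Suc n}. \<forall>j\<le>m. c i j \<in> F"
      "(\<Oplus>i\<in>{..<Suc n}. (\<Oplus>j\<in>{..m::nat}. c i j \<otimes> f [^] j) \<otimes> x' i) = \<zero>"
      "\<not> (\<forall>i\<in>{..<Suc n}. \<forall>j\<le>m. c i j = \<zero>)"
      using max[OF x'] unfolding v.pol_independent_def by blast
    let ?P = "\<lambda>i. \<Oplus>j\<in>{..m}. c i j \<otimes> f [^] j"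
    have PE: "?P i \<in> ?E" "?P i \<in> carrier K" if "i \<le> n" for i
    proof -
      show "?P i \<in> ?E" by (rule polE) (use c(1) that in auto)
      then show "?P i \<in> carrier K" using Es(1) by auto
    qed
    let ?S = "\<Oplus>i\<in>{..<n}. ?P i \<otimes> x i"
    have xc: "x i \<in> carrier K" if "i < n" for i using x(1) that by auto
    have Sc: "?S \<in> carrier K" using PE xc by (intro v.finsum_closed) auto
    have "(\<Oplus>i\<in>{..<Suc n}. ?P i \<otimes> x' i) = ?P n \<otimes> x' n \<oplus> (\<Oplus>i\<in>{..<n}. ?P i \<otimes> x' i)"
      unfolding lessThan_Suc
    proof (rule v.finsum_insert)
      show "(\<lambda>i. ?P i \<otimes> x' i) \<in> {..<n} \<rightarrow> carrier K" using PE xc by (auto simp: x'_def)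
      show "?P n \<otimes> x' n \<in> carrier K" using PE y by (auto simp: x'_def)
    qed auto
    also have "(\<Oplus>i\<in>{..<n}. ?P i \<otimes> x' i) = ?S"
      by (rule v.finsum_cong') (use PE xc in \<open>auto simp: x'_def\<close>)
    finally have rel: "?P n \<otimes> y \<oplus> ?S = \<zero>" using c(2) by (simp add: x'_def)
    have ne: "?P n \<noteq> \<zero>"
    proof
      assume Pn: "?P n = \<zero>"
      have "\<forall>j\<le>m. c n j \<in> F" using c(1) by (meson lessI lessThan_iff)
      then have cn: "\<forall>j\<le>m. c n j = \<zero>"
        using Pn by (rule v.pole_powers_independent[OF fc f(2,3)])
      have "?S = \<zero> \<otimes> y \<oplus> ?S" by (simp only: v.l_null[OF y] v.l_zero[OF Sc])
      also have "\<dots> = \<zero>" using rel unfolding Pn .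
      finally have S0: "?S = \<zero>" .
      have "\<forall>i\<in>{..<n}. \<forall>j\<le>m. c i j \<in> F" using c(1) by (meson lessThan_iff less_SucI)
      then have "\<forall>i\<in>{..<n}. \<forall>j\<le>m. c i j = \<zero>"
        using x(2)[unfolded v.pol_independent_def] S0 by blast
      then show False using c(3) cn by (metis lessThan_iff less_SucE)
    qed
    have "?S \<in> v.Span ?E Us"
      by (rule v.finsum_in_Span[OF E Us(1)]) (use PE Us(2) in auto)
    then have "\<ominus> ?S \<in> v.Span ?E Us" using v.Span_subgroup_props(4)[OF E Us(1)] by simp
    moreover have "?P n \<otimes> y = \<ominus> ?S"
      using rel PE[of n] y Sc by (simp add: v.minus_equality)
    ultimately have "?P n \<otimes> y \<in> v.Span ?E Us" by simp
    then show ?thesis using v.Span_m_inv_simprule[OF E Us(1) _ y, of "?P n"] PE[of n] ne by simp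
  qed
  then have "v.Span ?E Us = carrier K" using v.Span_in_carrier[OF Es(1) Us(1)] by blast
  then show ?thesis using v.Span_finite_dimension[OF E Us(1)] by simp
qed

lemma ex_poles:
  shows "\<exists>f\<in>R. f \<noteq> \<zero> \<and> v f < 0 \<and> w f < 0"
proof -
  obtain N where N: "\<forall>a\<ge>N. \<forall>b\<ge>N. \<exists>f\<in>R. f \<noteq> \<zero> \<and> v f = - a \<and> w f = - b" using R_poles by auto
  obtain f where "f \<in> R" "f \<noteq> \<zero>" "v f = - max N 1" "w f = - max N 1"
    using N[rule_format, of "max N 1" "max N 1"] by auto
  then show ?thesis by (intro bexI[of _ f]) auto
qed

theorem is_function_field: "function_field K F"
proof -
  obtain f where f: "f \<in> R" "f \<noteq> \<zero>" "v f < 0" "w f < 0" using ex_poles by auto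
  have fc: "f \<in> carrier K" using f R_props(1) by auto
  show ?thesis
    unfolding function_field_def
    using v.field_axioms v.F_subfield fc v.pole_transcendental[OF fc f(2,3)]
      finite_dimension_over_pole[OF f(1-3)] f(4) by auto
qed

end

section \<open>There is no third pole\<close>

context field
begin

text \<open>
  The expansion of a polynomial in \<open>f\<close> at a pole of \<open>f\<close>, where \<open>g = 1 / f\<close> is small; it isolates the
  leading coefficient. In the application \<open>T\<close> is the intersection of three valuation rings.
\<close>

lemma pol_div_power:
  assumes T: "subring T R" and F: "F \<subseteq> T" and g: "g \<in> T" and f: "f \<in> carrier R" "f \<otimes> g = \<one>"
  shows "(\<forall>j\<le>m. c j \<in> F) \<Longrightarrow>
    \<exists>e\<in>T. (\<Oplus>j\<in>{..m::nat}. c j \<otimes> f [^] j) \<otimes> g [^] m = c m \<oplus> g \<otimes> e"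
proof (induction m)
  case 0
  note s = subringE[OF T]
  have "c 0 \<in> carrier R" "g \<in> carrier R" using 0 F g s(1) by auto
  then show ?case using s(2) by (intro bexI[of _ \<zero>]) auto
next
  case (Suc m)
  note s = subringE[OF T]
  have cF: "\<forall>j\<le>m. c j \<in> F" using Suc.prems by (meson le_SucI)
  from Suc.IH[OF cF] obtain e where e: "e \<in> T"
    "(\<Oplus>j\<in>{..m::nat}. c j \<otimes> f [^] j) \<otimes> g [^] m = c m \<oplus> g \<otimes> e" by auto
  let ?S = "\<Oplus>j\<in>{..m}. c j \<otimes> f [^] j"
  have cc: "c j \<in> carrier R" if "j \<le> Suc m" for j using Suc.prems F s(1) that by blast
  have gc: "g \<in> carrier R" "e \<in> carrier R" using g e s(1) by auto
  have Sc: "?S \<in> carrier R" by (rule finsum_closed) (use cc f in auto)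
  have split: "(\<Oplus>j\<in>{..Suc m}. c j \<otimes> f [^] j) = c (Suc m) \<otimes> f [^] Suc m \<oplus> ?S"
    by (rule finsum_Suc) (use cc f(1) in auto)
  have one: "f [^] Suc m \<otimes> g [^] Suc m = \<one>" by (rule pow_inverse_cancel[OF f(1) gc(1) f(2)])
  have "(\<Oplus>j\<in>{..Suc m}. c j \<otimes> f [^] j) \<otimes> g [^] Suc m =
      c (Suc m) \<otimes> (f [^] Suc m \<otimes> g [^] Suc m) \<oplus> (?S \<otimes> g [^] m) \<otimes> g"
    unfolding split using cc[of "Suc m"] f(1) gc Sc
    by (simp add: l_distr m_assoc)
  also have "\<dots> = c (Suc m) \<oplus> g \<otimes> (c m \<oplus> g \<otimes> e)"
    unfolding one e(2) using cc gc by (simp add: m_comm)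
  finally have "(\<Oplus>j\<in>{..Suc m}. c j \<otimes> f [^] j) \<otimes> g [^] Suc m = c (Suc m) \<oplus> g \<otimes> (c m \<oplus> g \<otimes> e)" .
  moreover have "c m \<oplus> g \<otimes> e \<in> T" using s(6,7) g e(1) cF F by blast
  ultimately show ?case by blast
qed

end

context two_point_ring
begin

text \<open>
  All pairs of integers are values, because quotients of elements of \<open>R\<close> with large pole orders realize
  every difference.
\<close>

lemma ex_any_values:
  "\<exists>z\<in>carrier K. z \<noteq> \<zero> \<and> v z = a \<and> w z = b"
proof -
  obtain N where N: "\<forall>a\<ge>N. \<forall>b\<ge>N. \<exists>f\<in>R. f \<noteq> \<zero> \<and> v f = - a \<and> w f = - b" using R_poles by auto
  define M where "M = N + \<bar>a\<bar> + \<bar>b\<bar>"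
  have M: "N \<le> M" "N \<le> M - a" "N \<le> M - b" unfolding M_def by linarith+
  obtain f1 where f1: "f1 \<in> R" "f1 \<noteq> \<zero>" "v f1 = - M" "w f1 = - M"
    using N[rule_format, OF M(1) M(1)] by blast
  obtain f2 where f2: "f2 \<in> R" "f2 \<noteq> \<zero>" "v f2 = - (M - a)" "w f2 = - (M - b)"
    using N[rule_format, OF M(2,3)] by blast
  have c: "f1 \<in> carrier K" "f2 \<in> carrier K" using f1 f2 R_props(1) by auto
  note i = v.inv_nonzero[OF c(1) f1(2)]
  have "f2 \<otimes> inv f1 \<noteq> \<zero>" using c i f2(2) by (auto simp: v.integral_iff)
  moreover have "v (f2 \<otimes> inv f1) = a" "w (f2 \<otimes> inv f1) = b"
    using v.v_mult[OF c(2) i(1) f2(2) i(2)] w.v_mult[OF c(2) i(1) f2(2) i(2)]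
      v.v_inv[OF c(1) f1(2)] w.v_inv[OF c(1) f1(2)] f1 f2 by auto
  ultimately show ?thesis using c i by (intro bexI[of _ "f2 \<otimes> inv f1"]) auto
qed

lemma distinct_places: "v.vge 1 \<noteq> w.vge 1"
proof -
  obtain z where "z \<in> carrier K" "z \<noteq> \<zero>" "v z = 1" "w z = 0" using ex_any_values by blast
  then have "z \<in> v.vge 1" "z \<notin> w.vge 1" by (auto simp: v.vge_def w.vge_def)
  then show ?thesis by auto
qed

text \<open>
  The rings of \<open>v\<close> and \<open>w\<close> are maximal, so \<open>A\<close> is contained in neither of them and has elements with a
  pole at \<open>v\<close> and with a pole at \<open>w\<close>. One of them or their sum, called \<open>z\<close>, has both poles. Of \<open>z\<close> and
  \<open>1 + z\<close> one is a unit of \<open>A\<close>, and its inverse is \<open>s\<close>.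
\<close>

lemma third_valuation_separator:
  assumes A: "valuation_ring K F A" and ne: "A \<noteq> v.vge 0" "A \<noteq> w.vge 0"
  shows "\<exists>s\<in>A. s \<noteq> \<zero> \<and> inv s \<in> A \<and> 0 < v s \<and> 0 < w s"
proof -
  note sr = valuation_ringD(1)[OF A]
  note s = subringE[OF sr]
  have "\<not> A \<subseteq> v.vge 0" "\<not> A \<subseteq> w.vge 0"
    using v.valuation_ring_maximal[OF A] w.valuation_ring_maximal[OF A] ne by auto
  then obtain x y where xy: "x \<in> A" "x \<notin> v.vge 0" "y \<in> A" "y \<notin> w.vge 0" by auto
  have c: "x \<in> carrier K" "y \<in> carrier K" using xy s(1) by auto
  have "\<exists>z\<in>A. z \<notin> v.vge 0 \<and> z \<notin> w.vge 0"
  proof (cases "x \<in> w.vge 0 \<and> y \<in> v.vge 0")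
    case True
    have "(x \<oplus> y) \<ominus> y = x" "(x \<oplus> y) \<ominus> x = y"
      using v.add_minus_cancel[OF c] by (simp_all add: a_minus_def)
    then have "x \<oplus> y \<notin> v.vge 0" "x \<oplus> y \<notin> w.vge 0"
      using v.vge_minus[of "x \<oplus> y" 0 y] w.vge_minus[of "x \<oplus> y" 0 x] xy True by auto
    then show ?thesis using s(7) xy by blast
  qed (use xy in blast)
  then obtain z where z: "z \<in> A" "z \<notin> v.vge 0" "z \<notin> w.vge 0" by auto
  have zc: "z \<in> carrier K" using z s(1) by auto
  have "\<exists>z\<in>A. z \<notin> v.vge 0 \<and> z \<notin> w.vge 0 \<and> z \<notin> nonunits K A"
  proof (cases "z \<in> nonunits K A")
    case True
    have eq: "(\<one> \<oplus> z) \<ominus> \<one> = z" "(\<one> \<oplus> z) \<oplus> (z \<otimes> \<ominus> \<one>) = \<one>"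
      using v.add_minus_cancel[OF v.one_closed zc] zc by (simp_all add: a_minus_def v.r_minus)
    have one: "\<one> \<in> v.vge 0" "\<one> \<in> w.vge 0" using v.F_vge w.F_vge v.F_props(3) by auto
    have "\<one> \<oplus> z \<notin> v.vge 0" "\<one> \<oplus> z \<notin> w.vge 0"
      using v.vge_minus[OF _ one(1), of "\<one> \<oplus> z"] w.vge_minus[OF _ one(2), of "\<one> \<oplus> z"] eq(1) z by auto
    moreover have "\<one> \<oplus> z \<notin> nonunits K A"
      using v.nonunits_add[OF A _ v.nonunits_mult[OF sr True s(5)[OF s(3)]], of "\<one> \<oplus> z"] eq(2)
        v.unit_not_nonunit[OF sr] by auto
    moreover have "\<one> \<oplus> z \<in> A" using s(3,7) z by auto
    ultimately show ?thesis by blast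
  qed (use z in blast)
  then obtain t where t: "t \<in> A" "t \<notin> v.vge 0" "t \<notin> w.vge 0" "t \<notin> nonunits K A" by auto
  have tc: "t \<in> carrier K" "t \<noteq> \<zero>" "inv t \<in> A"
    using t s(1) v.zero_vge by (auto simp: nonunits_def)
  note i = v.inv_nonzero[OF tc(1,2)]
  show ?thesis
    using tc i t v.v_inv[OF tc(1,2)] w.v_inv[OF tc(1,2)]
    by (intro bexI[of _ "inv t"]) (auto simp: v.vge_def w.vge_def)
qed

text \<open>
  The part of weak approximation that is needed. If \<open>x\<close> with the prescribed values is not in \<open>A\<close>, replace
  it by the inverse of \<open>1 / x + s x\<close>. At \<open>v\<close> and \<open>w\<close> the summand \<open>1 / x\<close> dominates because \<open>s\<close>
  has positive and \<open>x\<close> has nonnegative values, so the values do not change. As \<open>s\<close> is a unit of \<open>A\<close>,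
  the summand \<open>s x\<close> is outside \<open>A\<close> while \<open>1 / x\<close> is inside; so the sum is outside and its inverse inside.
\<close>

lemma values_in_third_ring:
  assumes A: "valuation_ring K F A"
    and s: "s \<in> A" "s \<noteq> \<zero>" "inv s \<in> A" "0 < v s" "0 < w s"
    and ab: "0 \<le> a" "0 \<le> b"
  shows "\<exists>z\<in>A. z \<noteq> \<zero> \<and> v z = a \<and> w z = b"
proof -
  note sa = subringE[OF valuation_ringD(1)[OF A]]
  obtain x where x: "x \<in> carrier K" "x \<noteq> \<zero>" "v x = a" "w x = b" using ex_any_values by blast
  show ?thesis
  proof (cases "x \<in> A")
    case False
    note ix = v.inv_nonzero[OF x(1,2)]
    have sc: "s \<in> carrier K" using s sa(1) by auto
    have ixA: "inv x \<in> A" using valuation_ringD(4)[OF A x(1,2) False] .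
    define y where "y = inv x \<oplus> s \<otimes> x"
    have sx: "s \<otimes> x \<in> carrier K" "s \<otimes> x \<noteq> \<zero>" "v (s \<otimes> x) = v s + a" "w (s \<otimes> x) = w s + b"
      using x s sc v.v_mult[OF sc x(1) s(2) x(2)] w.v_mult[OF sc x(1) s(2) x(2)]
      by (auto simp: v.integral_iff)
    have yA: "y \<notin> A"
    proof
      assume "y \<in> A"
      then have "y \<oplus> \<ominus> (inv x) \<in> A" using sa(5,7) ixA by auto
      moreover have "y \<oplus> \<ominus> (inv x) = s \<otimes> x"
        unfolding y_def by (rule v.add_minus_cancel(2)[OF ix(1) sx(1)])
      ultimately have "inv s \<otimes> (s \<otimes> x) \<in> A" using sa(6) s(3) by auto
      moreover have "inv s \<otimes> (s \<otimes> x) = x"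
        using v.inv_nonzero[OF sc s(2)] sc x(1) by (simp add: v.m_assoc[symmetric])
      ultimately show False using False by simp
    qed
    have yc: "y \<in> carrier K" using ix sx by (simp add: y_def)
    have y0: "y \<noteq> \<zero>" using yA sa(2) by auto
    have vx: "v (inv x) = - a" "w (inv x) = - b" using v.v_inv[OF x(1,2)] w.v_inv[OF x(1,2)] x by auto
    have "v y = - a" "w y = - b"
      using v.v_add_dominated(2)[OF ix(1,2), of "s \<otimes> x"] w.v_add_dominated(2)[OF ix(1,2), of "s \<otimes> x"]
        v.vgeI[OF sx(1), of "v (inv x) + 1"] w.vgeI[OF sx(1), of "w (inv x) + 1"] sx vx s ab
      by (auto simp: y_def)
    then show ?thesis
      using valuation_ringD(4)[OF A yc y0 yA] v.inv_nonzero[OF yc y0] v.v_inv[OF yc y0] w.v_inv[OF yc y0]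
      by (intro bexI[of _ "inv y"]) auto
  qed (use x in blast)
qed

text \<open>
  Suppose that \<open>f \<in> R\<close> is not in \<open>A\<close>; adding an element of \<open>R\<close> if necessary, \<open>f\<close> has poles of
  orders \<open>p\<close> and \<open>q\<close> at \<open>v\<close> and \<open>w\<close>. Choose \<open>p + q\<close> elements of \<open>A\<close> that have values
  \<open>0, \<dots>, p - 1\<close> at \<open>v\<close> and at least \<open>q\<close> at \<open>w\<close>, or values \<open>0, \<dots>, q - 1\<close> at \<open>w\<close> and at least \<open>p\<close> at
  \<open>v\<close>, and add a unit \<open>u\<close> of \<open>A\<close> with values at least \<open>p\<close> and \<open>q\<close>. These \<open>p + q + 1\<close> elements are
  independent over \<open>F[f]\<close>: dividing a relation by the highest power of \<open>f\<close> yields a combination with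
  constant coefficients that is divisible by \<open>g = 1 / f\<close> at all three places, and looking at \<open>v\<close>, then at
  \<open>w\<close>, then at \<open>A\<close> shows that these constants vanish. This contradicts the bound on the
  degree of \<open>K\<close> over \<open>F(f)\<close>.
\<close>

lemma third_valuation_contains_ring:
  assumes A: "valuation_ring K F A" and ne: "A \<noteq> v.vge 0" "A \<noteq> w.vge 0"
  shows "R \<subseteq> A"
proof (rule ccontr)
  note sr = valuation_ringD(1)[OF A]
  note sa = subringE[OF sr]
  assume "\<not> R \<subseteq> A"
  then obtain r where r: "r \<in> R" "r \<notin> A" by auto
  have rc: "r \<in> carrier K" "r \<noteq> \<zero>" using r R_props(1) sa(2) by auto
  have "\<exists>f\<in>R. f \<notin> A \<and> v f < 0 \<and> w f < 0"
  proof -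
    obtain N where N: "\<forall>a\<ge>N. \<forall>b\<ge>N. \<exists>f\<in>R. f \<noteq> \<zero> \<and> v f = - a \<and> w f = - b" using R_poles by auto
    define M where "M = max 1 (max N (1 + max (- v r) (- w r)))"
    have M: "N \<le> M" "1 \<le> M" "1 - v r \<le> M" "1 - w r \<le> M" unfolding M_def by linarith+
    obtain f where f: "f \<in> R" "f \<noteq> \<zero>" "v f = - M" "w f = - M"
      using N[rule_format, OF M(1) M(1)] by blast
    have fc: "f \<in> carrier K" using f R_props(1) by auto
    have neg: "v f < 0" "w f < 0" using f M(2) by auto
    show ?thesis
    proof (cases "f \<in> A")
      case True
      have "r \<in> v.vge (v f + 1)" "r \<in> w.vge (w f + 1)"
        using f M(3,4) by (intro v.vgeI w.vgeI rc(1); simp)+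
      then have "v (f \<oplus> r) = v f" "w (f \<oplus> r) = w f"
        using v.v_add_dominated[OF fc f(2)] w.v_add_dominated[OF fc f(2)] by auto
      moreover have "f \<oplus> r \<notin> A"
      proof
        assume "f \<oplus> r \<in> A"
        then have "(f \<oplus> r) \<oplus> \<ominus> f \<in> A" using sa(5,7) True by auto
        moreover have "(f \<oplus> r) \<oplus> \<ominus> f = r" by (rule v.add_minus_cancel(2)[OF fc rc(1)])
        ultimately show False using r by simp
      qed
      moreover have "f \<oplus> r \<in> R" using R_props(7) f r by auto
      ultimately show ?thesis using neg by (intro bexI[of _ "f \<oplus> r"]) auto
    qed (use f neg in blast)
  qed
  then obtain f where f: "f \<in> R" "f \<notin> A" "v f < 0" "w f < 0" by auto
  have fc: "f \<in> carrier K" "f \<noteq> \<zero>" using f R_props(1) sa(2) by auto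
  define p where "p = nat (- v f)"
  define q where "q = nat (- w f)"
  have pq: "v f = - int p" "w f = - int q" using f by (auto simp: p_def q_def)
  obtain s where s: "s \<in> A" "s \<noteq> \<zero>" "inv s \<in> A" "0 < v s" "0 < w s"
    using third_valuation_separator[OF A ne] by auto
  have sc: "s \<in> carrier K" using s sa(1) by auto
  define u where "u = s [^] (p + q)"
  have u: "u \<in> A" "u \<in> carrier K" "u \<noteq> \<zero>" "v u = int (p + q) * v s" "w u = int (p + q) * w s"
    using v.v_nat_pow[OF sc s(2), of "p + q"] w.v_nat_pow[OF sc s(2), of "p + q"] sc
      v.nat_pow_in_subring[OF sr s(1)] by (auto simp: u_def)
  have ui: "inv s [^] (p + q) \<in> A" "u \<otimes> inv s [^] (p + q) = \<one>"
    using v.nat_pow_in_subring[OF sr s(3)] v.pow_inverse_cancel[OF sc _ v.inv_nonzero(3)[OF sc s(2)]]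
      v.inv_nonzero(1)[OF sc s(2)] by (auto simp: u_def)
  have uv: "int p \<le> v u" "int q \<le> w u"
  proof -
    have "int (p + q) * 1 \<le> int (p + q) * v s" "int (p + q) * 1 \<le> int (p + q) * w s"
      using s(4,5) by (intro mult_left_mono; simp)+
    then show "int p \<le> v u" "int q \<le> w u" using u by auto
  qed
  have "\<forall>k. \<exists>z\<in>A. z \<noteq> \<zero> \<and> v z = (if k < p then int k else int p) \<and>
      w z = (if k < p then int q else int (k - p))"
    using values_in_third_ring[OF A s] by auto
  then obtain y where y: "\<And>k. y k \<in> A" "\<And>k. y k \<noteq> \<zero>" "\<And>k. v (y k) = (if k < p then int k else int p)"
    "\<And>k. w (y k) = (if k < p then int q else int (k - p))" by metis
  define x where "x = (\<lambda>k. if k < p + q then y k else u)"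
  let ?I = "{..p + q}"
  have xA: "x k \<in> A" "x k \<in> carrier K" "x k \<noteq> \<zero>" for k
    using y(1,2) u(1-3) sa(1) by (auto simp: x_def)
  have xv: "v (x k) = int k" "w (x k) = int q" if "k < p" for k using that y by (auto simp: x_def)
  have xw: "v (x k) = int p" "w (x k) = int (k - p)" if "p \<le> k" "k < p + q" for k
    using that y by (auto simp: x_def)
  have xl: "x (p + q) = u" by (simp add: x_def)
  define T where "T = A \<inter> v.vge 0 \<inter> w.vge 0"
  have T: "subring T K" unfolding T_def using v.subring_inter sr v.vge_subring w.vge_subring by auto
  have FT: "F \<subseteq> T" using v.F_vge w.F_vge valuation_ringD(2)[OF A] by (auto simp: T_def)
  have xT: "x k \<in> T" for k
  proof -
    have "0 \<le> v (x k)" "0 \<le> w (x k)" using y(3,4) uv by (auto simp: x_def)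
    then show ?thesis using xA by (simp add: T_def v.vgeI w.vgeI)
  qed
  define g where "g = inv f"
  note i = v.inv_nonzero[OF fc, folded g_def]
  have gA: "g \<in> A" using valuation_ringD(4)[OF A fc f(2)] by (simp add: g_def)
  have gn: "g \<in> nonunits K A" using gA i f(2) by (auto simp: nonunits_def)
  have gv: "v g = int p" "w g = int q" using v.v_inv[OF fc] w.v_inv[OF fc] pq by (auto simp: g_def)
  have gT: "g \<in> T" using gA i gv by (auto simp: T_def intro!: v.vgeI w.vgeI)
  \<comment> \<open>a combination with constant coefficients that is divisible by \<open>g\<close> at all three places is trivial\<close>
  have triv: "\<forall>k\<in>?I. c k = \<zero>"
    if c: "\<forall>k\<in>?I. c k \<in> F" and e: "e \<in> T" "(\<Oplus>k\<in>?I. c k \<otimes> x k) = g \<otimes> e" for c e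
  proof -
    have ge: "g \<otimes> e \<in> v.vge (int p)" "g \<otimes> e \<in> w.vge (int q)" "g \<otimes> e \<in> nonunits K A"
      using v.vge_mult[of g "int p" e 0] w.vge_mult[of g "int q" e 0] v.nonunits_mult[OF sr gn]
        e(1) v.vgeI[OF i(1), of "int p"] w.vgeI[OF i(1), of "int q"] gv by (auto simp: T_def)
    \<comment> \<open>the least \<open>k\<close> with a nonzero coefficient would determine the value at \<open>v\<close> (if \<open>k < p\<close>) or at \<open>w\<close>\<close>
    have low: "c k = \<zero>" if "k < p + q" for k
      using that
    proof (induction k rule: less_induct)
      case (less k)
      show ?case
      proof (cases "k < p")
        case True
        show ?thesis
        proof (rule v.leading_coefficient_zero[of ?I k c x])
          show "(\<Oplus>j\<in>?I. c j \<otimes> x j) \<in> v.vge (v (x k) + 1)"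
            unfolding e(2) by (rule v.vge_mono[OF ge(1)]) (use xv(1) True in simp)
          show "c j = \<zero> \<or> x j \<in> v.vge (v (x k) + 1)" if j: "j \<in> ?I" "j \<noteq> k" for j
          proof (cases "j < k")
            case True then show ?thesis using less by auto
          next
            case False
            then have "k < j" using j by auto
            have "int k + 1 \<le> v (x j)"
            proof (cases "j < p")
              case True then show ?thesis using xv(1) \<open>k < j\<close> by simp
            next
              case False
              then have "int p \<le> v (x j)" using xw(1)[of j] xl uv(1) j(1) by (cases "j < p + q") auto
              then show ?thesis using \<open>k < p\<close> by linarith
            qed
            then show ?thesis using xA xv(1)[OF True] by (auto intro!: v.vgeI)
          qed
        qed (use less.prems c xA in auto)
      next
        case False
        then have kp: "p \<le> k" by simp
        show ?thesis
        proof (rule w.leading_coefficient_zero[of ?I k c x])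
          show "(\<Oplus>j\<in>?I. c j \<otimes> x j) \<in> w.vge (w (x k) + 1)"
            unfolding e(2) by (rule w.vge_mono[OF ge(2)]) (use xw(2)[OF kp less.prems] less.prems kp in simp)
          show "c j = \<zero> \<or> x j \<in> w.vge (w (x k) + 1)" if j: "j \<in> ?I" "j \<noteq> k" for j
          proof (cases "j < k")
            case True then show ?thesis using less by auto
          next
            case False
            then have kj: "k < j" using j by auto
            have "int (k - p) + 1 \<le> w (x j)"
            proof (cases "j < p + q")
              case True then show ?thesis using xw(2)[of j] kj kp by simp
            next
              case False
              then have "j = p + q" using j by simp
              then show ?thesis using xl uv(2) kp less.prems by simp
            qed
            then show ?thesis using xA xw(2)[OF kp less.prems] by (auto intro!: w.vgeI)
          qed
        qed (use less.prems c xA in auto)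
      qed
    qed
    \<comment> \<open>only the multiple of the unit \<open>u\<close> is left, and a unit is not divisible by \<open>g\<close>\<close>
    have "c (p + q) = \<zero>"
    proof (rule ccontr)
      assume n: "c (p + q) \<noteq> \<zero>"
      let ?c = "c (p + q)"
      have cF: "?c \<in> F" using c by auto
      have cc: "c j \<in> carrier K" if "j \<in> ?I" for j using c v.F_carrier that by auto
      have "(\<Oplus>k\<in>?I. c k \<otimes> x k) = ?c \<otimes> x (p + q) \<oplus> (\<Oplus>k\<in>?I - {p + q}. c k \<otimes> x k)"
        by (rule v.finsum_remove) (use cc xA in auto)
      also have "(\<Oplus>k\<in>?I - {p + q}. c k \<otimes> x k) = \<zero>"
      proof (rule v.add.finprod_one_eqI)
        fix k assume "k \<in> ?I - {p + q}"
        then have "c k = \<zero>" using low[of k] by auto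
        then show "c k \<otimes> x k = \<zero>" using xA(2) by simp
      qed
      finally have "?c \<otimes> u = g \<otimes> e" using e(2) xl cc[of "p + q"] u(2) by simp
      then have "?c \<otimes> u \<in> nonunits K A" using ge(3) by simp
      moreover have ic: "inv ?c \<in> F" using v.subfield_m_inv(1)[OF v.F_subfield] cF n by auto
      moreover have "inv ?c \<otimes> inv s [^] (p + q) \<in> A" using ic valuation_ringD(2)[OF A] ui(1) sa(6) by blast
      ultimately have "(?c \<otimes> u) \<otimes> (inv ?c \<otimes> inv s [^] (p + q)) \<in> nonunits K A"
        using v.nonunits_mult[OF sr] by blast
      moreover have "(?c \<otimes> u) \<otimes> (inv ?c \<otimes> inv s [^] (p + q)) = (?c \<otimes> inv ?c) \<otimes> (u \<otimes> inv s [^] (p + q))"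
        using cc[of "p + q"] u(2) v.inv_nonzero(1)[OF _ n] ui(1) sa(1) v.inv_nonzero(1)[OF sc s(2)]
        by (simp add: v.m_ac)
      moreover have "\<dots> = \<one>" using v.inv_nonzero(3)[OF cc n] ui(2) by simp
      ultimately show False using v.unit_not_nonunit[OF sr] by simp
    qed
    then show ?thesis using low by (metis atMost_iff le_neq_implies_less)
  qed
  \<comment> \<open>dividing by the \<open>m\<close>-th power of \<open>f\<close> reduces the leading coefficients to the constant case\<close>
  have lead: "\<forall>k\<in>?I. c k m = \<zero>"
    if c: "\<forall>k\<in>?I. \<forall>j\<le>m. c k j \<in> F"
      and z: "(\<Oplus>k\<in>?I. (\<Oplus>j\<in>{..m::nat}. c k j \<otimes> f [^] j) \<otimes> x k) = \<zero>" for m c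
  proof -
    let ?D = "\<lambda>k. \<Oplus>j\<in>{..m}. c k j \<otimes> f [^] j"
    have cF: "c k j \<in> F" "c k j \<in> carrier K" if "k \<in> ?I" "j \<le> m" for k j
      using c that v.F_carrier by blast+
    have "\<forall>k\<in>?I. \<exists>e\<in>T. ?D k \<otimes> g [^] m = c k m \<oplus> g \<otimes> e"
      using v.pol_div_power[OF T FT gT fc(1) i(3)] c by blast
    then obtain e where e: "\<And>k. k \<in> ?I \<Longrightarrow> e k \<in> T"
      "\<And>k. k \<in> ?I \<Longrightarrow> ?D k \<otimes> g [^] m = c k m \<oplus> g \<otimes> e k" by metis
    have ec: "e k \<in> carrier K" if "k \<in> ?I" for k using e(1)[OF that] subringE(1)[OF T] by auto
    have Dc: "?D k \<in> carrier K" if "k \<in> ?I" for k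
      by (rule v.finsum_closed) (use cF(2)[OF that] fc in auto)
    let ?E = "\<Oplus>k\<in>?I. e k \<otimes> x k"
    have E: "?E \<in> T" by (rule v.finsum_in_subring[OF T]) (use e(1) xT subringE(6)[OF T] in auto)
    then have Ec: "?E \<in> carrier K" using subringE(1)[OF T] by auto
    have gm: "g [^] m \<in> carrier K" using i(1) by simp
    have Cc: "(\<Oplus>k\<in>?I. c k m \<otimes> x k) \<in> carrier K" by (rule v.finsum_closed) (use cF(2) xA in auto)
    have "\<zero> = (\<Oplus>k\<in>?I. ?D k \<otimes> x k) \<otimes> g [^] m" unfolding z by (rule v.l_null[OF gm, symmetric])
    also have "\<dots> = (\<Oplus>k\<in>?I. ?D k \<otimes> x k \<otimes> g [^] m)"
      by (rule v.finsum_ldistr) (use Dc xA gm in auto)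
    also have "\<dots> = (\<Oplus>k\<in>?I. c k m \<otimes> x k \<oplus> g \<otimes> (e k \<otimes> x k))"
    proof (rule v.finsum_cong')
      fix k assume k: "k \<in> ?I"
      have "?D k \<otimes> x k \<otimes> g [^] m = (?D k \<otimes> g [^] m) \<otimes> x k"
        using Dc[OF k] xA(2) gm by (simp add: v.m_ac)
      also have "\<dots> = c k m \<otimes> x k \<oplus> g \<otimes> (e k \<otimes> x k)"
        unfolding e(2)[OF k] using cF(2)[OF k order_refl] ec[OF k] i(1) xA(2)[of k]
        by (simp add: v.l_distr v.m_assoc)
      finally show "?D k \<otimes> x k \<otimes> g [^] m = c k m \<otimes> x k \<oplus> g \<otimes> (e k \<otimes> x k)" .
    qed (use cF(2) xA ec i in auto)
    also have "\<dots> = (\<Oplus>k\<in>?I. c k m \<otimes> x k) \<oplus> (\<Oplus>k\<in>?I. g \<otimes> (e k \<otimes> x k))"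
      by (rule v.finsum_addf) (use cF(2) xA ec i in auto)
    also have "(\<Oplus>k\<in>?I. g \<otimes> (e k \<otimes> x k)) = g \<otimes> ?E"
      by (rule v.finsum_rdistr[symmetric]) (use xA ec i in auto)
    finally have "(\<Oplus>k\<in>?I. c k m \<otimes> x k) \<oplus> g \<otimes> ?E = \<zero>" by (rule sym)
    then have "(\<Oplus>k\<in>?I. c k m \<otimes> x k) = \<ominus> (g \<otimes> ?E)"
      by (rule v.minus_equality[symmetric]) (use Cc Ec i in auto)
    also have "\<dots> = g \<otimes> (\<ominus> ?E)" using Ec i(1) by (simp add: v.r_minus)
    finally have eq: "(\<Oplus>k\<in>?I. c k m \<otimes> x k) = g \<otimes> (\<ominus> ?E)" .
    show ?thesis
      by (rule triv[OF _ subringE(5)[OF T E] eq]) (use cF(1) in blast)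
  qed
  have "v.pol_independent F f ?I x"
    unfolding v.pol_independent_def
  proof (intro allI impI)
    fix m c
    assume "\<forall>k\<in>?I. \<forall>j\<le>m. c k j \<in> F" "(\<Oplus>k\<in>?I. (\<Oplus>j\<in>{..m::nat}. c k j \<otimes> f [^] j) \<otimes> x k) = \<zero>"
    then show "\<forall>k\<in>?I. \<forall>j\<le>m. c k j = \<zero>"
    proof (induction m)
      case 0
      show ?case using lead[OF 0] by blast
    next
      case (Suc m)
      have top: "\<forall>k\<in>?I. c k (Suc m) = \<zero>" by (rule lead[OF Suc.prems])
      have cc: "c k j \<in> carrier K" if "k \<in> ?I" "j \<le> Suc m" for k j
        using Suc.prems(1) that v.F_carrier by blast
      have "(\<Oplus>k\<in>?I. (\<Oplus>j\<in>{..m}. c k j \<otimes> f [^] j) \<otimes> x k) =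
          (\<Oplus>k\<in>?I. (\<Oplus>j\<in>{..Suc m}. c k j \<otimes> f [^] j) \<otimes> x k)"
      proof (rule v.finsum_cong')
        fix k assume k: "k \<in> ?I"
        have Sc: "(\<Oplus>j\<in>{..m}. c k j \<otimes> f [^] j) \<in> carrier K"
          by (rule v.finsum_closed) (use cc[OF k] fc(1) in auto)
        have "(\<Oplus>j\<in>{..Suc m}. c k j \<otimes> f [^] j) =
            c k (Suc m) \<otimes> f [^] Suc m \<oplus> (\<Oplus>j\<in>{..m}. c k j \<otimes> f [^] j)"
          by (rule v.finsum_Suc) (use cc[OF k] fc(1) in auto)
        also have "\<dots> = (\<Oplus>j\<in>{..m}. c k j \<otimes> f [^] j)"
          by (simp only: top[rule_format, OF k] v.l_null[OF v.nat_pow_closed[OF fc(1)]] v.l_zero[OF Sc])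
        finally show "(\<Oplus>j\<in>{..m}. c k j \<otimes> f [^] j) \<otimes> x k =
            (\<Oplus>j\<in>{..Suc m}. c k j \<otimes> f [^] j) \<otimes> x k" by (rule arg_cong[OF sym])
      next
        show "(\<lambda>k. (\<Oplus>j\<in>{..Suc m}. c k j \<otimes> f [^] j) \<otimes> x k) \<in> ?I \<rightarrow> carrier K"
        proof
          fix k assume k: "k \<in> ?I"
          have "(\<Oplus>j\<in>{..Suc m}. c k j \<otimes> f [^] j) \<in> carrier K"
            by (rule v.finsum_closed) (use cc[OF k] fc(1) in auto)
          then show "(\<Oplus>j\<in>{..Suc m}. c k j \<otimes> f [^] j) \<otimes> x k \<in> carrier K" using xA(2) by blast
        qed
      qed simp
      also have "\<dots> = \<zero>" by (rule Suc.prems(2))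
      finally have "(\<Oplus>k\<in>?I. (\<Oplus>j\<in>{..m}. c k j \<otimes> f [^] j) \<otimes> x k) = \<zero>" .
      moreover have "\<forall>k\<in>?I. \<forall>j\<le>m. c k j \<in> F" using Suc.prems(1) by (meson le_SucI)
      ultimately have "\<forall>k\<in>?I. \<forall>j\<le>m. c k j = \<zero>" by (intro Suc.IH)
      then show ?case using top by (metis le_SucE)
    qed
  qed
  then have "int (card ?I) \<le> - v f - w f"
    by (intro pol_independent_card[OF f(1) fc(2)]) (use f xA in auto)
  then show False using pq by simp
qed

end

section \<open>The integral closure of a two point ring\<close>

context two_point_ring
begin

text \<open>
  The two excluded places are exactly those whose rings do not contain \<open>R\<close>, so the intersection
  runs over the valuation rings above \<open>R\<close>.
\<close>

theorem integral_closure_eq_places: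
  "integral_closure K R =
     carrier K \<inter> (\<Inter>S \<in> places K F - {v.vge 1, w.vge 1}. place_ring K F S)"
proof (intro equalityI subsetI)
  fix z assume z: "z \<in> integral_closure K R"
  have "z \<in> place_ring K F S" if S: "S \<in> places K F - {v.vge 1, w.vge 1}" for S
  proof -
    obtain A where A: "place_of K F A S" using S unfolding places_def by auto
    then have vr: "valuation_ring K F A" unfolding place_of_def by simp
    have "A \<noteq> v.vge 0" "A \<noteq> w.vge 0"
      using v.place_eq_nonunits[OF A] v.nonunits_vge w.nonunits_vge S by auto
    then have "R \<subseteq> A" by (rule third_valuation_contains_ring[OF vr])
    then have "z \<in> A" by (rule v.integral_closure_in_valuation_ring[OF vr R_subring _ z])
    then show ?thesis using v.place_ring_eq[OF A] by simp
  qed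
  moreover have "z \<in> carrier K" using z unfolding integral_closure_def by simp
  ultimately show "z \<in> carrier K \<inter> (\<Inter>S \<in> places K F - {v.vge 1, w.vge 1}. place_ring K F S)"
    by blast
next
  fix z assume z: "z \<in> carrier K \<inter> (\<Inter>S \<in> places K F - {v.vge 1, w.vge 1}. place_ring K F S)"
  obtain f where f: "f \<in> R" "f \<noteq> \<zero>" "v f < 0" "w f < 0" using ex_poles by auto
  have fv: "f \<notin> v.vge 0" "f \<notin> w.vge 0" using f by (auto simp: v.vge_def w.vge_def)
  then have "F \<subset> R" using f(1) F_R v.F_vge by blast
  show "z \<in> integral_closure K R"
  proof (rule ccontr)
    assume "z \<notin> integral_closure K R"
    then obtain A where A: "valuation_ring K F A" "R \<subseteq> A" "z \<notin> A"
      using v.valuation_ring_avoiding_non_integral[OF R_subring \<open>F \<subset> R\<close>] z by blast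
    note P = v.valuation_ring_place[OF A(1)]
    have "A \<noteq> v.vge 0" "A \<noteq> w.vge 0" using A(2) f(1) fv by auto
    then have "nonunits K A \<noteq> v.vge 1" "nonunits K A \<noteq> w.vge 1"
      using v.place_ring_eq[OF P] v.vge_place_ring w.vge_place_ring by auto
    then have "nonunits K A \<in> places K F - {v.vge 1, w.vge 1}"
      using P unfolding places_def by auto
    then have "z \<in> place_ring K F (nonunits K A)" using z by blast
    then show False using A(3) v.place_ring_eq[OF P] by simp
  qed
qed

end

section \<open>The quotient field\<close>

lemma (in domain) fract_class_mem:
  "(x, y) \<in> fract_class R a b \<longleftrightarrow> a \<in> carrier R \<and> b \<in> carrier R - {\<zero>} \<and>
     x \<in> carrier R \<and> y \<in> carrier R - {\<zero>} \<and> a \<otimes> y = x \<otimes> b"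
  unfolding fract_class_def frac_rel_def by auto

lemma (in domain) frac_rel_equiv: "equiv (carrier R \<times> (carrier R - {\<zero>})) (frac_rel R)"
proof (rule equivI)
  show "frac_rel R \<subseteq> (carrier R \<times> (carrier R - {\<zero>})) \<times> (carrier R \<times> (carrier R - {\<zero>}))"
    by (auto simp: frac_rel_def)
  show "refl_on (carrier R \<times> (carrier R - {\<zero>})) (frac_rel R)"
    by (auto simp: refl_on_def frac_rel_def)
  show "sym (frac_rel R)" by (auto simp: sym_def frac_rel_def)
  show "trans (frac_rel R)"
  proof (rule transI, clarify)
    fix a b c d e f
    assume "((a, b), (c, d)) \<in> frac_rel R" "((c, d), (e, f)) \<in> frac_rel R"
    then have h: "a \<in> carrier R" "b \<in> carrier R" "b \<noteq> \<zero>" "c \<in> carrier R" "d \<in> carrier R" "d \<noteq> \<zero>"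
      "e \<in> carrier R" "f \<in> carrier R" "f \<noteq> \<zero>" "a \<otimes> d = c \<otimes> b" "c \<otimes> f = e \<otimes> d"
      by (auto simp: frac_rel_def)
    have "d \<otimes> (a \<otimes> f) = (a \<otimes> d) \<otimes> f" using h(1-9) by (simp add: m_ac)
    also have "\<dots> = (c \<otimes> f) \<otimes> b" unfolding h(10) using h(1-9) by (simp add: m_ac)
    also have "\<dots> = d \<otimes> (e \<otimes> b)" unfolding h(11) using h(1-9) by (simp add: m_ac)
    finally have "a \<otimes> f = e \<otimes> b" using h by (simp add: m_lcancel)
    then show "((a, b), (e, f)) \<in> frac_rel R" using h by (auto simp: frac_rel_def)
  qed
qed

context domain
begin

abbreviation "Q \<equiv> quotient_field R"

lemma fract_class_eq:
  assumes "a \<in> carrier R" "b \<in> carrier R" "b \<noteq> \<zero>" "c \<in> carrier R" "d \<in> carrier R" "d \<noteq> \<zero>"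
  shows "fract_class R a b = fract_class R c d \<longleftrightarrow> a \<otimes> d = c \<otimes> b"
  unfolding fract_class_def
  using eq_equiv_class_iff[OF frac_rel_equiv, of "(a, b)" "(c, d)"] assms by (simp add: frac_rel_def)

lemma fract_class_in_Q:
  assumes "a \<in> carrier R" "b \<in> carrier R" "b \<noteq> \<zero>"
  shows "fract_class R a b \<in> carrier Q"
  using assms by (auto simp: quotient_field_def fract_class_def intro!: quotientI)

lemma Q_cases:
  assumes "z \<in> carrier Q"
  obtains a b where "a \<in> carrier R" "b \<in> carrier R" "b \<noteq> \<zero>" "z = fract_class R a b"
  using assms unfolding quotient_field_def fract_class_def by (auto elim!: quotientE)

lemma Union_const: "A \<noteq> {} \<Longrightarrow> (\<And>x. x \<in> A \<Longrightarrow> x = y) \<Longrightarrow> \<Union>A = y" by auto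

lemma Q_mult:
  assumes "a \<in> carrier R" "b \<in> carrier R" "b \<noteq> \<zero>" "c \<in> carrier R" "d \<in> carrier R" "d \<noteq> \<zero>"
  shows "fract_class R a b \<otimes>\<^bsub>Q\<^esub> fract_class R c d = fract_class R (a \<otimes> c) (b \<otimes> d)"
proof -
  have "\<Union>{fract_class R (a' \<otimes> c') (b' \<otimes> d') | a' b' c' d'.
      (a', b') \<in> fract_class R a b \<and> (c', d') \<in> fract_class R c d} = fract_class R (a \<otimes> c) (b \<otimes> d)"
  proof (rule Union_const)
    have "(a, b) \<in> fract_class R a b" "(c, d) \<in> fract_class R c d"
      using assms by (auto simp: fract_class_mem)
    then show "{fract_class R (a' \<otimes> c') (b' \<otimes> d') | a' b' c' d'.
      (a', b') \<in> fract_class R a b \<and> (c', d') \<in> fract_class R c d} \<noteq> {}" by blast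
  next
    fix x assume "x \<in> {fract_class R (a' \<otimes> c') (b' \<otimes> d') | a' b' c' d'.
      (a', b') \<in> fract_class R a b \<and> (c', d') \<in> fract_class R c d}"
    then obtain a' b' c' d' where h: "x = fract_class R (a' \<otimes> c') (b' \<otimes> d')"
      "a' \<in> carrier R" "b' \<in> carrier R" "b' \<noteq> \<zero>" "a \<otimes> b' = a' \<otimes> b"
      "c' \<in> carrier R" "d' \<in> carrier R" "d' \<noteq> \<zero>" "c \<otimes> d' = c' \<otimes> d"
      by (auto simp: fract_class_mem)
    have "(a' \<otimes> c') \<otimes> (b \<otimes> d) = (a' \<otimes> b) \<otimes> (c' \<otimes> d)" using h(2-4,6-8) assms by (simp add: m_ac)
    also have "\<dots> = (a \<otimes> c) \<otimes> (b' \<otimes> d')"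
      unfolding h(5)[symmetric] h(9)[symmetric] using h(2-4,6-8) assms by (simp add: m_ac)
    finally show "x = fract_class R (a \<otimes> c) (b \<otimes> d)"
      unfolding h(1) using h assms by (subst fract_class_eq) (auto simp: integral_iff)
  qed
  then show ?thesis by (simp add: quotient_field_def)
qed

lemma Q_add:
  assumes "a \<in> carrier R" "b \<in> carrier R" "b \<noteq> \<zero>" "c \<in> carrier R" "d \<in> carrier R" "d \<noteq> \<zero>"
  shows "fract_class R a b \<oplus>\<^bsub>Q\<^esub> fract_class R c d = fract_class R (a \<otimes> d \<oplus> c \<otimes> b) (b \<otimes> d)"
proof -
  have "\<Union>{fract_class R (a' \<otimes> d' \<oplus> c' \<otimes> b') (b' \<otimes> d') | a' b' c' d'.
      (a', b') \<in> fract_class R a b \<and> (c', d') \<in> fract_class R c d} = fract_class R (a \<otimes> d \<oplus> c \<otimes> b) (b \<otimes> d)"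
  proof (rule Union_const)
    have "(a, b) \<in> fract_class R a b" "(c, d) \<in> fract_class R c d"
      using assms by (auto simp: fract_class_mem)
    then show "{fract_class R (a' \<otimes> d' \<oplus> c' \<otimes> b') (b' \<otimes> d') | a' b' c' d'.
      (a', b') \<in> fract_class R a b \<and> (c', d') \<in> fract_class R c d} \<noteq> {}" by blast
  next
    fix x assume "x \<in> {fract_class R (a' \<otimes> d' \<oplus> c' \<otimes> b') (b' \<otimes> d') | a' b' c' d'.
      (a', b') \<in> fract_class R a b \<and> (c', d') \<in> fract_class R c d}"
    then obtain a' b' c' d' where h: "x = fract_class R (a' \<otimes> d' \<oplus> c' \<otimes> b') (b' \<otimes> d')"
      "a' \<in> carrier R" "b' \<in> carrier R" "b' \<noteq> \<zero>" "a \<otimes> b' = a' \<otimes> b"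
      "c' \<in> carrier R" "d' \<in> carrier R" "d' \<noteq> \<zero>" "c \<otimes> d' = c' \<otimes> d"
      by (auto simp: fract_class_mem)
    have "(a' \<otimes> d' \<oplus> c' \<otimes> b') \<otimes> (b \<otimes> d) = (a' \<otimes> b) \<otimes> (d' \<otimes> d) \<oplus> (c' \<otimes> d) \<otimes> (b' \<otimes> b)"
      using h(2-4,6-8) assms by (simp add: l_distr r_distr m_ac)
    also have "\<dots> = (a \<otimes> d \<oplus> c \<otimes> b) \<otimes> (b' \<otimes> d')"
      unfolding h(5)[symmetric] h(9)[symmetric] using h(2-4,6-8) assms by (simp add: l_distr r_distr m_ac)
    finally show "x = fract_class R (a \<otimes> d \<oplus> c \<otimes> b) (b \<otimes> d)"
      unfolding h(1) using h assms by (subst fract_class_eq) (auto simp: integral_iff)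
  qed
  then show ?thesis by (simp add: quotient_field_def)
qed

lemma Q_one: "\<one>\<^bsub>Q\<^esub> = fract_class R \<one> \<one>" and Q_zero: "\<zero>\<^bsub>Q\<^esub> = fract_class R \<zero> \<one>"
  by (simp_all add: quotient_field_def)

lemma fract_class_zero:
  assumes "a \<in> carrier R" "b \<in> carrier R" "b \<noteq> \<zero>"
  shows "fract_class R a b = \<zero>\<^bsub>Q\<^esub> \<longleftrightarrow> a = \<zero>"
  unfolding Q_zero using assms by (subst fract_class_eq) auto

lemma quotient_field_cring: "cring Q"
proof (rule cringI)
  show "abelian_group Q"
  proof (rule abelian_groupI)
    fix x y assume "x \<in> carrier Q" "y \<in> carrier Q"
    then obtain a b c d where h: "a \<in> carrier R" "b \<in> carrier R" "b \<noteq> \<zero>" "x = fract_class R a b"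
      "c \<in> carrier R" "d \<in> carrier R" "d \<noteq> \<zero>" "y = fract_class R c d"
      by (elim Q_cases) blast
    show "x \<oplus>\<^bsub>Q\<^esub> y \<in> carrier Q"
      unfolding h(4,8) Q_add[OF h(1-3,5-7)] by (rule fract_class_in_Q) (use h(1-3,5-7) in \<open>auto simp: integral_iff\<close>)
    show "x \<oplus>\<^bsub>Q\<^esub> y = y \<oplus>\<^bsub>Q\<^esub> x"
      unfolding h(4,8) Q_add[OF h(1-3,5-7)] Q_add[OF h(5-7,1-3)]
      using h(1,2,5,6) by (simp add: m_comm a_comm)
  next
    fix x y z assume "x \<in> carrier Q" "y \<in> carrier Q" "z \<in> carrier Q"
    then obtain a b c d e f where h: "a \<in> carrier R" "b \<in> carrier R" "b \<noteq> \<zero>" "x = fract_class R a b"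
      "c \<in> carrier R" "d \<in> carrier R" "d \<noteq> \<zero>" "y = fract_class R c d"
      "e \<in> carrier R" "f \<in> carrier R" "f \<noteq> \<zero>" "z = fract_class R e f"
      by (elim Q_cases) blast
    then show "x \<oplus>\<^bsub>Q\<^esub> y \<oplus>\<^bsub>Q\<^esub> z = x \<oplus>\<^bsub>Q\<^esub> (y \<oplus>\<^bsub>Q\<^esub> z)"
      by (simp add: Q_add integral_iff l_distr r_distr m_ac a_ac)
  next
    show "\<zero>\<^bsub>Q\<^esub> \<in> carrier Q" unfolding Q_zero by (intro fract_class_in_Q) auto
  next
    fix x assume "x \<in> carrier Q"
    then obtain a b where h: "a \<in> carrier R" "b \<in> carrier R" "b \<noteq> \<zero>" "x = fract_class R a b"
      by (elim Q_cases) blast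
    then show "\<zero>\<^bsub>Q\<^esub> \<oplus>\<^bsub>Q\<^esub> x = x" unfolding Q_zero by (simp add: Q_add)
    have "fract_class R (\<ominus> a) b \<oplus>\<^bsub>Q\<^esub> x = \<zero>\<^bsub>Q\<^esub>"
      using h by (simp add: Q_add fract_class_zero integral_iff l_minus l_neg)
    moreover have "fract_class R (\<ominus> a) b \<in> carrier Q" using h by (intro fract_class_in_Q) auto
    ultimately show "\<exists>y\<in>carrier Q. y \<oplus>\<^bsub>Q\<^esub> x = \<zero>\<^bsub>Q\<^esub>" by blast
  qed
next
  show "comm_monoid Q"
  proof (rule comm_monoidI)
    fix x y assume "x \<in> carrier Q" "y \<in> carrier Q"
    then obtain a b c d where h: "a \<in> carrier R" "b \<in> carrier R" "b \<noteq> \<zero>" "x = fract_class R a b"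
      "c \<in> carrier R" "d \<in> carrier R" "d \<noteq> \<zero>" "y = fract_class R c d"
      by (elim Q_cases) blast
    show "x \<otimes>\<^bsub>Q\<^esub> y \<in> carrier Q"
      unfolding h(4,8) Q_mult[OF h(1-3,5-7)] by (rule fract_class_in_Q) (use h(1-3,5-7) in \<open>auto simp: integral_iff\<close>)
    show "x \<otimes>\<^bsub>Q\<^esub> y = y \<otimes>\<^bsub>Q\<^esub> x"
      unfolding h(4,8) Q_mult[OF h(1-3,5-7)] Q_mult[OF h(5-7,1-3)]
      using h(1,2,5,6) by (simp add: m_comm)
  next
    fix x y z assume "x \<in> carrier Q" "y \<in> carrier Q" "z \<in> carrier Q"
    then obtain a b c d e f where h: "a \<in> carrier R" "b \<in> carrier R" "b \<noteq> \<zero>" "x = fract_class R a b"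
      "c \<in> carrier R" "d \<in> carrier R" "d \<noteq> \<zero>" "y = fract_class R c d"
      "e \<in> carrier R" "f \<in> carrier R" "f \<noteq> \<zero>" "z = fract_class R e f"
      by (elim Q_cases) blast
    then show "x \<otimes>\<^bsub>Q\<^esub> y \<otimes>\<^bsub>Q\<^esub> z = x \<otimes>\<^bsub>Q\<^esub> (y \<otimes>\<^bsub>Q\<^esub> z)"
      by (simp add: Q_mult integral_iff m_ac)
  next
    show "\<one>\<^bsub>Q\<^esub> \<in> carrier Q" unfolding Q_one by (intro fract_class_in_Q) auto
  next
    fix x assume "x \<in> carrier Q"
    then obtain a b where h: "a \<in> carrier R" "b \<in> carrier R" "b \<noteq> \<zero>" "x = fract_class R a b"
      by (elim Q_cases) blast
    then show "\<one>\<^bsub>Q\<^esub> \<otimes>\<^bsub>Q\<^esub> x = x" unfolding Q_one by (simp add: Q_mult)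
  qed
next
  fix x y z assume "x \<in> carrier Q" "y \<in> carrier Q" "z \<in> carrier Q"
  then obtain a b c d e f where h: "a \<in> carrier R" "b \<in> carrier R" "b \<noteq> \<zero>" "x = fract_class R a b"
    "c \<in> carrier R" "d \<in> carrier R" "d \<noteq> \<zero>" "y = fract_class R c d"
    "e \<in> carrier R" "f \<in> carrier R" "f \<noteq> \<zero>" "z = fract_class R e f"
      by (elim Q_cases) blast
  then show "(x \<oplus>\<^bsub>Q\<^esub> y) \<otimes>\<^bsub>Q\<^esub> z = x \<otimes>\<^bsub>Q\<^esub> z \<oplus>\<^bsub>Q\<^esub> y \<otimes>\<^bsub>Q\<^esub> z"
    by (simp add: Q_add Q_mult integral_iff fract_class_eq) (simp add: l_distr r_distr m_ac)
qed

lemma quotient_field_field: "field Q"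
proof (rule cring.cring_fieldI2[OF quotient_field_cring])
  show "\<zero>\<^bsub>Q\<^esub> \<noteq> \<one>\<^bsub>Q\<^esub>"
    unfolding Q_one using fract_class_zero[of \<one> \<one>] by auto
  fix x assume x: "x \<in> carrier Q" "x \<noteq> \<zero>\<^bsub>Q\<^esub>"
  then obtain a b where h: "a \<in> carrier R" "b \<in> carrier R" "b \<noteq> \<zero>" "x = fract_class R a b"
    by (elim Q_cases) blast
  then have a: "a \<noteq> \<zero>" using x fract_class_zero by auto
  have "x \<otimes>\<^bsub>Q\<^esub> fract_class R b a = \<one>\<^bsub>Q\<^esub>"
    unfolding Q_one h(4) using h a by (simp add: Q_mult fract_class_eq integral_iff m_comm)
  then show "\<exists>y\<in>carrier Q. x \<otimes>\<^bsub>Q\<^esub> y = \<one>\<^bsub>Q\<^esub>" using h a fract_class_in_Q by blast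
qed

lemma to_frac_hom: "ring_hom_ring R Q (to_frac R)"
proof (rule ring_hom_ringI2)
  show "ring R" by (rule ring_axioms)
  show "ring Q" using quotient_field_cring by (simp add: cring_def)
  show "to_frac R \<in> ring_hom R Q"
    by (rule ring_hom_memI)
      (auto simp: to_frac_def Q_mult Q_add Q_one intro: fract_class_in_Q)
qed

lemma to_frac_zero: "a \<in> carrier R \<Longrightarrow> to_frac R a = \<zero>\<^bsub>Q\<^esub> \<longleftrightarrow> a = \<zero>"
  unfolding to_frac_def by (rule fract_class_zero) auto

end

section \<open>Near weights are pole orders\<close>

context normalized_near_weight
begin

text \<open>
  The weight as an integer; at zero, where the weight is minus infinity, the value \<open>0\<close> is a mere
  default.
\<close>

definition deg :: "'a \<Rightarrow> int" where
  "deg f = (case \<rho> f of Fin n \<Rightarrow> n | _ \<Rightarrow> 0)"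

abbreviation "M \<equiv> nw_M R \<rho>"

lemma F_carrier: "l \<in> F \<Longrightarrow> l \<in> carrier R" using F_proper by auto

lemma one_nonzero: "\<one> \<noteq> \<zero>" by (rule subfieldE(6)[OF F_subfield])

lemma rho_one: "\<rho> \<one> = 0"
  by (rule normalized_U) (use one_nonzero in \<open>auto simp: nw_U_star_def\<close>)

lemma rho_deg:
  assumes "f \<in> carrier R" "f \<noteq> \<zero>"
  shows "\<rho> f = Fin (deg f)" "0 \<le> deg f"
  using rho_range[OF assms(1)] N0[OF assms(1)] assms(2) by (auto simp: deg_def)

lemma M_iff: "f \<in> M \<longleftrightarrow> f \<in> carrier R \<and> f \<noteq> \<zero> \<and> 0 < deg f"
proof -
  have "f \<notin> M" if "f = \<zero>" using that N0[of \<zero>] rho_one by (auto simp: nw_M_def zero_extended_def)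
  moreover have "f \<in> M \<longleftrightarrow> 0 < deg f" if "f \<in> carrier R" "f \<noteq> \<zero>"
    using that rho_deg[OF that] rho_one by (auto simp: nw_M_def zero_extended_def)
  moreover have "f \<in> carrier R" if "f \<in> M" using that by (auto simp: nw_M_def)
  ultimately show ?thesis by blast
qed

lemma M_D: "f \<in> M \<Longrightarrow> f \<in> carrier R" "f \<in> M \<Longrightarrow> f \<noteq> \<zero>" "f \<in> M \<Longrightarrow> 0 < deg f"
  using M_iff by blast+

lemma not_M_deg: "\<lbrakk>f \<in> carrier R; f \<noteq> \<zero>; f \<notin> M\<rbrakk> \<Longrightarrow> deg f = 0"
  using M_iff rho_deg(2)[of f] by force

lemma not_M_U: "f \<in> carrier R \<Longrightarrow> f \<notin> M \<Longrightarrow> f \<in> nw_U R \<rho>"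
  by (auto simp: nw_U_def nw_U_star_def nw_M_def)

lemma M_nonempty: "\<exists>m. m \<in> M"
proof (rule ccontr)
  assume "\<nexists>m. m \<in> M"
  then have "{n. \<exists>f \<in> M. \<rho> f = Fin n} = {}" by auto
  then show False using normalized_Gcd by simp
qed

lemma mult_M_nonzero:
  assumes "f \<in> carrier R" "f \<noteq> \<zero>" "h \<in> M"
  shows "f \<otimes> h \<noteq> \<zero>"
proof
  assume z: "f \<otimes> h = \<zero>"
  have "\<rho> \<zero> = Minf" using N0[of \<zero>] by simp
  then have "\<rho> (\<zero> \<otimes> h) < \<rho> (f \<otimes> h)"
    using N3_strict[OF zero_closed assms(1,3)] rho_deg[OF assms(1,2)] by simp
  then show False using z M_D(1)[OF assms(3)] by simp
qed

lemma deg_mult: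
  assumes "f \<in> M" "g \<in> M" shows "f \<otimes> g \<in> M" "deg (f \<otimes> g) = deg f + deg g"
proof -
  note f = M_D[OF assms(1)] and g = M_D[OF assms(2)]
  have "f \<otimes> g \<noteq> \<zero>" by (rule mult_M_nonzero[OF f(1,2) assms(2)])
  then show "deg (f \<otimes> g) = deg f + deg g"
    using N5_eq[OF assms] rho_deg(1)[of "f \<otimes> g"] rho_deg(1)[OF f(1,2)] rho_deg(1)[OF g(1,2)] f(1) g(1)
    by simp
  then show "f \<otimes> g \<in> M" using \<open>f \<otimes> g \<noteq> \<zero>\<close> f g by (simp add: M_iff)
qed

lemma deg_add:
  assumes "f \<in> carrier R" "f \<noteq> \<zero>" "g \<in> carrier R" "g \<noteq> \<zero>" "f \<oplus> g \<noteq> \<zero>"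
  shows "deg (f \<oplus> g) \<le> max (deg f) (deg g)"
  using N2[OF assms(1,3)] rho_deg(1)[OF assms(1,2)] rho_deg(1)[OF assms(3,4)]
    rho_deg(1)[of "f \<oplus> g"] assms by simp

lemma deg_mult_le:
  assumes "f \<in> carrier R" "f \<noteq> \<zero>" "g \<in> carrier R" "g \<noteq> \<zero>" "f \<otimes> g \<noteq> \<zero>"
  shows "deg (f \<otimes> g) \<le> deg f + deg g"
  using N5[OF assms(1,3)] rho_deg(1)[OF assms(1,2)] rho_deg(1)[OF assms(3,4)]
    rho_deg(1)[of "f \<otimes> g"] assms by simp

lemma deg_strict:
  assumes "f \<in> carrier R" "f \<noteq> \<zero>" "g \<in> carrier R" "g \<noteq> \<zero>" "h \<in> M" "deg f < deg g"
  shows "deg (f \<otimes> h) < deg (g \<otimes> h)"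
  using N3_strict[OF assms(1,3,5)] assms(6) rho_deg(1)[OF assms(1,2)] rho_deg(1)[OF assms(3,4)]
    rho_deg(1)[OF _ mult_M_nonzero[OF assms(1,2,5)]] rho_deg(1)[OF _ mult_M_nonzero[OF assms(3,4,5)]]
    M_D(1)[OF assms(5)] assms(1,3) by simp

lemma deg_smult:
  assumes "l \<in> F" "l \<noteq> \<zero>" "f \<in> carrier R"
  shows "deg (l \<otimes> f) = deg f"
  using N1[OF assms(3)] assms(1,2) by (simp add: deg_def)

lemma deg_cancel:
  assumes "f \<in> M" "g \<in> M" "deg f = deg g"
  shows "\<exists>l\<in>F. f \<ominus> l \<otimes> g = \<zero> \<or> deg (f \<ominus> l \<otimes> g) < deg f"
proof -
  note f = M_D[OF assms(1)] and g = M_D[OF assms(2)]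
  have "\<rho> f = \<rho> g" using rho_deg(1)[OF f(1,2)] rho_deg(1)[OF g(1,2)] assms(3) by simp
  then obtain l where l: "l \<in> F" "\<rho> (f \<ominus> l \<otimes> g) < \<rho> f" using N4[OF assms(1,2)] by auto
  have c: "f \<ominus> l \<otimes> g \<in> carrier R" using f g l F_carrier by simp
  have "deg (f \<ominus> l \<otimes> g) < deg f" if "f \<ominus> l \<otimes> g \<noteq> \<zero>"
    using l(2) rho_deg(1)[OF c that] rho_deg(1)[OF f(1,2)] by simp
  then show ?thesis using l(1) by blast
qed

lemma F_not_M: "l \<in> F \<Longrightarrow> l \<notin> M"
proof
  assume l: "l \<in> F" "l \<in> M"
  then have "deg (l \<otimes> \<one>) = deg \<one>" using deg_smult[of l \<one>] M_D by auto
  moreover have "deg \<one> = 0" using rho_one by (simp add: deg_def zero_extended_def)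
  ultimately show False using M_D(1,3)[OF l(2)] by simp
qed

end

locale agreeing_weights = cring R + p: normalized_near_weight R F \<rho> + q: normalized_near_weight R F \<sigma>
  for R :: "('a, 'b) ring_scheme" (structure) and F \<rho> \<sigma> +
  assumes agree: "agree_well R F \<rho> \<sigma>"
begin

lemma agreeing_weights_swap: "agreeing_weights R F \<sigma> \<rho>"
proof -
  let ?H = "\<lambda>\<rho> \<sigma>. (\<lambda>f. (\<rho> f, \<sigma> f)) ` (carrier R - {\<zero>})"
  let ?N = "Fin ` {0::int<..} \<times> Fin ` {0::int<..}"
  have "?N - ?H \<sigma> \<rho> \<subseteq> prod.swap ` (?N - ?H \<rho> \<sigma>)"
  proof
    fix z assume z: "z \<in> ?N - ?H \<sigma> \<rho>"
    obtain a b where ab: "z = (a, b)" by (cases z)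
    have "(b, a) \<notin> ?H \<rho> \<sigma>"
    proof
      assume "(b, a) \<in> ?H \<rho> \<sigma>"
      then obtain f where "f \<in> carrier R - {\<zero>}" "b = \<rho> f" "a = \<sigma> f" by blast
      then show False using z ab by blast
    qed
    moreover have "(b, a) \<in> ?N" using z ab by blast
    ultimately have "(b, a) \<in> ?N - ?H \<rho> \<sigma>" by (rule DiffI[rotated])
    moreover have "z = prod.swap (b, a)" using ab by simp
    ultimately show "z \<in> prod.swap ` (?N - ?H \<rho> \<sigma>)" by (rule rev_image_eqI)
  qed
  moreover have "finite (?N - ?H \<rho> \<sigma>)" using agree unfolding agree_well_def by blast
  ultimately have "finite (?N - ?H \<sigma> \<rho>)" by (rule finite_subset[OF _ finite_imageI])
  moreover have "nw_U R \<sigma> \<inter> nw_U R \<rho> = F" using agree unfolding agree_well_def by blast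
  ultimately have "agree_well R F \<sigma> \<rho>" unfolding agree_well_def by (rule conjI)
  then show ?thesis by (intro agreeing_weights.intro agreeing_weights_axioms.intro
        cring_axioms p.normalized_near_weight_axioms q.normalized_near_weight_axioms)
qed

text \<open>
  The finitely many missing pairs are bounded, so it is enough that one of the two coordinates is large.
\<close>

lemma ex_degs:
  obtains N where "\<And>a b. \<lbrakk>0 < a; 0 < b; N \<le> a \<or> N \<le> b\<rbrakk>
    \<Longrightarrow> \<exists>f\<in>carrier R. f \<noteq> \<zero> \<and> p.deg f = a \<and> q.deg f = b"
proof -
  define H where "H = (\<lambda>f. (\<rho> f, \<sigma> f)) ` (carrier R - {\<zero>})"
  define Y where "Y = {(a, b). 0 < a \<and> 0 < b \<and> (Fin a, Fin b) \<notin> H}"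
  have "finite (map_prod Fin Fin ` Y)"
  proof (rule finite_subset)
    show "map_prod Fin Fin ` Y \<subseteq> Fin ` {0<..} \<times> Fin ` {0<..} - H" by (auto simp: Y_def)
    show "finite (Fin ` {0::int<..} \<times> Fin ` {0::int<..} - H)"
      using agree unfolding agree_well_def H_def by simp
  qed
  then have Y: "finite Y" by (rule finite_imageD) (auto simp: inj_on_def)
  obtain A where A: "\<And>y. y \<in> Y \<Longrightarrow> fst y \<le> A"
    using bdd_above_finite[OF finite_imageI[OF Y, of fst]] unfolding bdd_above_def by auto
  obtain B where B: "\<And>y. y \<in> Y \<Longrightarrow> snd y \<le> B"
    using bdd_above_finite[OF finite_imageI[OF Y, of snd]] unfolding bdd_above_def by auto
  define N where "N = max A B + 1"
  show thesis
  proof (rule that[of N])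
    fix a b :: int assume h: "0 < a" "0 < b" "N \<le> a \<or> N \<le> b"
    have "(a, b) \<notin> Y" using A[of "(a, b)"] B[of "(a, b)"] h(3) by (auto simp: N_def)
    then have "(Fin a, Fin b) \<in> H" using h by (auto simp: Y_def)
    then obtain f where f: "f \<in> carrier R - {\<zero>}" "(Fin a, Fin b) = (\<rho> f, \<sigma> f)"
      unfolding H_def by blast
    have "f \<in> carrier R" "f \<noteq> \<zero>" using f(1) by blast+
    moreover have "\<rho> f = Fin a" "\<sigma> f = Fin b" using f(2) by simp_all
    ultimately show "\<exists>f\<in>carrier R. f \<noteq> \<zero> \<and> p.deg f = a \<and> q.deg f = b"
      by (intro bexI[of _ f]) (auto simp: p.deg_def q.deg_def)
  qed
qed

lemma not_M_F: "\<lbrakk>f \<in> carrier R; f \<notin> p.M; f \<notin> q.M\<rbrakk> \<Longrightarrow> f \<in> F"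
  using p.not_M_U q.not_M_U agree unfolding agree_well_def by blast

text \<open>
  Multiplication by an element of positive weight is injective. If \<open>g\<close> has positive weight for neither
  \<open>\<rho>\<close> nor \<open>\<sigma>\<close>, it is a constant and hence zero or a unit.
\<close>

lemma is_domain: "domain R"
proof (rule domain.intro[OF cring_axioms], rule domain_axioms.intro)
  show "\<one> \<noteq> \<zero>" by (rule p.one_nonzero)
  fix f g assume h: "f \<otimes> g = \<zero>" "f \<in> carrier R" "g \<in> carrier R"
  show "f = \<zero> \<or> g = \<zero>"
  proof (rule ccontr)
    assume n: "\<not> (f = \<zero> \<or> g = \<zero>)"
    have "g \<in> F" using not_M_F[OF h(3)] p.mult_M_nonzero[OF h(2)] q.mult_M_nonzero[OF h(2)] n h(1) by blast
    then have "g \<otimes> inv g = \<one>" "inv g \<in> carrier R"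
      using subfield_m_inv[OF p.F_subfield, of g] n p.F_carrier by auto
    then have "f = f \<otimes> g \<otimes> inv g" using h(2,3) by (simp add: m_assoc)
    then show False using h(1) n \<open>inv g \<in> carrier R\<close> by simp
  qed
qed

end

sublocale agreeing_weights \<subseteq> domain R by (rule is_domain)

context agreeing_weights
begin

text \<open>
  Otherwise the elements \<open>g\<close> such that all multiples of \<open>g\<close> have \<open>\<rho>\<close>-weight at most \<open>0\<close> form a nonzero ideal.
  It contains no nonzero constant, since constants preserve weights, so its nonzero elements are not in \<open>F\<close> and have positive \<open>\<sigma>\<close>-weight; let
  \<open>g\<close> be one of least \<open>\<sigma>\<close>-weight. If \<open>h\<close> has \<open>\<sigma>\<close>-weight \<open>0\<close>, then \<open>g h\<close> has the same
  \<open>\<sigma>\<close>-weight as \<open>g\<close>, and by minimality \<open>N4\<close> gives \<open>g h = l g\<close>, that is \<open>h = l \<in> F\<close>. But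
  there are nonconstant elements without \<open>\<sigma>\<close>-pole: cancel the \<open>\<sigma>\<close>-poles of two elements of \<open>\<sigma>\<close>-weight \<open>1\<close>
  and distinct \<open>\<rho>\<close>-weights.
\<close>

lemma ex_multiplier:
  assumes f: "f \<in> carrier R" "f \<noteq> \<zero>"
  shows "\<exists>h\<in>p.M. f \<otimes> h \<in> p.M"
proof (rule ccontr)
  assume no: "\<not> ?thesis"
  have minus: "x \<oplus> \<ominus> y \<notin> p.M" if xy: "x \<in> carrier R" "y \<in> carrier R" "x \<notin> p.M" "y \<notin> p.M" for x y
  proof
    assume m: "x \<oplus> \<ominus> y \<in> p.M"
    have "\<ominus> \<one> \<in> F" "\<ominus> \<one> \<noteq> \<zero>"
      using subringE(3,5)[OF subfieldE(1)[OF p.F_subfield]] p.one_nonzero by (auto simp: a_inv_inj dest: arg_cong[where f = "a_inv R"])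
    then have my: "\<rho> (\<ominus> y) = \<rho> y" using p.N1[OF xy(2), of "\<ominus> \<one>"] xy(2) by (simp add: l_minus)
    have "\<rho> (x \<oplus> \<ominus> y) \<le> max (\<rho> x) (\<rho> y)" using p.N2[OF xy(1), of "\<ominus> y"] xy(2) my by simp
    then show False using m xy unfolding nw_M_def by (auto simp: max_def split: if_splits)
  qed
  \<comment> \<open>from multipliers of positive weight to all multipliers: write \<open>h = (h + m) - m\<close>\<close>
  have all: "f \<otimes> h \<notin> p.M" if h: "h \<in> carrier R" for h
  proof
    assume fh: "f \<otimes> h \<in> p.M"
    then have hM: "h \<notin> p.M" using no by blast
    obtain m where m: "m \<in> p.M" using p.M_nonempty by auto
    have mc: "m \<in> carrier R" using p.M_D(1)[OF m] .
    have "(h \<oplus> m) \<oplus> \<ominus> h = m" "f \<otimes> (h \<oplus> m) \<oplus> \<ominus> (f \<otimes> m) = f \<otimes> h"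
      using add_minus_cancel[OF h mc] add_minus_cancel[of "f \<otimes> h" "f \<otimes> m"] f h mc by (simp_all add: r_distr)
    then have "h \<oplus> m \<in> p.M" "f \<otimes> (h \<oplus> m) \<in> p.M"
      using minus[of "h \<oplus> m" h] minus[of "f \<otimes> (h \<oplus> m)" "f \<otimes> m"] h mc hM m fh no f by auto
    then show False using no by blast
  qed
  define I where "I = {g \<in> carrier R. g \<noteq> \<zero> \<and> (\<forall>h\<in>carrier R. g \<otimes> h \<notin> p.M)}"
  have fI: "f \<in> I" using f all by (simp add: I_def)
  have I_mult: "g \<otimes> h \<in> I" if "g \<in> I" "h \<in> carrier R" "h \<noteq> \<zero>" for g h
    using that by (auto simp: I_def integral_iff m_assoc)
  have I_M: "g \<in> q.M" if g: "g \<in> I" for g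
  proof (rule ccontr)
    assume n: "g \<notin> q.M"
    have gc: "g \<in> carrier R" "g \<noteq> \<zero>" using g by (auto simp: I_def)
    have "g \<otimes> \<one> \<notin> p.M" using g unfolding I_def by blast
    then have gF: "g \<in> F" using not_M_F[OF gc(1) _ n] gc by simp
    obtain m where m: "m \<in> p.M" using p.M_nonempty by auto
    note mm = p.M_D[OF m]
    have "g \<otimes> m \<in> p.M"
      using p.deg_smult[OF gF gc(2) mm(1)] mm gc by (simp add: p.M_iff integral_iff)
    then show False using g mm(1) unfolding I_def by blast
  qed
  define g where "g = (ARG_MIN (\<lambda>g. nat (q.deg g)) g. g \<in> I)"
  have g: "g \<in> I" unfolding g_def by (rule arg_min_natI[of "\<lambda>g. g \<in> I", OF fI])
  have least: "nat (q.deg g) \<le> nat (q.deg g')" if "g' \<in> I" for g'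
    unfolding g_def by (rule arg_min_nat_le[of "\<lambda>g. g \<in> I", OF that])
  have gc: "g \<in> carrier R" "g \<noteq> \<zero>" using g by (auto simp: I_def)
  have U: "h \<in> F" if h: "h \<in> carrier R" "h \<noteq> \<zero>" "h \<notin> q.M" for h
  proof -
    have gh: "g \<otimes> h \<in> I" using I_mult[OF g] h by auto
    have ghn: "g \<otimes> h \<noteq> \<zero>" using gh by (simp add: I_def)
    have "q.deg (g \<otimes> h) \<le> q.deg g" using q.deg_mult_le[OF gc h(1,2) ghn] q.not_M_deg[OF h] by simp
    then have eq: "q.deg (g \<otimes> h) = q.deg g"
      using least[OF gh] q.M_D(3)[OF I_M[OF gh]] q.M_D(3)[OF I_M[OF g]] by simp
    obtain l where l: "l \<in> F" "g \<otimes> h \<ominus> l \<otimes> g = \<zero> \<or> q.deg (g \<otimes> h \<ominus> l \<otimes> g) < q.deg (g \<otimes> h)"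
      using q.deg_cancel[OF I_M[OF gh] I_M[OF g] eq] by auto
    have lc: "l \<in> carrier R" using p.F_carrier l by auto
    have d: "g \<otimes> h \<ominus> l \<otimes> g = g \<otimes> (h \<oplus> \<ominus> l)"
      using gc h lc by (simp add: a_minus_def r_distr r_minus m_comm)
    have "h \<oplus> \<ominus> l = \<zero>"
    proof (rule ccontr)
      assume n: "h \<oplus> \<ominus> l \<noteq> \<zero>"
      then have "g \<otimes> (h \<oplus> \<ominus> l) \<in> I" using I_mult[OF g] h lc by auto
      moreover have "g \<otimes> (h \<oplus> \<ominus> l) \<noteq> \<zero>" using calculation by (simp add: I_def)
      ultimately show False using l(2) least eq q.M_D(3)[OF I_M] unfolding d by fastforce
    qed
    then have "h = l" using h lc by (metis add_minus_cancel(1) a_inv_closed minus_minus l_zero)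
    then show ?thesis using l by simp
  qed
  obtain N where N: "\<And>a b. \<lbrakk>0 < a; 0 < b; N \<le> a \<or> N \<le> b\<rbrakk>
    \<Longrightarrow> \<exists>f\<in>carrier R. f \<noteq> \<zero> \<and> p.deg f = a \<and> q.deg f = b" using ex_degs by blast
  define D where "D = max N 1"
  have D: "0 < D" "0 < D + 1" "N \<le> D" "N \<le> D + 1" unfolding D_def by linarith+
  obtain g1 where g1: "g1 \<in> carrier R" "g1 \<noteq> \<zero>" "p.deg g1 = D + 1" "q.deg g1 = 1"
    using N[OF D(2) zero_less_one disjI1[OF D(4)]] by blast
  obtain g2 where g2: "g2 \<in> carrier R" "g2 \<noteq> \<zero>" "p.deg g2 = D" "q.deg g2 = 1"
    using N[OF D(1) zero_less_one disjI1[OF D(3)]] by blast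
  have "g1 \<in> q.M" "g2 \<in> q.M" using g1 g2 by (auto simp: q.M_iff)
  then obtain l where l: "l \<in> F" "g1 \<ominus> l \<otimes> g2 = \<zero> \<or> q.deg (g1 \<ominus> l \<otimes> g2) < 1"
    using q.deg_cancel[of g1 g2] g1 g2 by auto
  have lc: "l \<in> carrier R" using p.F_carrier l by auto
  define x where "x = g1 \<ominus> l \<otimes> g2"
  have xc: "x \<in> carrier R" using g1 g2 lc by (simp add: x_def)
  have "x = \<zero> \<or> x \<notin> q.M" using l(2) unfolding x_def[symmetric] q.M_iff by auto
  then have xF: "x \<in> F" using U[OF xc] subringE(2)[OF subfieldE(1)[OF p.F_subfield]] by auto
  have e: "g1 = x \<oplus> l \<otimes> g2" using g1 g2 lc by (simp add: x_def a_minus_def a_assoc l_neg)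
  have "\<rho> (l \<otimes> g2) \<le> \<rho> g2"
  proof (cases "l = \<zero>")
    case True then show ?thesis using g2(1) p.N0[of \<zero>] by simp
  next
    case False then show ?thesis using p.N1[OF g2(1), of l] l(1) by simp
  qed
  moreover have "\<rho> x \<le> 0"
    using p.F_not_M[OF xF] xc p.rho_one by (auto simp: nw_M_def)
  moreover have "\<rho> g1 \<le> max (\<rho> x) (\<rho> (l \<otimes> g2))"
    using p.N2[OF xc, of "l \<otimes> g2"] e lc g2 by simp
  ultimately have "\<rho> g1 \<le> max 0 (\<rho> g2)" by (meson max.mono order_trans)
  then show False
    using p.rho_deg(1)[OF g1(1,2)] p.rho_deg(1)[OF g2(1,2)] g1(3) g2(3) D(1)
    by (simp add: zero_extended_def)
qed

text \<open>
  By \<open>ex_multiplier\<close> every nonzero fraction has numerator and denominator of positive weight, where the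
  weight is additive.
\<close>

definition frac_val :: "('a \<times> 'a) set \<Rightarrow> int" where
  "frac_val z = (THE n. \<exists>a\<in>p.M. \<exists>b\<in>p.M. z = fract_class R a b \<and> n = p.deg b - p.deg a)"

lemma frac_val_fract:
  assumes "a \<in> p.M" "b \<in> p.M"
  shows "frac_val (fract_class R a b) = p.deg b - p.deg a"
  unfolding frac_val_def
proof (rule the_equality)
  show "\<exists>c\<in>p.M. \<exists>d\<in>p.M. fract_class R a b = fract_class R c d \<and> p.deg b - p.deg a = p.deg d - p.deg c"
    using assms by blast
  fix n assume "\<exists>c\<in>p.M. \<exists>d\<in>p.M. fract_class R a b = fract_class R c d \<and> n = p.deg d - p.deg c"
  then obtain c d where cd: "c \<in> p.M" "d \<in> p.M" "fract_class R a b = fract_class R c d" "n = p.deg d - p.deg c"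
    by blast
  have "a \<otimes> d = c \<otimes> b"
    using cd(3) fract_class_eq[OF p.M_D(1)[OF assms(1)] p.M_D(1,2)[OF assms(2)] p.M_D(1)[OF cd(1)] p.M_D(1,2)[OF cd(2)]]
    by simp
  then have "p.deg a + p.deg d = p.deg c + p.deg b"
    using p.deg_mult(2)[OF assms(1) cd(2)] p.deg_mult(2)[OF cd(1) assms(2)] by simp
  then show "n = p.deg b - p.deg a" using cd(4) by simp
qed

lemma fract_class_expand:
  assumes "a \<in> carrier R" "b \<in> carrier R" "b \<noteq> \<zero>" "h \<in> carrier R" "h \<noteq> \<zero>"
  shows "fract_class R a b = fract_class R (a \<otimes> h) (b \<otimes> h)"
  using assms by (subst fract_class_eq) (auto simp: integral_iff m_ac)

lemma Q_nonzero_cases: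
  assumes z: "z \<in> carrier Q" "z \<noteq> \<zero>\<^bsub>Q\<^esub>"
  obtains a b where "a \<in> p.M" "b \<in> p.M" "z = fract_class R a b"
proof -
  from z(1) obtain a b where ab: "a \<in> carrier R" "b \<in> carrier R" "b \<noteq> \<zero>" "z = fract_class R a b"
    by (elim Q_cases) blast
  then have a: "a \<noteq> \<zero>" using z(2) fract_class_zero by auto
  obtain h where h: "h \<in> p.M" "a \<otimes> h \<in> p.M" using ex_multiplier[OF ab(1) a] by auto
  obtain k where k: "k \<in> p.M" "b \<otimes> k \<in> p.M" using ex_multiplier[OF ab(2,3)] by auto
  have hk: "h \<otimes> k \<in> carrier R" "h \<otimes> k \<noteq> \<zero>"
    using p.M_D(1,2)[OF p.deg_mult(1)[OF h(1) k(1)]] .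
  note hc = p.M_D(1)[OF h(1)] and kc = p.M_D(1)[OF k(1)]
  have "a \<otimes> (h \<otimes> k) \<in> p.M" "b \<otimes> (h \<otimes> k) \<in> p.M"
    using p.deg_mult(1)[OF h(2) k(1)] p.deg_mult(1)[OF k(2) h(1)] ab hc kc by (simp_all add: m_ac)
  then show ?thesis using that fract_class_expand[OF ab(1-3) hk] ab(4) by blast
qed

lemma frac_val_expand:
  assumes a: "a \<in> carrier R" "a \<noteq> \<zero>" and b: "b \<in> p.M"
  obtains h where "h \<in> p.M" "a \<otimes> h \<in> p.M"
    "frac_val (fract_class R a b) = p.deg (b \<otimes> h) - p.deg (a \<otimes> h)"
proof -
  obtain h where h: "h \<in> p.M" "a \<otimes> h \<in> p.M" using ex_multiplier[OF a] by auto
  have "frac_val (fract_class R a b) = p.deg (b \<otimes> h) - p.deg (a \<otimes> h)"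
    unfolding fract_class_expand[OF a(1) p.M_D(1,2)[OF b] p.M_D(1,2)[OF h(1)]]
    by (rule frac_val_fract[OF h(2) p.deg_mult(1)[OF b h(1)]])
  then show ?thesis using that h by blast
qed

lemma to_frac_expand:
  assumes f: "f \<in> carrier R" "f \<noteq> \<zero>"
  obtains h where "h \<in> p.M" "f \<otimes> h \<in> p.M" "to_frac R f = fract_class R (f \<otimes> h) h"
    "frac_val (to_frac R f) = p.deg h - p.deg (f \<otimes> h)"
proof -
  obtain h where h: "h \<in> p.M" "f \<otimes> h \<in> p.M" using ex_multiplier[OF f] by auto
  have "to_frac R f = fract_class R (f \<otimes> h) h"
    unfolding to_frac_def using fract_class_expand[OF f(1) one_closed one_not_zero p.M_D(1,2)[OF h(1)]]
      p.M_D(1)[OF h(1)] by simp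
  then show ?thesis using that h frac_val_fract[OF h(2,1)] by auto
qed

lemma frac_val_M:
  assumes "f \<in> p.M" shows "frac_val (to_frac R f) = - p.deg f"
proof -
  note f = p.M_D[OF assms]
  obtain h where "h \<in> p.M" "frac_val (to_frac R f) = p.deg h - p.deg (f \<otimes> h)"
    using to_frac_expand[OF f(1,2)] by blast
  then show ?thesis using p.deg_mult(2)[OF assms] by simp
qed

lemma frac_val_not_M:
  assumes "f \<in> carrier R" "f \<noteq> \<zero>" "f \<notin> p.M" shows "0 \<le> frac_val (to_frac R f)"
proof -
  obtain h where h: "h \<in> p.M" "frac_val (to_frac R f) = p.deg h - p.deg (f \<otimes> h)"
    using to_frac_expand[OF assms(1,2)] by blast
  have "p.deg (f \<otimes> h) \<le> p.deg f + p.deg h"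
    using assms p.M_D[OF h(1)] by (intro p.deg_mult_le) (auto simp: integral_iff)
  then show ?thesis using h(2) p.not_M_deg[OF assms] by simp
qed

lemma F_image_subfield: "subfield (to_frac R ` F) Q"
  using ring_hom_ring.img_is_subfield(2)[OF to_frac_hom p.F_subfield]
    domain.one_not_zero[OF field.axioms(1)[OF quotient_field_field]] by blast

lemma Q_uminus:
  assumes "a \<in> carrier R" "b \<in> carrier R" "b \<noteq> \<zero>"
  shows "\<ominus>\<^bsub>Q\<^esub> fract_class R a b = fract_class R (\<ominus> a) b"
proof -
  interpret Q: field Q by (rule quotient_field_field)
  show ?thesis
  proof (rule Q.minus_equality)
    show "fract_class R (\<ominus> a) b \<oplus>\<^bsub>Q\<^esub> fract_class R a b = \<zero>\<^bsub>Q\<^esub>"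
      using assms by (simp add: Q_add fract_class_zero integral_iff l_minus l_neg)
  qed (use assms in \<open>auto intro: fract_class_in_Q\<close>)
qed

text \<open>
  Sums are estimated after expanding the fraction so that the numerator of the sum has positive weight as
  well. The residue condition is \<open>N4\<close> for numerator and denominator, and its strict inequality survives the expansion
  by the strict part of \<open>N3\<close>.
\<close>

lemma frac_val_rational: "rational_valuation Q (to_frac R ` F) frac_val"
proof (rule rational_valuation.intro[OF quotient_field_field], rule rational_valuation_axioms.intro)
  interpret Q: field Q by (rule quotient_field_field)
  show "subfield (to_frac R ` F) Q" by (rule F_image_subfield)
  fix x y assume xy: "x \<in> carrier Q" "y \<in> carrier Q" "x \<noteq> \<zero>\<^bsub>Q\<^esub>" "y \<noteq> \<zero>\<^bsub>Q\<^esub>"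
  obtain a b where ab: "a \<in> p.M" "b \<in> p.M" "x = fract_class R a b" using Q_nonzero_cases[OF xy(1,3)] .
  obtain c d where cd: "c \<in> p.M" "d \<in> p.M" "y = fract_class R c d" using Q_nonzero_cases[OF xy(2,4)] .
  note a = p.M_D[OF ab(1)] and b = p.M_D[OF ab(2)] and c = p.M_D[OF cd(1)] and d = p.M_D[OF cd(2)]
  have "x \<otimes>\<^bsub>Q\<^esub> y = fract_class R (a \<otimes> c) (b \<otimes> d)" unfolding ab(3) cd(3) using a b c d by (intro Q_mult)
  then show "frac_val (x \<otimes>\<^bsub>Q\<^esub> y) = frac_val x + frac_val y"
    using frac_val_fract[OF ab(1,2)] frac_val_fract[OF cd(1,2)] ab(3) cd(3)
      frac_val_fract[OF p.deg_mult(1)[OF ab(1) cd(1)] p.deg_mult(1)[OF ab(2) cd(2)]]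
      p.deg_mult(2)[OF ab(1) cd(1)] p.deg_mult(2)[OF ab(2) cd(2)] by simp
  assume nz: "x \<oplus>\<^bsub>Q\<^esub> y \<noteq> \<zero>\<^bsub>Q\<^esub>"
  let ?n = "a \<otimes> d \<oplus> c \<otimes> b"
  have eq: "x \<oplus>\<^bsub>Q\<^esub> y = fract_class R ?n (b \<otimes> d)" unfolding ab(3) cd(3) using a b c d by (intro Q_add)
  have bd: "b \<otimes> d \<in> p.M" "p.deg (b \<otimes> d) = p.deg b + p.deg d" using p.deg_mult[OF ab(2) cd(2)] .
  have n: "?n \<in> carrier R" "?n \<noteq> \<zero>" using nz a b c d p.M_D[OF bd(1)] unfolding eq by (auto simp: fract_class_zero)
  obtain h where h: "h \<in> p.M" "?n \<otimes> h \<in> p.M"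
    "frac_val (x \<oplus>\<^bsub>Q\<^esub> y) = p.deg (b \<otimes> d \<otimes> h) - p.deg (?n \<otimes> h)"
    using frac_val_expand[OF n bd(1)] eq by metis
  note hc = p.M_D[OF h(1)]
  have adh: "a \<otimes> d \<otimes> h \<in> p.M" "p.deg (a \<otimes> d \<otimes> h) = p.deg a + p.deg d + p.deg h"
    using p.deg_mult[OF p.deg_mult(1)[OF ab(1) cd(2)] h(1)] p.deg_mult(2)[OF ab(1) cd(2)] by auto
  have cbh: "c \<otimes> b \<otimes> h \<in> p.M" "p.deg (c \<otimes> b \<otimes> h) = p.deg c + p.deg b + p.deg h"
    using p.deg_mult[OF p.deg_mult(1)[OF cd(1) ab(2)] h(1)] p.deg_mult(2)[OF cd(1) ab(2)] by auto
  have dist: "?n \<otimes> h = a \<otimes> d \<otimes> h \<oplus> c \<otimes> b \<otimes> h" using a b c d hc by (simp add: l_distr)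
  have "p.deg (?n \<otimes> h) \<le> max (p.deg (a \<otimes> d \<otimes> h)) (p.deg (c \<otimes> b \<otimes> h))"
    unfolding dist using p.M_D[OF adh(1)] p.M_D[OF cbh(1)] p.M_D(2)[OF h(2)] dist by (intro p.deg_add) auto
  moreover have "p.deg (b \<otimes> d \<otimes> h) = p.deg b + p.deg d + p.deg h"
    using p.deg_mult(2)[OF bd(1) h(1)] bd(2) by simp
  ultimately show "min (frac_val x) (frac_val y) \<le> frac_val (x \<oplus>\<^bsub>Q\<^esub> y)"
    using h(3) adh(2) cbh(2) frac_val_fract[OF ab(1,2)] frac_val_fract[OF cd(1,2)] ab(3) cd(3) by simp
next
  obtain N where N: "\<And>a b. \<lbrakk>0 < a; 0 < b; N \<le> a \<or> N \<le> b\<rbrakk>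
    \<Longrightarrow> \<exists>f\<in>carrier R. f \<noteq> \<zero> \<and> p.deg f = a \<and> q.deg f = b" using ex_degs by blast
  define D where "D = max N 1"
  have D: "0 < D" "0 < D + 1" "N \<le> D" "N \<le> D + 1" unfolding D_def by linarith+
  obtain f g where fg: "f \<in> carrier R" "f \<noteq> \<zero>" "p.deg f = D" "g \<in> carrier R" "g \<noteq> \<zero>" "p.deg g = D + 1"
    using N[OF D(1,1) disjI1[OF D(3)]] N[OF D(2,1) disjI1[OF D(4)]] by blast
  then have "f \<in> p.M" "g \<in> p.M" using D by (auto simp: p.M_iff)
  then have "frac_val (fract_class R f g) = 1" using frac_val_fract fg by simp
  moreover have "fract_class R f g \<in> carrier Q" "fract_class R f g \<noteq> \<zero>\<^bsub>Q\<^esub>"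
    using fg fract_class_in_Q fract_class_zero by auto
  ultimately show "\<exists>t\<in>carrier Q. t \<noteq> \<zero>\<^bsub>Q\<^esub> \<and> frac_val t = 1" by blast
next
  fix c assume c: "c \<in> to_frac R ` F" "c \<noteq> \<zero>\<^bsub>Q\<^esub>"
  then obtain l where l: "l \<in> F" "c = to_frac R l" by auto
  then have lc: "l \<in> carrier R" "l \<noteq> \<zero>" using p.F_carrier c to_frac_zero by auto
  obtain h where "h \<in> p.M" "frac_val c = p.deg h - p.deg (l \<otimes> h)"
    using to_frac_expand[OF lc] l(2) by blast
  then show "frac_val c = 0" using p.deg_smult[OF l(1) lc(2)] p.M_D(1) by simp
next
  fix x assume x: "x \<in> carrier Q" "x \<noteq> \<zero>\<^bsub>Q\<^esub>" "frac_val x = 0"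
  obtain a b where ab: "a \<in> p.M" "b \<in> p.M" "x = fract_class R a b" using Q_nonzero_cases[OF x(1,2)] .
  note a = p.M_D[OF ab(1)] and b = p.M_D[OF ab(2)]
  have "p.deg a = p.deg b" using x(3) frac_val_fract[OF ab(1,2)] ab(3) by simp
  then obtain l where l: "l \<in> F" "a \<ominus> l \<otimes> b = \<zero> \<or> p.deg (a \<ominus> l \<otimes> b) < p.deg a"
    using p.deg_cancel[OF ab(1,2)] by auto
  have lc: "l \<in> carrier R" using p.F_carrier l by auto
  let ?n = "a \<ominus> l \<otimes> b"
  have nc: "?n \<in> carrier R" using a b lc by simp
  have eq: "x \<ominus>\<^bsub>Q\<^esub> to_frac R l = fract_class R ?n b"
    unfolding a_minus_def[of Q] to_frac_def ab(3) using a b lc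
    by (simp add: Q_uminus Q_add a_minus_def l_minus)
  have "0 < frac_val (x \<ominus>\<^bsub>Q\<^esub> to_frac R l)" if n: "?n \<noteq> \<zero>"
  proof -
    obtain h where h: "h \<in> p.M" "frac_val (x \<ominus>\<^bsub>Q\<^esub> to_frac R l) = p.deg (b \<otimes> h) - p.deg (?n \<otimes> h)"
      using frac_val_expand[OF nc n ab(2)] eq by metis
    have "p.deg ?n < p.deg b" using l(2) n \<open>p.deg a = p.deg b\<close> by simp
    then show ?thesis using p.deg_strict[OF nc n b(1,2) h(1)] h(2) by simp
  qed
  moreover have "x \<ominus>\<^bsub>Q\<^esub> to_frac R l = \<zero>\<^bsub>Q\<^esub>" if "?n = \<zero>"
    unfolding eq using fract_class_zero[OF nc b(1,2)] that by simp
  ultimately show "\<exists>c\<in>to_frac R ` F. x \<ominus>\<^bsub>Q\<^esub> c = \<zero>\<^bsub>Q\<^esub> \<or> 0 < frac_val (x \<ominus>\<^bsub>Q\<^esub> c)"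
    using l(1) by blast
qed

lemma frac_val_derived:
  "derived_from R \<rho> (place_val Q (to_frac R ` F) (rational_valuation.vge Q frac_val 1) \<circ> to_frac R)"
proof -
  interpret v: rational_valuation Q "to_frac R ` F" frac_val by (rule frac_val_rational)
  show ?thesis
    unfolding derived_from_def
  proof
    fix f assume f: "f \<in> carrier R"
    let ?v = "(place_val Q (to_frac R ` F) (v.vge 1) \<circ> to_frac R) f"
    have fQ: "to_frac R f \<in> carrier Q" unfolding to_frac_def using f by (intro fract_class_in_Q) auto
    show "\<rho> f = (if f = \<zero> then Minf else if 0 \<le> ?v then 0 else - ?v)"
    proof (cases "f = \<zero>")
      case True then show ?thesis using p.N0[OF f] by simp
    next
      case False
      have v: "?v = Fin (frac_val (to_frac R f))"
        using v.place_val_vge[OF fQ] to_frac_zero[OF f] False by simp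
      show ?thesis
      proof (cases "f \<in> p.M")
        case True
        then show ?thesis using v frac_val_M[OF True] p.rho_deg(1)[OF f False] p.M_D(3)[OF True] False
          by (simp add: zero_extended_def)
      next
        case nM: False
        then show ?thesis using v frac_val_not_M[OF f False nM] p.rho_deg(1)[OF f False] p.not_M_deg[OF f False nM] False
          by (simp add: zero_extended_def)
      qed
    qed
  qed
qed

end

lemma (in agreeing_weights) two_points:
  "two_point_ring Q (to_frac R ` F) frac_val (agreeing_weights.frac_val R \<sigma>) (to_frac R ` carrier R)"
proof -
  interpret s: agreeing_weights R F \<sigma> \<rho> by (rule agreeing_weights_swap)
  interpret v: rational_valuation Q "to_frac R ` F" frac_val by (rule frac_val_rational)
  interpret w: rational_valuation Q "to_frac R ` F" s.frac_val by (rule s.frac_val_rational)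
  interpret i: ring_hom_ring R Q "to_frac R" by (rule to_frac_hom)
  show ?thesis
  proof (intro two_point_ring.intro two_point_ring_axioms.intro)
    show "rational_valuation Q (to_frac R ` F) frac_val" by (rule frac_val_rational)
    show "rational_valuation Q (to_frac R ` F) s.frac_val" by (rule s.frac_val_rational)
    show "subring (to_frac R ` carrier R) Q" by (rule i.img_is_subring[OF carrier_is_subring])
    show "to_frac R ` F \<subseteq> to_frac R ` carrier R" using p.F_carrier by auto
  next
    fix z assume "z \<in> carrier Q"
    then obtain a b where ab: "a \<in> carrier R" "b \<in> carrier R" "b \<noteq> \<zero>" "z = fract_class R a b"
      by (elim Q_cases) blast
    have "z \<otimes>\<^bsub>Q\<^esub> to_frac R b = to_frac R a"
      unfolding ab(4) to_frac_def using ab(1-3) by (simp add: Q_mult fract_class_eq integral_iff)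
    then show "\<exists>b\<in>to_frac R ` carrier R. b \<noteq> \<zero>\<^bsub>Q\<^esub> \<and> z \<otimes>\<^bsub>Q\<^esub> b \<in> to_frac R ` carrier R"
      using ab to_frac_zero by (intro bexI[of _ "to_frac R b"]) auto
  next
    show "to_frac R ` carrier R \<inter> v.vge 0 \<inter> w.vge 0 \<subseteq> to_frac R ` F"
    proof
      fix z assume z: "z \<in> to_frac R ` carrier R \<inter> v.vge 0 \<inter> w.vge 0"
      then obtain f where f: "f \<in> carrier R" "z = to_frac R f" by auto
      have "f \<notin> p.M"
      proof
        assume "f \<in> p.M"
        then show False using frac_val_M[of f] p.M_D[of f] z v.vgeD[of z 0] to_frac_zero[OF f(1)] f(2) by auto
      qed
      moreover have "f \<notin> q.M"
      proof
        assume "f \<in> q.M"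
        then show False using s.frac_val_M[of f] q.M_D[of f] z w.vgeD[of z 0] to_frac_zero[OF f(1)] f(2) by auto
      qed
      ultimately show "z \<in> to_frac R ` F" using not_M_F[OF f(1)] f(2) by blast
    qed
  next
    obtain N where N: "\<And>a b. \<lbrakk>0 < a; 0 < b; N \<le> a \<or> N \<le> b\<rbrakk>
      \<Longrightarrow> \<exists>f\<in>carrier R. f \<noteq> \<zero> \<and> p.deg f = a \<and> q.deg f = b" using ex_degs by blast
    show "\<exists>N. \<forall>a\<ge>N. \<forall>b\<ge>N. \<exists>f\<in>to_frac R ` carrier R. f \<noteq> \<zero>\<^bsub>Q\<^esub> \<and> frac_val f = - a \<and> s.frac_val f = - b"
    proof (rule exI[of _ "max N 1"], intro allI impI)
      fix a b assume ab: "max N 1 \<le> a" "max N 1 \<le> b"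
      then have "0 < a" "0 < b" "N \<le> a" by auto
      then obtain f where f: "f \<in> carrier R" "f \<noteq> \<zero>" "p.deg f = a" "q.deg f = b" using N by blast
      then have "f \<in> p.M" "f \<in> q.M" using ab by (auto simp: p.M_iff q.M_iff)
      then have "frac_val (to_frac R f) = - a" "s.frac_val (to_frac R f) = - b"
        using frac_val_M s.frac_val_M f by auto
      then show "\<exists>f\<in>to_frac R ` carrier R. f \<noteq> \<zero>\<^bsub>Q\<^esub> \<and> frac_val f = - a \<and> s.frac_val f = - b"
        using f(1,2) to_frac_zero by blast
    qed
  qed
qed

section \<open>Well agreeing near weights\<close>

theorem theorem5p5:
  fixes R :: "('a, 'b) ring_scheme"
    and F :: "'a set"
    and \<rho> \<sigma> :: "'a \<Rightarrow> int extended"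
  assumes "cring R" and "subfield F R" and "F \<subset> carrier R"
    and "normalized_near_weight R F \<rho>" and "normalized_near_weight R F \<sigma>"
    and "agree_well R F \<rho> \<sigma>"
  shows "domain R \<and>
    (let K = quotient_field R; \<iota> = to_frac R; k = \<iota> ` F in
       function_field K k \<and>
       (\<exists>P \<in> places K k. \<exists>Q \<in> places K k. P \<noteq> Q \<and>
          derived_from R \<rho> (place_val K k P \<circ> \<iota>) \<and>
          derived_from R \<sigma> (place_val K k Q \<circ> \<iota>) \<and>
          integral_closure K (\<iota> ` carrier R) =
            carrier K \<inter> (\<Inter>S \<in> places K k - {P, Q}. place_ring K k S)))"
proof -
  interpret a: agreeing_weights R F \<rho> \<sigma>
    by (intro agreeing_weights.intro agreeing_weights_axioms.intro assms)
  interpret b: agreeing_weights R F \<sigma> \<rho> by (rule a.agreeing_weights_swap)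
  interpret t: two_point_ring "quotient_field R" "to_frac R ` F" a.frac_val b.frac_val "to_frac R ` carrier R"
    by (rule a.two_points)
  show ?thesis
    unfolding Let_def
    using a.is_domain t.is_function_field t.v.vge_in_places t.w.vge_in_places t.distinct_places
      a.frac_val_derived b.frac_val_derived t.integral_closure_eq_places
    by blast
qed

end
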